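(* The reduced homology group $\tilde H_{n-2}(\bar\Pi^2_n)$ of the order complex of $\bar\Pi^2_n$, viewed as a representation of $\mathfrak S_n$, has character $\sigma\mapsto(-1)^{n-z(\sigma)}(n-1)^{z(\sigma)-1}$, where $z(\sigma)$ is the number of cycles of $\sigma$.
   Context: $\Pi_n$: set partitions of $\{1,\dots,n\}$; $NC_n$: noncrossing set partitions; both ordered so that $\pi\leq\tau$ iff $\tau$ refines $\pi$. $\Pi^2_n$ is the set of triples $(\pi,\rho,\lambda)$ with $\pi\in NC_n$, $\rho\in\Pi_n$, $\lambda$ a bijection from blocks of $\pi$ to blocks of $\rho$ with $|\lambda(B)|=|B|$, ordered by $(\pi,\rho,\lambda)\geq(\pi',\rho',\lambda')$ iff $\pi$ refines $\pi'$, $\rho$ refines $\rho'$, and $\lambda'(\biguplus_iB_i)=\biguplus_i\lambda(B_i)$ whenever $\biguplus_iB_i\in\pi'$ with $B_i\in\pi$. It has a unique minimum $(0_n,0_n,\mathrm{id})$ where $0_n$ is the one-block partition. $\bar\Pi^2_n$ is $\Pi^2_n$ with its minimum removed; its order complex is the simplicial complex of strict chains of $\bar\Pi^2_n$, and reduced simplicial homology is taken with coefficients in a field of characteristic zero. $\mathfrak S_n$ acts on $\Pi^2_n$ by $\sigma\cdot(\pi,\rho,\lambda)=(\pi,\sigma\cdot\rho,\sigma\circ\lambda)$, where $\sigma$ acts on sets and set partitions elementwise; this action preserves the order and hence acts on chains and on homology. *)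

theory Defs
  imports
    "HOL-Library.Disjoint_Sets"
    "HOL-Library.FuncSet"
    "HOL-Library.Poly_Mapping"
    "HOL-Combinatorics.Permutations"
    "HOL-Combinatorics.Orbits"
    "HOL-Algebra.AbelCoset"
    "Jordan_Normal_Form.VS_Connect"
begin

section \<open>Linear algebra\<close>

text \<open>The fields \<open>mult\<close> and \<open>one\<close> of a module record are never used; they are
  filled with dummy values below.\<close>

definition quotient_module ::
  "('k, 'v, 'm) module_scheme \<Rightarrow> 'v set \<Rightarrow> ('k, 'v set) module" where
  "quotient_module V W =
     \<lparr>carrier = a_rcosets\<^bsub>V\<^esub> W,
      mult = (\<lambda>X Y. W),
      one = W,
      zero = W,
      add = (\<lambda>X Y. X <+>\<^bsub>V\<^esub> Y),
      smult = (\<lambda>c X. \<Union>x\<in>X. W +>\<^bsub>V\<^esub> (c \<odot>\<^bsub>V\<^esub> x))\<rparr>"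

definition (in vectorspace) coords :: "'c set \<Rightarrow> 'c \<Rightarrow> 'c \<Rightarrow> 'a" where
  "coords B v = (THE a. a \<in> B \<rightarrow>\<^sub>E carrier K \<and> lincomb a B = v)"

text \<open>The trace of an endomorphism of a finite-dimensional space: the sum of the diagonal
  entries of its matrix in some basis (the value does not depend on the basis).\<close>

definition (in vectorspace) trace :: "('c \<Rightarrow> 'c) \<Rightarrow> 'a" where
  "trace f = (let B = (SOME B. finite B \<and> basis B)
              in (\<Oplus>\<^bsub>K\<^esub>b\<in>B. coords B (f b) b))"


section \<open>Reduced simplicial homology of order complexes\<close>

text \<open>A poset is given by its ground set \<open>P\<close> and its strict order \<open>lt\<close>.
  A \<open>d\<close>-simplex of the order complex, i.e. a strict chain with \<open>d + 1\<close> elements, is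
  represented by the list of its vertices in increasing order, which also orients it. The
  empty chain is the only simplex of dimension \<open>-1\<close>; this makes the homology reduced.\<close>

definition order_simplices :: "'p set \<Rightarrow> ('p \<Rightarrow> 'p \<Rightarrow> bool) \<Rightarrow> int \<Rightarrow> 'p list set" where
  "order_simplices P lt d =
     {xs. set xs \<subseteq> P \<and> sorted_wrt lt xs \<and> int (length xs) = d + 1}"

definition chain_space ::
  "'p set \<Rightarrow> ('p \<Rightarrow> 'p \<Rightarrow> bool) \<Rightarrow> int \<Rightarrow> ('k::field, 'p list \<Rightarrow>\<^sub>0 'k) module" where
  "chain_space P lt d =
     \<lparr>carrier = {c. Poly_Mapping.keys c \<subseteq> order_simplices P lt d},
      mult = (\<lambda>c c'. 0),
      one = 0,
      zero = 0,
      add = (+),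
      smult = (\<lambda>a. Poly_Mapping.map ((*) a))\<rparr>"

definition boundary :: "('p list \<Rightarrow>\<^sub>0 'k::field) \<Rightarrow> ('p list \<Rightarrow>\<^sub>0 'k)" where
  "boundary c =
     (\<Sum>xs\<in>Poly_Mapping.keys c. \<Sum>i<length xs.
        Poly_Mapping.single (take i xs @ drop (Suc i) xs)
          ((- 1) ^ i * Poly_Mapping.lookup c xs))"

definition cycles ::
  "'p set \<Rightarrow> ('p \<Rightarrow> 'p \<Rightarrow> bool) \<Rightarrow> int \<Rightarrow> ('p list \<Rightarrow>\<^sub>0 'k::field) set" where
  "cycles P lt d = {c \<in> carrier (chain_space P lt d). boundary c = 0}"

definition boundaries ::
  "'p set \<Rightarrow> ('p \<Rightarrow> 'p \<Rightarrow> bool) \<Rightarrow> int \<Rightarrow> ('p list \<Rightarrow>\<^sub>0 'k::field) set" where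
  "boundaries P lt d = boundary ` carrier (chain_space P lt (d + 1))"

definition reduced_homology ::
  "'p set \<Rightarrow> ('p \<Rightarrow> 'p \<Rightarrow> bool) \<Rightarrow> int \<Rightarrow> ('k::field, ('p list \<Rightarrow>\<^sub>0 'k) set) module" where
  "reduced_homology P lt d =
     quotient_module ((chain_space P lt d)\<lparr>carrier := cycles P lt d\<rparr>) (boundaries P lt d)"

text \<open>The maps induced on chains and on homology by a strictly monotone map
  \<open>f\<close> from \<open>P\<close> to \<open>P\<close>. The latter sends the class \<open>[c]\<close> to the class
  \<open>[f c]\<close>.\<close>

definition chain_map :: "('p \<Rightarrow> 'p) \<Rightarrow> ('p list \<Rightarrow>\<^sub>0 'k::field) \<Rightarrow> ('p list \<Rightarrow>\<^sub>0 'k)" where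
  "chain_map f c =
     (\<Sum>xs\<in>Poly_Mapping.keys c.
        Poly_Mapping.single (List.map f xs) (Poly_Mapping.lookup c xs))"

definition homology_map ::
  "'p set \<Rightarrow> ('p \<Rightarrow> 'p \<Rightarrow> bool) \<Rightarrow> int \<Rightarrow> ('p \<Rightarrow> 'p) \<Rightarrow>
     ('p list \<Rightarrow>\<^sub>0 'k::field) set \<Rightarrow> ('p list \<Rightarrow>\<^sub>0 'k) set" where
  "homology_map P lt d f X =
     (\<Union>c\<in>X. boundaries P lt d +>\<^bsub>chain_space P lt d\<^esub> chain_map f c)"


section \<open>The poset of pairs of partitions\<close>

definition set_partitions :: "nat \<Rightarrow> nat set set set" where
  "set_partitions n = {\<pi>. partition_on {1..n} \<pi>}"

definition noncrossing :: "nat set set \<Rightarrow> bool" where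
  "noncrossing \<pi> \<longleftrightarrow>
     (\<forall>A\<in>\<pi>. \<forall>B\<in>\<pi>. \<forall>a b c d. a < b \<and> b < c \<and> c < d \<and>
        a \<in> A \<and> c \<in> A \<and> b \<in> B \<and> d \<in> B \<longrightarrow> A = B)"

definition nc_partitions :: "nat \<Rightarrow> nat set set set" where
  "nc_partitions n = {\<pi> \<in> set_partitions n. noncrossing \<pi>}"

type_synonym partition_pair = "nat set set \<times> nat set set \<times> (nat set \<Rightarrow> nat set)"

text \<open>The bijection of a triple is made unique as a HOL function by fixing its value
  outside the blocks of the first partition (\<open>extensional\<close>).\<close>

definition Pi2 :: "nat \<Rightarrow> partition_pair set" where
  "Pi2 n = {(\<pi>, \<rho>, l). \<pi> \<in> nc_partitions n \<and> \<rho> \<in> set_partitions n \<and>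
     l \<in> extensional \<pi> \<and> bij_betw l \<pi> \<rho> \<and> (\<forall>B\<in>\<pi>. card (l B) = card B)}"

text \<open>\<open>refines A P Q\<close> says that \<open>P\<close> is the finer partition; finer triples are larger.\<close>

fun Pi2_le :: "nat \<Rightarrow> partition_pair \<Rightarrow> partition_pair \<Rightarrow> bool" where
  "Pi2_le n (\<pi>', \<rho>', l') (\<pi>, \<rho>, l) \<longleftrightarrow>
     refines {1..n} \<pi> \<pi>' \<and> refines {1..n} \<rho> \<rho>' \<and>
     (\<forall>S \<subseteq> \<pi>. \<Union>S \<in> \<pi>' \<longrightarrow> l' (\<Union>S) = \<Union>(l ` S))"

definition Pi2_less :: "nat \<Rightarrow> partition_pair \<Rightarrow> partition_pair \<Rightarrow> bool" where
  "Pi2_less n x y \<longleftrightarrow> Pi2_le n x y \<and> x \<noteq> y"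

definition Pi2_min :: "nat \<Rightarrow> partition_pair" where
  "Pi2_min n = ({{1..n}}, {{1..n}}, \<lambda>B\<in>{{1..n}}. B)"

definition Pi2_bar :: "nat \<Rightarrow> partition_pair set" where
  "Pi2_bar n = Pi2 n - {Pi2_min n}"

fun Pi2_act :: "(nat \<Rightarrow> nat) \<Rightarrow> partition_pair \<Rightarrow> partition_pair" where
  "Pi2_act \<sigma> (\<pi>, \<rho>, l) = (\<pi>, (`) \<sigma> ` \<rho>, \<lambda>B\<in>\<pi>. \<sigma> ` l B)"

definition Pi2_character :: "nat \<Rightarrow> int \<Rightarrow> (nat \<Rightarrow> nat) \<Rightarrow> 'k::field" where
  "Pi2_character n d \<sigma> =
     vectorspace.trace class_ring (reduced_homology (Pi2_bar n) (Pi2_less n) d)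
       (homology_map (Pi2_bar n) (Pi2_less n) d (Pi2_act \<sigma>))"

text \<open>The number of cycles of a permutation of \<open>{1..n}\<close>, fixed points included.\<close>

definition num_cycles :: "nat \<Rightarrow> (nat \<Rightarrow> nat) \<Rightarrow> nat" where
  "num_cycles n \<sigma> = card (orbit \<sigma> ` {1..n})"

end

theory Submission
  imports Defs
begin

text \<open>For a permutation \<open>g\<close>, the elements \<open>(\<tau>, g \<tau>, g)\<close> of \<open>Pi2_bar n\<close> form a chamber: a copy of
  the noncrossing partition lattice without its coarsest element, hence a cone. The chambers are
  glued one after the other. Each meets the union of the earlier ones in the partitions \<open>\<tau>\<close> with
  an inversion of \<open>g\<close> inside some block. A double induction with the Mayer-Vietoris argument,
  which removes the inversion whose values are closest, shows that this intersection is acyclic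
  below its top dimension, and therefore so is \<open>Pi2_bar n\<close>. A contracting homotopy of the chain
  complex below the top dimension then expresses the character of the top homology as the
  alternating count of the chains that are fixed by \<open>\<sigma>\<close>.

  The fixed elements are noncrossing partitions whose blocks are labelled by sets of cycles of
  \<open>\<sigma>\<close>. Give such an element the product \<open>\<Phi>\<close> of \<open>(1 - |B|) ^ (z - 1)\<close> over its blocks \<open>B\<close>, where
  \<open>z\<close> is the number of cycles that label \<open>B\<close>. Then \<open>\<Phi>\<close> sums to \<open>1\<close> over the elements above any
  given one, by a recursion that rests on Hurwitz' extension of Abel's binomial identity. So the
  alternating count of the chains above an element is the value of \<open>\<Phi>\<close>, which at the minimum is
  \<open>(1 - n) ^ (z(\<sigma>) - 1)\<close>.\<close>

section \<open>Linear extension\<close>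

text \<open>A chamber meets the earlier ones in a union of principal downsets, one for each
  inversion of \<open>g\<close>. Splitting off one of them is easy; the obstacle is that what it
  shares with the rest must again be described by inversions. For this, only inversions between
  positions whose blocks can be merged without a crossing are counted, and \<open>g\<close> may be
  any injective function: the function that describes the shared part has at \<open>a\<close> a
  value above all others, so it is no permutation of {1..n}.

  On the counting side \<Phi> is forced. Up to sign it is the Moebius function from an element to an
  adjoined top, the only function whose sums over the elements above any given one are all
  \<open>1\<close>. The cycles of \<sigma> have different lengths, so each of them enters with its
  length as a weight; Abel's identity covers only equal weights, as for the identity permutation.
  The recursion does not close on labelled partitions alone. It needs an unlabelled block that holds
  the minimum, whose size is a further parameter.\<close>

abbreviation "lookup \<equiv> Poly_Mapping.lookup"
abbreviation "keys \<equiv> Poly_Mapping.keys"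
abbreviation "single \<equiv> Poly_Mapping.single"

definition cscale :: "'k::field \<Rightarrow> ('x \<Rightarrow>\<^sub>0 'k) \<Rightarrow> ('x \<Rightarrow>\<^sub>0 'k)" where
  "cscale a = Poly_Mapping.map ((*) a)"

lemma lookup_cscale [simp]: "lookup (cscale a c) x = a * lookup c x"
  unfolding cscale_def by (transfer) (auto simp: when_def)

lemma cscale_single [simp]: "cscale a (single x b) = single x (a * b)"
  by (rule poly_mapping_eqI) (simp add: lookup_single when_def)

lemma cscale_zero [simp]: "cscale a 0 = 0" "cscale 0 c = 0"
  by (rule poly_mapping_eqI; simp)+

lemma cscale_one [simp]: "cscale 1 c = c"
  by (rule poly_mapping_eqI) simp

lemma cscale_cscale [simp]: "cscale a (cscale b c) = cscale (a * b) c"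
  by (rule poly_mapping_eqI) simp

lemma cscale_add: "cscale a (c + d) = cscale a c + cscale a d"
  by (rule poly_mapping_eqI) (simp add: lookup_add algebra_simps)

lemma add_cscale: "cscale (a + b) c = cscale a c + cscale b c"
  by (rule poly_mapping_eqI) (simp add: lookup_add algebra_simps)

lemma cscale_sum: "cscale a (sum f A) = (\<Sum>x\<in>A. cscale a (f x))"
  by (rule poly_mapping_eqI) (simp add: lookup_sum sum_distrib_left)

lemma keys_cscale: "keys (cscale a c) \<subseteq> keys c"
  by (auto simp: in_keys_iff)

lemma keys_add_subset: "keys a \<subseteq> S \<Longrightarrow> keys b \<subseteq> S \<Longrightarrow> keys (a + b) \<subseteq> S"
  using Poly_Mapping.keys_add[of a b] by blast

lemma keys_diff_subset:
  "keys (a :: 'x \<Rightarrow>\<^sub>0 'k::field) \<subseteq> S \<Longrightarrow> keys b \<subseteq> S \<Longrightarrow> keys (a - b) \<subseteq> S"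
  by (simp add: subset_iff in_keys_iff lookup_minus) (metis diff_zero)

lemma keys_sum_subset: "(\<And>x. x \<in> A \<Longrightarrow> keys (f x) \<subseteq> S) \<Longrightarrow> keys (sum f A) \<subseteq> S"
  using Poly_Mapping.keys_sum[of f A] by blast

text \<open>The linear map that sends the basis vector \<open>x\<close> to \<open>f x\<close>.
  Boundary, chain maps, homotopies and projections are all of this kind, so an identity between
  their composites reduces to one on single simplices (\<open>extend_extend\<close>,
  \<open>extend_cong\<close>).\<close>

definition extend :: "('x \<Rightarrow> ('y \<Rightarrow>\<^sub>0 'k::field)) \<Rightarrow> ('x \<Rightarrow>\<^sub>0 'k) \<Rightarrow> ('y \<Rightarrow>\<^sub>0 'k)" where
  "extend f c = (\<Sum>x\<in>keys c. cscale (lookup c x) (f x))"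

lemma extend_superset:
  assumes "finite A" "keys c \<subseteq> A"
  shows "extend f c = (\<Sum>x\<in>A. cscale (lookup c x) (f x))"
  unfolding extend_def
  by (rule sum.mono_neutral_left) (use assms in \<open>auto simp: in_keys_iff\<close>)

lemma extend_zero [simp]: "extend f 0 = 0"
  by (simp add: extend_def)

lemma extend_single [simp]: "extend f (single x a) = cscale a (f x)"
  by (subst extend_superset[of "{x}"]) auto

lemma extend_add: "extend f (c + d) = extend f c + extend f d"
proof -
  let ?S = "keys c \<union> keys d"
  have "extend f c' = (\<Sum>x\<in>?S. cscale (lookup c' x) (f x))" if "keys c' \<subseteq> ?S" for c'
    using that by (intro extend_superset) auto
  from this[of c] this[of d] this[of "c + d"] show ?thesis
    by (simp add: lookup_add add_cscale sum.distrib Poly_Mapping.keys_add)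
qed

lemma extend_cscale: "extend f (cscale a c) = cscale a (extend f c)"
  by (subst (1 2) extend_superset[of "keys c"])
    (auto simp: cscale_sum dest: subsetD[OF keys_cscale])

lemma extend_minus: "extend f (- c) = - extend f c"
  using extend_add[of f c "- c"] by (simp add: eq_neg_iff_add_eq_0 add.commute)

lemma extend_diff: "extend f (c - d) = extend f c - extend f d"
  using extend_add[of f c "- d"] by (simp add: extend_minus)

lemma extend_sum: "extend f (sum g A) = (\<Sum>x\<in>A. extend f (g x))"
  by (induction A rule: infinite_finite_induct) (auto simp: extend_add)

lemma extend_extend: "extend f (extend g c) = extend (\<lambda>x. extend f (g x)) c"
  by (simp add: extend_def[of g] extend_def[of "\<lambda>x. extend f (g x)"] extend_sum extend_cscale)

lemma extend_cong: "(\<And>x. x \<in> keys c \<Longrightarrow> f x = g x) \<Longrightarrow> extend f c = extend g c"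
  by (simp add: extend_def)

lemma extend_fun_diff: "extend (\<lambda>x. f x - g x) c = extend f c - extend g c"
  by (rule poly_mapping_eqI)
    (simp add: extend_def lookup_sum lookup_minus algebra_simps sum_subtractf)

lemma extend_fun_add: "extend (\<lambda>x. f x + g x) c = extend f c + extend g c"
  by (rule poly_mapping_eqI)
    (simp add: extend_def lookup_sum lookup_add algebra_simps sum.distrib)

lemma extend_fun_cscale: "extend (\<lambda>x. cscale a (f x)) c = cscale a (extend f c)"
  by (rule poly_mapping_eqI)
    (simp add: extend_def lookup_sum sum_distrib_left algebra_simps)

lemma extend_id [simp]: "extend (\<lambda>x. single x 1) c = c"
proof (rule poly_mapping_eqI)
  fix y
  have "lookup (extend (\<lambda>x. single x 1) c) y = (\<Sum>x\<in>keys c. if x = y then lookup c x else 0)"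
    by (auto simp: extend_def lookup_sum lookup_single when_def intro!: sum.cong)
  then show "lookup (extend (\<lambda>x. single x 1) c) y = lookup c y"
    by (auto simp: in_keys_iff)
qed

lemma keys_extend: "(\<And>x. x \<in> keys c \<Longrightarrow> keys (f x) \<subseteq> S) \<Longrightarrow> keys (extend f c) \<subseteq> S"
  unfolding extend_def by (intro keys_sum_subset order_trans[OF keys_cscale])

lemma keys_split:
  fixes c :: "'x \<Rightarrow>\<^sub>0 'k::field"
  assumes "keys c \<subseteq> A \<union> B"
  obtains a b where "c = a + b" "keys a \<subseteq> A" "keys b \<subseteq> B"
proof -
  define a where "a = extend (\<lambda>x. if x \<in> A then single x 1 else 0) c"
  define b where "b = extend (\<lambda>x. if x \<in> A then 0 else single x 1) c"
  have "a + b = extend (\<lambda>x. (if x \<in> A then single x 1 else 0) + (if x \<in> A then 0 else single x 1)) c"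
    unfolding a_def b_def extend_fun_add ..
  also have "\<dots> = extend (\<lambda>x. single x 1) c"
    by (rule extend_cong) simp
  finally have "c = a + b" by simp
  moreover have "keys a \<subseteq> A" unfolding a_def by (rule keys_extend) auto
  moreover have "keys b \<subseteq> B" unfolding b_def by (rule keys_extend) (use assms in auto)
  ultimately show ?thesis by (rule that)
qed

section \<open>Acyclicity of order complexes\<close>

definition bd :: "'p list \<Rightarrow> ('p list \<Rightarrow>\<^sub>0 'k::field)" where
  "bd xs = (\<Sum>i<length xs. single (take i xs @ drop (Suc i) xs) ((- 1) ^ i))"

lemma boundary_eq_extend: "boundary c = extend bd c"
  by (simp add: boundary_def extend_def bd_def cscale_sum mult.commute)

lemma chain_map_eq_extend: "chain_map f c = extend (\<lambda>xs. single (List.map f xs) 1) c"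
  by (simp add: chain_map_def extend_def)

lemma bd_Nil [simp]: "bd [] = 0"
  by (simp add: bd_def)

abbreviation snoc :: "'p \<Rightarrow> ('p list \<Rightarrow>\<^sub>0 'k::field) \<Rightarrow> ('p list \<Rightarrow>\<^sub>0 'k)" where
  "snoc t \<equiv> extend (\<lambda>ys. single (ys @ [t]) 1)"

text \<open>Only the face that omits \<open>t\<close> is new. In every other face the omitted vertex
  keeps its index and hence its sign, which is why cone points are appended at the end.\<close>

lemma bd_snoc: "bd (xs @ [t]) = snoc t (bd xs) + single xs ((- 1) ^ length xs)"
  by (simp add: bd_def extend_sum)

lemma boundary_snoc:
  assumes "\<And>xs. xs \<in> keys c \<Longrightarrow> length xs = k"
  shows "boundary (snoc t c) = snoc t (boundary c) + cscale ((- 1) ^ k) c"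
proof -
  have "boundary (snoc t c) = extend (\<lambda>xs. snoc t (bd xs) + cscale ((- 1) ^ k) (single xs 1)) c"
    unfolding boundary_eq_extend extend_extend
    by (rule extend_cong) (simp add: assms bd_snoc)
  then show ?thesis
    by (simp only: extend_fun_add extend_fun_cscale extend_id boundary_eq_extend extend_extend)
qed

lemma length_keys_bd: "ys \<in> keys (bd xs) \<Longrightarrow> length ys = length xs - 1"
  unfolding bd_def using Poly_Mapping.keys_sum by (fastforce split: if_splits)

text \<open>For nonempty \<open>xs\<close> the boundary of \<open>bd (xs @ [t])\<close> consists of
  two multiples of \<open>bd xs\<close>. Their signs have consecutive exponents, since the faces of
  \<open>xs\<close> are one shorter than \<open>xs\<close>.\<close>

lemma boundary_bd: "boundary (bd xs :: 'p list \<Rightarrow>\<^sub>0 'k::field) = 0"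
proof (induction xs rule: rev_induct)
  case Nil
  show ?case by (simp add: boundary_eq_extend)
next
  case (snoc t xs)
  show ?case
  proof (cases xs rule: rev_cases)
    case Nil
    have "bd [t] = (single [] 1 :: 'p list \<Rightarrow>\<^sub>0 'k)" by (simp add: bd_def)
    then show ?thesis by (simp add: Nil boundary_eq_extend)
  next
    case (snoc ys y)
    have "boundary (bd (xs @ [t]) :: 'p list \<Rightarrow>\<^sub>0 'k)
      = boundary (snoc t (bd xs)) + cscale ((- 1) ^ length xs) (bd xs)"
      by (simp add: bd_snoc boundary_eq_extend extend_add)
    also have "boundary (snoc t (bd xs) :: 'p list \<Rightarrow>\<^sub>0 'k) = cscale ((- 1) ^ length ys) (bd xs)"
      by (subst boundary_snoc[where k = "length ys"])
        (auto dest: length_keys_bd simp: snoc \<open>boundary (bd xs :: 'p list \<Rightarrow>\<^sub>0 'k) = 0\<close>[unfolded snoc])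
    finally show ?thesis
      by (simp add: snoc flip: add_cscale)
  qed
qed

lemma boundary_boundary [simp]: "boundary (boundary c) = 0"
proof -
  have "boundary (boundary c) = extend (\<lambda>xs. boundary (bd xs)) c"
    by (simp add: boundary_eq_extend extend_extend)
  then show ?thesis by (simp add: boundary_bd extend_def)
qed

section \<open>Chains by length, cones and gluing\<close>

definition strict_chains :: "'p set \<Rightarrow> ('p \<Rightarrow> 'p \<Rightarrow> bool) \<Rightarrow> nat \<Rightarrow> 'p list set" where
  "strict_chains P lt k = {xs. set xs \<subseteq> P \<and> sorted_wrt lt xs \<and> length xs = k}"

lemma finite_strict_chains: "finite P \<Longrightarrow> finite (strict_chains P lt k)"
  by (rule finite_subset[OF _ finite_lists_length_eq[of P k]]) (auto simp: strict_chains_def)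

lemma keys_bd: "xs \<in> strict_chains P lt (Suc k) \<Longrightarrow> keys (bd xs) \<subseteq> strict_chains P lt k"
  unfolding bd_def
proof (rule keys_sum_subset)
  fix i assume xs: "xs \<in> strict_chains P lt (Suc k)" and i: "i \<in> {..<length xs}"
  have eq: "xs = take i xs @ xs ! i # drop (Suc i) xs"
    using i by (simp add: id_take_nth_drop)
  have "sorted_wrt lt (take i xs @ xs ! i # drop (Suc i) xs)" "set xs \<subseteq> P" "length xs = Suc k"
    using xs eq by (auto simp: strict_chains_def)
  then have "take i xs @ drop (Suc i) xs \<in> strict_chains P lt k"
    using i by (auto simp: strict_chains_def sorted_wrt_append dest: in_set_takeD in_set_dropD)
  then show "keys (single (take i xs @ drop (Suc i) xs) ((- 1) ^ i)) \<subseteq> strict_chains P lt k"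
    by (auto split: if_splits)
qed

lemma keys_boundary: "keys c \<subseteq> strict_chains P lt (Suc k) \<Longrightarrow> keys (boundary c) \<subseteq> strict_chains P lt k"
  unfolding boundary_eq_extend by (rule keys_extend, rule keys_bd) auto

lemma strict_chains_mono: "P \<subseteq> Q \<Longrightarrow> strict_chains P lt k \<subseteq> strict_chains Q lt k"
  by (auto simp: strict_chains_def)

lemma strict_chains_0 [simp]: "strict_chains P lt 0 = {[]}"
  by (auto simp: strict_chains_def)

text \<open>Chains are indexed by their number of elements, so this says that reduced homology
  vanishes in dimensions below \<open>m - 1\<close>. For \<open>k = 0\<close> it makes
  \<open>P\<close> nonempty, because the empty chain must be a boundary.\<close>

definition acyclic_below ::
  "'k::field itself \<Rightarrow> 'p set \<Rightarrow> ('p \<Rightarrow> 'p \<Rightarrow> bool) \<Rightarrow> nat \<Rightarrow> bool" where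
  "acyclic_below _ P lt m \<longleftrightarrow>
     (\<forall>k<m. \<forall>c :: 'p list \<Rightarrow>\<^sub>0 'k. keys c \<subseteq> strict_chains P lt k \<and> boundary c = 0 \<longrightarrow>
        (\<exists>b. keys b \<subseteq> strict_chains P lt (Suc k) \<and> boundary b = c))"

lemma acyclic_belowD:
  assumes "acyclic_below TYPE('k) P lt m" "k < m"
    and "keys (c :: 'p list \<Rightarrow>\<^sub>0 'k::field) \<subseteq> strict_chains P lt k" "boundary c = 0"
  obtains b where "keys b \<subseteq> strict_chains P lt (Suc k)" "boundary b = c"
  using assms unfolding acyclic_below_def by blast

lemma acyclic_below_0 [simp]: "acyclic_below TYPE('k::field) P lt 0"
  by (simp add: acyclic_below_def)

text \<open>The apex \<open>t\<close> can only be last in a chain. Let a cycle be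
  \<open>a + b\<close> with \<open>t\<close> absent from \<open>a\<close> and last in
  \<open>b\<close>. The part of its boundary without \<open>t\<close> shows that
  \<open>boundary a\<close> is, up to sign, \<open>b\<close> with \<open>t\<close> removed. So
  \<open>a\<close> with \<open>t\<close> appended has boundary \<open>a + b\<close>, up to
  sign.\<close>

lemma acyclic_below_cone:
  assumes t: "t \<in> P" and top: "\<And>x. x \<in> P \<Longrightarrow> x \<noteq> t \<Longrightarrow> lt x t" and irr: "\<not> lt t t"
    and asym: "\<And>x. x \<in> P \<Longrightarrow> \<not> lt t x"
  shows "acyclic_below TYPE('k::field) P lt m"
  unfolding acyclic_below_def
proof (intro allI impI, elim conjE)
  fix k and c :: "'a list \<Rightarrow>\<^sub>0 'k"
  assume c: "keys c \<subseteq> strict_chains P lt k" and dc: "boundary c = 0"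
  define C0 where "C0 = strict_chains (P - {t}) lt k"
  \<comment> \<open>For \<open>k = 0\<close> the truncated \<open>k - 1\<close> would admit the
    chain \<open>[t]\<close>; the condition \<open>k > 0\<close> excludes it.\<close>
  define C1 where "C1 = {ys @ [t] | ys. ys \<in> strict_chains (P - {t}) lt (k - 1) \<and> k > 0}"
  have "strict_chains P lt k \<subseteq> C0 \<union> C1"
  proof
    fix xs assume xs: "xs \<in> strict_chains P lt k"
    show "xs \<in> C0 \<union> C1"
    proof (cases "t \<in> set xs")
      case True
      then obtain ys zs where e: "xs = ys @ t # zs" by (auto simp: in_set_conv_decomp)
      then have "zs = []"
        using xs asym by (cases zs) (auto simp: strict_chains_def sorted_wrt_append)
      moreover have "t \<notin> set ys" using xs e irr by (auto simp: strict_chains_def sorted_wrt_append)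
      ultimately show ?thesis using xs e by (auto simp: strict_chains_def C1_def sorted_wrt_append)
    qed (use xs in \<open>auto simp: C0_def strict_chains_def\<close>)
  qed
  with c obtain a b where ab: "c = a + b" "keys a \<subseteq> C0" "keys b \<subseteq> C1"
    by (meson keys_split order_trans)
  define b' where "b' = extend (\<lambda>xs. single (butlast xs) 1) b"
  have b: "b = snoc t b'"
    unfolding b'_def extend_extend
    by (subst (1) extend_id[symmetric], rule extend_cong) (use ab in \<open>auto simp: C1_def\<close>)
  have kb': "keys b' \<subseteq> strict_chains (P - {t}) lt (k - 1)"
    unfolding b'_def by (rule keys_extend) (use ab in \<open>auto simp: C1_def\<close>)
  define s where "s = (- 1 :: 'k) ^ k"
  have ss: "s * s = 1" by (simp add: s_def flip: power_mult_distrib)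
  have ksn: "keys (snoc t a) \<subseteq> strict_chains P lt (Suc k)"
    by (rule keys_extend) (use ab t top in \<open>auto simp: C0_def strict_chains_def sorted_wrt_append subset_iff\<close>)
  show "\<exists>b. keys b \<subseteq> strict_chains P lt (Suc k) \<and> boundary b = c"
  proof (cases k)
    case 0
    then have "b = 0" using ab by (auto simp: C1_def)
    then show ?thesis
      using ksn ab 0 dc boundary_snoc[of a 0 t] by (intro exI[of _ "snoc t a"]) (auto simp: C0_def)
  next
    case (Suc j)
    have bb: "boundary b = snoc t (boundary b') + cscale ((-1) ^ j) b'"
      unfolding b by (rule boundary_snoc) (use kb' Suc in \<open>auto simp: strict_chains_def\<close>)
    have ba: "boundary (snoc t a) = snoc t (boundary a) + cscale s a"
      unfolding s_def by (rule boundary_snoc) (use ab in \<open>auto simp: strict_chains_def C0_def\<close>)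
    have ka: "keys (boundary a) \<subseteq> strict_chains (P - {t}) lt j"
      using ab Suc by (intro keys_boundary) (simp add: C0_def)
    have eq0: "boundary a + cscale ((-1) ^ j) b' + snoc t (boundary b') = 0"
      using dc ab(1) bb by (simp add: boundary_eq_extend extend_add algebra_simps)
    \<comment> \<open>Chains with \<open>t\<close> and chains without it have disjoint supports, so
      the part of \<open>eq0\<close> without \<open>t\<close> vanishes by itself.\<close>
    have "keys (snoc t (boundary b')) \<inter> strict_chains (P - {t}) lt j = {}"
    proof -
      have "keys (snoc t (boundary b')) \<subseteq> {xs. t \<in> set xs}"
        by (rule keys_extend) auto
      then show ?thesis by (auto simp: strict_chains_def)
    qed
    then have "lookup (boundary a + cscale ((-1) ^ j) b') xs = 0" for xs
    proof (cases "xs \<in> strict_chains (P - {t}) lt j")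
      case True
      with \<open>_ = {}\<close> have "lookup (snoc t (boundary b')) xs = 0"
        by (auto simp: in_keys_iff)
      with arg_cong[OF eq0, of "\<lambda>p. lookup p xs"] show ?thesis by (simp add: lookup_add)
    next
      case False
      with ka kb' Suc have "xs \<notin> keys (boundary a)" "xs \<notin> keys b'" by auto
      then show ?thesis by (simp add: lookup_add in_keys_iff)
    qed
    then have "boundary a + cscale ((-1) ^ j) b' = 0" by (intro poly_mapping_eqI) simp
    then have "boundary a = cscale s b'"
      unfolding s_def Suc by (simp add: eq_neg_iff_add_eq_0 poly_mapping_eq_iff fun_eq_iff lookup_add)
    then have "boundary (snoc t a) = cscale s (a + b)"
      unfolding ba b by (simp add: extend_cscale cscale_add)
    then have "boundary (cscale s (snoc t a)) = c"
      by (simp add: boundary_eq_extend extend_cscale ss ab)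
    with order_trans[OF keys_cscale ksn] show ?thesis by blast
  qed
qed

text \<open>Both sets are downsets of the union, so the last element of a chain decides where the
  whole chain lies, and a cycle splits as \<open>a + b\<close>. The common boundary of
  \<open>a\<close> and \<open>- b\<close> is a cycle of \<open>A \<inter> B\<close> whose chains are
  one element shorter, hence \<open>m - 1\<close> there. A chain \<open>f\<close> of the
  intersection with this boundary leaves the cycles \<open>a - f\<close> and \<open>b + f\<close>,
  which can be filled in \<open>A\<close> and in \<open>B\<close>.\<close>

lemma acyclic_below_Un:
  assumes A: "acyclic_below TYPE('k::field) A lt m" and B: "acyclic_below TYPE('k) B lt m"
    and AB: "acyclic_below TYPE('k) (A \<inter> B) lt (m - 1)"
    and down: "\<And>x y. x \<in> A \<union> B \<Longrightarrow> y \<in> A \<Longrightarrow> lt x y \<Longrightarrow> x \<in> A"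
      "\<And>x y. x \<in> A \<union> B \<Longrightarrow> y \<in> B \<Longrightarrow> lt x y \<Longrightarrow> x \<in> B"
  shows "acyclic_below TYPE('k) (A \<union> B) lt m"
  unfolding acyclic_below_def
proof (intro allI impI, elim conjE)
  fix k and c :: "'a list \<Rightarrow>\<^sub>0 'k"
  assume k: "k < m" and c: "keys c \<subseteq> strict_chains (A \<union> B) lt k" and dc: "boundary c = 0"
  have "strict_chains (A \<union> B) lt k \<subseteq> strict_chains A lt k \<union> strict_chains B lt k"
  proof
    fix xs assume xs: "xs \<in> strict_chains (A \<union> B) lt k"
    show "xs \<in> strict_chains A lt k \<union> strict_chains B lt k"
    proof (cases xs rule: rev_cases)
      case Nil
      then show ?thesis using xs by (auto simp: strict_chains_def)
    next
      case (snoc ys y)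
      then have ys: "\<And>x. x \<in> set ys \<Longrightarrow> x \<in> A \<union> B \<and> lt x y" and "y \<in> A \<union> B"
        using xs by (auto simp: strict_chains_def sorted_wrt_append)
      then consider "y \<in> A" "set ys \<subseteq> A" | "y \<in> B" "set ys \<subseteq> B"
        using down by blast
      then show ?thesis using xs snoc by cases (auto simp: strict_chains_def)
    qed
  qed
  with c obtain a b where ab: "c = a + b" "keys a \<subseteq> strict_chains A lt k" "keys b \<subseteq> strict_chains B lt k"
    by (meson keys_split order_trans)
  have "\<exists>f. keys f \<subseteq> strict_chains (A \<inter> B) lt k \<and> boundary f = boundary a"
  proof (cases k)
    case 0
    then have "keys a \<subseteq> {[]}" using ab by auto
    then have "boundary a = 0" by (subst boundary_eq_extend, subst extend_superset[of "{[]}"]) auto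
    then show ?thesis by (intro exI[of _ 0]) (simp add: boundary_eq_extend)
  next
    case (Suc j)
    have "boundary a = - boundary b"
      using dc ab by (simp add: boundary_eq_extend extend_add eq_neg_iff_add_eq_0)
    then have "keys (boundary a) \<subseteq> strict_chains A lt j \<inter> strict_chains B lt j"
      using keys_boundary[of a A lt j] keys_boundary[of b B lt j] ab Suc
      by (auto simp: in_keys_iff)
    then have "keys (boundary a) \<subseteq> strict_chains (A \<inter> B) lt j" by (auto simp: strict_chains_def)
    then show ?thesis
      using AB Suc k by (simp add: acyclic_below_def less_diff_conv)
  qed
  then obtain f where f: "keys f \<subseteq> strict_chains (A \<inter> B) lt k" "boundary f = boundary a" by blast
  have fA: "keys f \<subseteq> strict_chains A lt k" and fB: "keys f \<subseteq> strict_chains B lt k"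
    by (rule order_trans[OF f(1) strict_chains_mono]; simp)+
  have "keys (a - f) \<subseteq> strict_chains A lt k" "boundary (a - f) = 0"
    using keys_diff_subset[OF ab(2) fA] f(2) by (simp_all add: boundary_eq_extend extend_diff)
  then obtain u where u: "keys u \<subseteq> strict_chains A lt (Suc k)" "boundary u = a - f"
    using acyclic_belowD[OF A k] by blast
  have "keys (b + f) \<subseteq> strict_chains B lt k" "boundary (b + f) = 0"
    using ab fB f(2) dc keys_add_subset[OF ab(3) fB]
    by (simp_all add: boundary_eq_extend extend_add add.commute)
  then obtain v where v: "keys v \<subseteq> strict_chains B lt (Suc k)" "boundary v = b + f"
    using acyclic_belowD[OF B k] by blast
  have "keys (u + v) \<subseteq> strict_chains (A \<union> B) lt (Suc k)"
    using order_trans[OF u(1) strict_chains_mono, of "A \<union> B"] order_trans[OF v(1) strict_chains_mono, of "A \<union> B"]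
      Poly_Mapping.keys_add[of u v] by auto
  moreover have "boundary (u + v) = c"
    using u(2) v(2) ab by (simp add: boundary_eq_extend extend_add)
  ultimately show "\<exists>b. keys b \<subseteq> strict_chains (A \<union> B) lt (Suc k) \<and> boundary b = c" by blast
qed

section \<open>The trace formula\<close>

text \<open>The trace of a product of two matrices does not depend on the order of the factors. It
  is applied to the boundary and to a chain map after a homotopy, which go between neighbouring
  degrees.\<close>

lemma finite_trace_commute:
  fixes K :: "'x \<Rightarrow> ('y \<Rightarrow>\<^sub>0 'k::field)" and L :: "'y \<Rightarrow> ('x \<Rightarrow>\<^sub>0 'k)"
  assumes fin: "finite C" "finite D"
    and K: "\<And>x. x \<in> C \<Longrightarrow> keys (K x) \<subseteq> D" and L: "\<And>y. y \<in> D \<Longrightarrow> keys (L y) \<subseteq> C"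
  shows "(\<Sum>x\<in>C. lookup (extend L (K x)) x) = (\<Sum>y\<in>D. lookup (extend K (L y)) y)"
proof -
  have "(\<Sum>x\<in>C. lookup (extend L (K x)) x) = (\<Sum>x\<in>C. \<Sum>y\<in>D. lookup (K x) y * lookup (L y) x)"
    by (intro sum.cong refl) (simp add: extend_superset[OF fin(2) K] lookup_sum)
  also have "\<dots> = (\<Sum>y\<in>D. \<Sum>x\<in>C. lookup (L y) x * lookup (K x) y)"
    by (subst sum.swap) (simp add: mult.commute)
  also have "\<dots> = (\<Sum>y\<in>D. lookup (extend K (L y)) y)"
    by (intro sum.cong refl) (simp add: extend_superset[OF fin(1) L] lookup_sum)
  finally show ?thesis .
qed

lemma cscale_minus_one: "cscale (- 1) c = - c"
  by (rule poly_mapping_eqI) simp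

text \<open>Write \<open>d\<close> for the boundary. Where \<open>d h = 1 - h d\<close> holds on the
  faces of \<open>xs\<close>, \<open>d h d = d - h d d = d\<close>. Hence \<open>xs - h d xs\<close>
  is a cycle; this extends a homotopy by one degree and, in the top degree, projects chains onto
  cycles.\<close>

lemma homotopy_bd:
  fixes h :: "'a list \<Rightarrow> ('a list \<Rightarrow>\<^sub>0 'k::field)"
  assumes xs: "xs \<in> strict_chains P lt k"
    and h: "\<And>j ys. j < k \<Longrightarrow> ys \<in> strict_chains P lt j \<Longrightarrow> keys (h ys) \<subseteq> strict_chains P lt (Suc j)"
      "\<And>j ys. j < k \<Longrightarrow> ys \<in> strict_chains P lt j \<Longrightarrow> boundary (h ys) = single ys 1 - extend h (bd ys)"
  shows "keys (extend h (bd xs)) \<subseteq> strict_chains P lt k" "boundary (extend h (bd xs)) = bd xs"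
proof -
  have "keys (extend h (bd xs)) \<subseteq> strict_chains P lt k \<and> boundary (extend h (bd xs)) = bd xs"
  proof (cases k)
    case (Suc j)
    with xs have k: "keys (bd xs :: 'a list \<Rightarrow>\<^sub>0 'k) \<subseteq> strict_chains P lt j" by (intro keys_bd) simp
    have "boundary (extend h (bd xs)) = extend (\<lambda>ys. single ys 1 - extend h (bd ys)) (bd xs)"
      unfolding boundary_eq_extend extend_extend
      by (rule extend_cong) (use k h(2)[of j] Suc in \<open>auto simp: boundary_eq_extend\<close>)
    also have "\<dots> = bd xs - extend h (boundary (bd xs))"
      by (simp add: extend_fun_diff extend_extend boundary_eq_extend)
    finally have "boundary (extend h (bd xs)) = bd xs" by (simp add: boundary_bd)
    moreover have "keys (extend h (bd xs)) \<subseteq> strict_chains P lt k"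
      using k h(1)[of j] Suc by (intro keys_extend) auto
    ultimately show ?thesis by blast
  qed (use xs in \<open>simp add: boundary_eq_extend\<close>)
  then show "keys (extend h (bd xs)) \<subseteq> strict_chains P lt k" "boundary (extend h (bd xs)) = bd xs"
    by blast+
qed

text \<open>A choice of fillings, one degree at a time: \<open>xs - h d xs\<close> is a cycle by
  \<open>homotopy_bd\<close>, and in the degrees below \<open>m\<close> every cycle is a boundary.
  The choice in a new degree does not touch the earlier ones.\<close>

lemma contracting_homotopy:
  assumes "acyclic_below TYPE('k::field) P lt m"
  shows "\<exists>h :: 'a list \<Rightarrow> ('a list \<Rightarrow>\<^sub>0 'k). \<forall>k<m. \<forall>xs\<in>strict_chains P lt k.
    keys (h xs) \<subseteq> strict_chains P lt (Suc k) \<and>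
    boundary (h xs) = single xs 1 - extend h (bd xs)"
  using assms
proof (induction m)
  case (Suc m)
  let ?C = "strict_chains P lt"
  from Suc.prems have "acyclic_below TYPE('k) P lt m" by (simp add: acyclic_below_def)
  with Suc.IH obtain h :: "'a list \<Rightarrow> ('a list \<Rightarrow>\<^sub>0 'k)" where
    h: "\<And>k xs. k < m \<Longrightarrow> xs \<in> ?C k \<Longrightarrow> keys (h xs) \<subseteq> ?C (Suc k)"
      "\<And>k xs. k < m \<Longrightarrow> xs \<in> ?C k \<Longrightarrow> boundary (h xs) = single xs 1 - extend h (bd xs)" by metis
  have ex: "\<exists>b. keys b \<subseteq> ?C (Suc m) \<and> boundary b = single xs 1 - extend h (bd xs)"
    if xs: "xs \<in> ?C m" for xs
  proof -
    have "keys (single xs (1::'k)) \<subseteq> ?C m" using xs by simp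
    moreover have "keys (extend h (bd xs)) \<subseteq> ?C m" by (rule homotopy_bd(1)[OF xs h])
    ultimately have "keys (single xs 1 - extend h (bd xs)) \<subseteq> ?C m" by (rule keys_diff_subset)
    moreover have "boundary (extend h (bd xs)) = bd xs" by (rule homotopy_bd(2)[OF xs h])
    then have "boundary (single xs 1 - extend h (bd xs)) = 0"
      by (simp add: boundary_eq_extend extend_diff)
    ultimately show ?thesis
      using Suc.prems by (simp add: acyclic_below_def)
  qed
  define h' where "h' = (\<lambda>xs. if length xs = m
    then SOME b. keys b \<subseteq> ?C (Suc m) \<and> boundary b = single xs 1 - extend h (bd xs) else h xs)"
  have eq: "extend h' (bd xs) = extend h (bd xs)" if "length xs \<le> m" for xs
  proof (cases "xs = []")
    case False
    with that have "length xs - 1 < m" by (cases xs) auto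
    then show ?thesis
      by (intro extend_cong) (auto simp: h'_def dest!: length_keys_bd)
  qed simp
  show ?case
  proof (intro exI[of _ h'] allI impI ballI)
    fix k xs assume k: "k < Suc m" and xs: "xs \<in> ?C k"
    show "keys (h' xs) \<subseteq> ?C (Suc k) \<and> boundary (h' xs) = single xs 1 - extend h' (bd xs)"
    proof (cases "k = m")
      case True
      with xs someI_ex[OF ex, of xs] have "keys (h' xs) \<subseteq> ?C (Suc m) \<and> boundary (h' xs) = single xs 1 - extend h (bd xs)"
        by (auto simp: h'_def strict_chains_def)
      with True xs show ?thesis by (subst eq) (auto simp: strict_chains_def)
    next
      case False
      then have "k < m" "length xs = k" using k xs by (auto simp: strict_chains_def)
      then show ?thesis using h[of k xs] xs by (subst eq) (auto simp: h'_def)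
    qed
  qed
qed simp

lemma strict_chains_map:
  assumes "\<And>x. x \<in> P \<Longrightarrow> f x \<in> P" "\<And>x y. x \<in> P \<Longrightarrow> y \<in> P \<Longrightarrow> lt x y \<Longrightarrow> lt (f x) (f y)"
    and "xs \<in> strict_chains P lt k"
  shows "List.map f xs \<in> strict_chains P lt k"
  using assms sorted_wrt_mono_rel[of xs lt "\<lambda>x y. lt (f x) (f y)"] unfolding strict_chains_def
  by (auto simp: sorted_wrt_map subset_iff)

lemma chain_map_bd: "chain_map f (bd xs) = bd (List.map f xs)"
  by (simp add: chain_map_eq_extend bd_def extend_sum take_map drop_map)

lemma chain_map_boundary: "chain_map f (boundary c) = boundary (chain_map f c)"
  by (simp add: boundary_eq_extend chain_map_eq_extend extend_extend flip: chain_map_bd)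

section \<open>Homology in the top degree\<close>

locale top_homology =
  fixes P :: "'p set" and lt :: "'p \<Rightarrow> 'p \<Rightarrow> bool" and m :: nat and K :: "'k::field itself"
  assumes fin: "finite P" and top: "strict_chains P lt (Suc m) = {}"
begin

text \<open>Without chains of \<open>m + 1\<close> elements the only boundary is \<open>0\<close>.
  So each homology class is a singleton \<open>{c}\<close> with \<open>c\<close> a cycle, and the
  homology is a copy of \<open>Z\<close>.\<close>

definition Z :: "('p list \<Rightarrow>\<^sub>0 'k) set" where
  "Z = {c. keys c \<subseteq> strict_chains P lt m \<and> boundary c = 0}"

abbreviation H :: "('k, ('p list \<Rightarrow>\<^sub>0 'k) set) module" where
  "H \<equiv> reduced_homology P lt (int m - 1)"

lemma Z_zero: "0 \<in> Z"
  by (simp add: Z_def boundary_eq_extend)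

lemma Z_add: "x \<in> Z \<Longrightarrow> y \<in> Z \<Longrightarrow> x + y \<in> Z"
  using keys_add_subset by (auto simp: Z_def boundary_eq_extend extend_add)

lemma Z_cscale: "x \<in> Z \<Longrightarrow> cscale a x \<in> Z"
  by (auto simp: Z_def boundary_eq_extend extend_cscale dest: subsetD[OF keys_cscale])

lemma cycles_eq: "cycles P lt (int m - 1) = Z"
  by (simp add: cycles_def chain_space_def Z_def order_simplices_def strict_chains_def)

lemma boundaries_eq: "boundaries P lt (int m - 1) = ({0} :: ('p list \<Rightarrow>\<^sub>0 'k) set)"
proof -
  have "order_simplices P lt (int m - 1 + 1) = {}"
    using top by (auto simp: order_simplices_def strict_chains_def)
  then show ?thesis
    by (auto simp: boundaries_def chain_space_def boundary_eq_extend intro!: image_eqI[of _ _ 0])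
qed

lemma H_simps [simp]:
  "carrier H = (\<lambda>c. {c}) ` Z" "\<zero>\<^bsub>H\<^esub> = {0}"
  "{x} \<oplus>\<^bsub>H\<^esub> {y} = {x + y}" "a \<odot>\<^bsub>H\<^esub> {x} = {cscale a x}"
  by (auto simp: reduced_homology_def quotient_module_def cycles_eq boundaries_eq A_RCOSETS_def'
      a_r_coset_def' set_add_def' chain_space_def cscale_def)

lemma vectorspace_H: "vectorspace class_ring H"
proof -
  have cr: "cring (class_ring :: 'k ring)" "field (class_ring :: 'k ring)"
    by (rule class_cring.cring_axioms, rule class_field.field_axioms)
  have "abelian_group H"
  proof (rule abelian_groupI)
    fix X assume "X \<in> carrier H"
    then obtain x where "x \<in> Z" "X = {x}" by auto
    moreover from this have "- x \<in> Z" using Z_cscale[of x "- 1"] by (simp add: cscale_minus_one)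
    ultimately show "\<exists>Y\<in>carrier H. Y \<oplus>\<^bsub>H\<^esub> X = \<zero>\<^bsub>H\<^esub>" by (auto intro!: bexI[of _ "- x"])
  qed (auto simp: Z_zero Z_add algebra_simps)
  then have "module class_ring H"
    by (intro moduleI cr) (auto simp: Z_cscale add_cscale cscale_add)
  then show ?thesis using cr by (intro vectorspace.intro)
qed

sublocale H: vectorspace "class_ring :: 'k ring" H
  by (rule vectorspace_H)

lemma finsum_H:
  assumes "finite I" "\<And>i. i \<in> I \<Longrightarrow> g i \<in> Z"
  shows "finsum H (\<lambda>i. {g i}) I = {sum g I}"
  using assms
proof (induction I rule: finite_induct)
  case (insert i I)
  then show ?case by (subst H.finsum_insert) auto
qed (simp add: H.finsum_empty)

lemma lincomb_H:
  assumes "finite I" "I \<subseteq> Z"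
  shows "H.lincomb a ((\<lambda>c. {c}) ` I) = {\<Sum>c\<in>I. cscale (a {c}) c}"
proof -
  have "H.lincomb a ((\<lambda>c. {c}) ` I) = finsum H (\<lambda>c. {cscale (a {c}) c}) I"
    unfolding H.lincomb_def using assms
    by (subst H.finsum_reindex) (auto simp: Z_cscale subset_iff)
  then show ?thesis using assms by (simp add: finsum_H Z_cscale subset_iff)
qed

text \<open>\<open>p\<close> projects chains onto cycles, so the trace of \<open>g\<close> on
  \<open>Z\<close> equals the trace of \<open>g\<close> after \<open>p\<close> on all chains. The
  latter is computed in the basis of simplices, whereas \<open>trace\<close> refers to a chosen
  basis of the homology about which nothing else is known.\<close>

lemma trace_H:
  assumes f: "\<And>c. c \<in> Z \<Longrightarrow> F {c} = {extend g c}" "\<And>c. c \<in> Z \<Longrightarrow> extend g c \<in> Z"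
    and p: "\<And>s. s \<in> strict_chains P lt m \<Longrightarrow> p s \<in> Z" "\<And>c. c \<in> Z \<Longrightarrow> extend p c = c"
  shows "H.trace F = (\<Sum>s\<in>strict_chains P lt m. lookup (extend g (p s)) s)"
proof -
  let ?C = "strict_chains P lt m"
  have finC: "finite ?C" by (rule finite_strict_chains[OF fin])
  have ZC: "extend p c = (\<Sum>s\<in>?C. cscale (lookup c s) (p s))" if "c \<in> Z" for c
    using that by (intro extend_superset finC) (simp add: Z_def)
  have "H.fin_dim"
    unfolding H.fin_dim_def
  proof (intro exI conjI)
    let ?A = "(\<lambda>c. {c}) ` p ` ?C"
    show "finite ?A" using finC by simp
    show sub: "?A \<subseteq> carrier H" using p(1) by auto
    show "H.gen_set ?A"
    proof
      show "H.span ?A \<subseteq> carrier H" using sub by (rule H.span_is_subset2)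
      show "carrier H \<subseteq> H.span ?A"
      proof
        fix X assume "X \<in> carrier H"
        then obtain c where c: "c \<in> Z" "X = {c}" by auto
        \<comment> \<open>Different simplices may have the same image under \<open>p\<close>, so the
          coefficients are added up over the fibres before a linear combination of the set of images
          can be formed.\<close>
        have "c = (\<Sum>s\<in>?C. cscale (lookup c s) (p s))" using p(2) c ZC by simp
        also have "\<dots> = (\<Sum>b\<in>p ` ?C. \<Sum>s\<in>{s\<in>?C. p s = b}. cscale (lookup c s) (p s))"
          by (rule sum.image_gen[OF finC])
        also have "\<dots> = (\<Sum>b\<in>p ` ?C. cscale (\<Sum>s\<in>{s\<in>?C. p s = b}. lookup c s) b)"
        proof (rule sum.cong[OF refl])
          fix b
          have "(\<Sum>s\<in>{s\<in>?C. p s = b}. cscale (lookup c s) (p s)) =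
              (\<Sum>s\<in>{s\<in>?C. p s = b}. cscale (lookup c s) b)" by (rule sum.cong) auto
          also have "\<dots> = cscale (\<Sum>s\<in>{s\<in>?C. p s = b}. lookup c s) b"
            by (rule poly_mapping_eqI) (simp add: lookup_sum sum_distrib_right)
          finally show "(\<Sum>s\<in>{s\<in>?C. p s = b}. cscale (lookup c s) (p s)) =
              cscale (\<Sum>s\<in>{s\<in>?C. p s = b}. lookup c s) b" .
        qed
        finally have "X = H.lincomb (\<lambda>Y. \<Sum>s\<in>{s\<in>?C. p s = the_elem Y}. lookup c s) ?A"
          using c p(1) finC by (subst lincomb_H) auto
        then show "X \<in> H.span ?A"
          unfolding H.span_def using finC by (auto simp: class_ring_simps)
      qed
    qed
  qed
  then obtain B0 where "finite B0" "H.basis B0" using H.finite_basis_exists by blast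
  define B where "B = (SOME B. finite B \<and> H.basis B)"
  have B: "finite B" "H.basis B"
    using someI[of "\<lambda>B. finite B \<and> H.basis B" B0] \<open>finite B0\<close> \<open>H.basis B0\<close> by (auto simp: B_def)
  define I where "I = the_elem ` B"
  have Bc: "B \<subseteq> carrier H" using B by (simp add: H.basis_def)
  then have "{the_elem X} = X" if "X \<in> B" for X using that by auto
  then have BI: "B = (\<lambda>c. {c}) ` I" by (simp add: I_def image_image)
  have IZ: "I \<subseteq> Z" using Bc by (auto simp: I_def)
  have finI: "finite I" using B by (simp add: I_def)
  define \<phi> where "\<phi> = (\<lambda>c b. H.coords B {c} {b})"
  have uniq: "\<exists>!a. a \<in> B \<rightarrow>\<^sub>E carrier class_ring \<and> H.lincomb a B = {c}" if "c \<in> Z" for c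
    using H.basis_criterion[OF B(1) Bc] B(2) that by auto
  have \<phi>_sum: "(\<Sum>b\<in>I. cscale (\<phi> c b) b) = c" if "c \<in> Z" for c
    using theI'[OF uniq[OF that]] unfolding H.coords_def[symmetric]
    by (simp add: \<phi>_def BI lincomb_H[OF finI IZ])
  have \<phi>_eq: "\<phi> c b = a b" if "c \<in> Z" "c = (\<Sum>b\<in>I. cscale (a b) b)" "b \<in> I" for c a b
  proof -
    let ?a = "\<lambda>Y\<in>B. a (the_elem Y)"
    have "H.lincomb ?a B = {c}"
      unfolding BI lincomb_H[OF finI IZ] using that(2) by (simp add: BI)
    then have "H.coords B {c} = ?a"
      unfolding H.coords_def by (intro the1_equality uniq that) (auto simp: class_ring_simps)
    then show ?thesis using that(3) by (simp add: \<phi>_def BI)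
  qed
  \<comment> \<open>Coordinates are linear and the cycles \<open>p s\<close> generate
    \<open>Z\<close>, so the coordinates of \<open>p s\<close> determine all others.\<close>
  have lin: "\<phi> w b = (\<Sum>s\<in>?C. lookup w s * \<phi> (p s) b)" if w: "w \<in> Z" and b: "b \<in> I" for w b
  proof (rule \<phi>_eq[OF w _ b])
    have "w = (\<Sum>s\<in>?C. cscale (lookup w s) (\<Sum>b\<in>I. cscale (\<phi> (p s) b) b))"
      using p(2)[OF w] ZC[OF w] \<phi>_sum[OF p(1)] by simp
    also have "\<dots> = (\<Sum>b\<in>I. \<Sum>s\<in>?C. cscale (lookup w s * \<phi> (p s) b) b)"
      by (simp add: cscale_sum sum.swap[of _ _ ?C])
    also have "\<dots> = (\<Sum>b\<in>I. cscale (\<Sum>s\<in>?C. lookup w s * \<phi> (p s) b) b)"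
      by (rule poly_mapping_eqI) (simp add: lookup_sum sum_distrib_right)
    finally show "w = (\<Sum>b\<in>I. cscale (\<Sum>s\<in>?C. lookup w s * \<phi> (p s) b) b)" .
  qed
  have "H.trace F = (\<Sum>X\<in>B. H.coords B (F X) X)"
    unfolding H.trace_def B_def[symmetric] Let_def by (simp add: class_ring_simps)
  also have "\<dots> = (\<Sum>b\<in>I. \<phi> (extend g b) b)"
    unfolding BI using f(1) IZ
    by (subst sum.reindex) (auto simp: \<phi>_def BI intro!: sum.cong)
  also have "\<dots> = (\<Sum>b\<in>I. \<Sum>s\<in>?C. lookup (extend g b) s * \<phi> (p s) b)"
    using f(2) IZ lin by (intro sum.cong) auto
  also have "\<dots> = (\<Sum>s\<in>?C. lookup (\<Sum>b\<in>I. cscale (\<phi> (p s) b) (extend g b)) s)"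
    by (subst sum.swap) (simp add: lookup_sum mult.commute)
  also have "\<dots> = (\<Sum>s\<in>?C. lookup (extend g (p s)) s)"
  proof (rule sum.cong[OF refl])
    fix s assume "s \<in> ?C"
    then have "extend g (\<Sum>b\<in>I. cscale (\<phi> (p s) b) b) = extend g (p s)" using \<phi>_sum p(1) by simp
    then show "lookup (\<Sum>b\<in>I. cscale (\<phi> (p s) b) (extend g b)) s = lookup (extend g (p s)) s"
      by (simp add: extend_sum extend_cscale)
  qed
  finally show ?thesis .
qed

text \<open>The Hopf trace formula. With \<open>d\<close> the boundary and
  \<open>p = 1 - h d\<close>, let \<open>t k\<close> be the trace of \<open>f p\<close> on the
  chains of \<open>k\<close> elements. One degree higher, commuting the factors inside the trace
  turns the term \<open>f h d\<close> into \<open>d f h = f d h\<close>, and \<open>d h\<close> is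
  \<open>p\<close> again; hence \<open>t (Suc k) = fx (Suc k) - t k\<close>. In degree
  \<open>m\<close> the map \<open>p\<close> projects onto the cycles. A fixed simplex contributes
  \<open>1\<close> without a sign because the order of its vertices is kept.\<close>

theorem trace_homology_map:
  assumes acyclic: "acyclic_below TYPE('k) P lt m"
    and f: "\<And>x. x \<in> P \<Longrightarrow> f x \<in> P" "\<And>x y. x \<in> P \<Longrightarrow> y \<in> P \<Longrightarrow> lt x y \<Longrightarrow> lt (f x) (f y)"
  shows "H.trace (homology_map P lt (int m - 1) f) =
    (\<Sum>k\<le>m. (- 1) ^ (m - k) * of_nat (card {xs \<in> strict_chains P lt k. List.map f xs = xs}))"
proof -
  let ?C = "strict_chains P lt"
  have finC: "finite (?C k)" for k by (rule finite_strict_chains[OF fin])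
  obtain h :: "'p list \<Rightarrow> ('p list \<Rightarrow>\<^sub>0 'k)" where
    h: "\<And>k xs. k < m \<Longrightarrow> xs \<in> ?C k \<Longrightarrow> keys (h xs) \<subseteq> ?C (Suc k)"
      "\<And>k xs. k < m \<Longrightarrow> xs \<in> ?C k \<Longrightarrow> boundary (h xs) = single xs 1 - extend h (bd xs)"
    using contracting_homotopy[OF acyclic] by metis
  define p where "p = (\<lambda>xs. single xs 1 - extend h (bd xs))"
  define f1 :: "'p list \<Rightarrow> ('p list \<Rightarrow>\<^sub>0 'k)" where "f1 = (\<lambda>xs. single (List.map f xs) 1)"
  have cm: "chain_map f c = extend f1 c" for c :: "'p list \<Rightarrow>\<^sub>0 'k"
    by (simp add: chain_map_eq_extend f1_def)
  have fC: "keys (extend f1 c) \<subseteq> ?C k" if "keys c \<subseteq> ?C k" for c k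
    using that strict_chains_map[of P f lt] f by (intro keys_extend) (auto simp: f1_def)
  have pZ: "p s \<in> Z" if s: "s \<in> ?C m" for s
  proof -
    have "boundary (extend h (bd s)) = bd s" by (rule homotopy_bd(2)[OF s h])
    moreover have "keys (p s) \<subseteq> ?C m"
      unfolding p_def using s homotopy_bd(1)[OF s h] by (intro keys_diff_subset) simp_all
    ultimately show ?thesis
      by (simp add: Z_def p_def boundary_eq_extend extend_diff)
  qed
  have pid: "extend p c = c" if "c \<in> Z" for c
  proof -
    have "extend p c = c - extend h (boundary c)"
      by (simp add: p_def extend_fun_diff extend_extend boundary_eq_extend)
    then show ?thesis using that by (simp add: Z_def)
  qed
  have FZ: "extend f1 c \<in> Z" if "c \<in> Z" for c
    using that fC[of c m] chain_map_boundary[of f c] by (simp add: Z_def cm)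
  have "homology_map P lt (int m - 1) f {c} = {extend f1 c}" for c :: "'p list \<Rightarrow>\<^sub>0 'k"
    by (simp add: homology_map_def boundaries_eq a_r_coset_def' chain_space_def cm)
  then have tr: "H.trace (homology_map P lt (int m - 1) f) = (\<Sum>s\<in>?C m. lookup (extend f1 (p s)) s)"
    by (intro trace_H FZ pZ pid)
  define t where "t = (\<lambda>k. \<Sum>s\<in>?C k. lookup (extend f1 (p s)) s)"
  define fx where "fx = (\<lambda>k. of_nat (card {xs \<in> ?C k. List.map f xs = xs}) :: 'k)"
  have fx: "(\<Sum>s\<in>?C k. lookup (f1 s) s) = fx k" for k
  proof -
    have "(\<Sum>s\<in>?C k. lookup (f1 s) s) = (\<Sum>s\<in>?C k. if List.map f s = s then 1 else 0)"
      by (rule sum.cong) (auto simp: f1_def lookup_single)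
    also have "\<dots> = (\<Sum>s\<in>{s\<in>?C k. List.map f s = s}. 1)"
      by (rule sum.inter_filter[symmetric, OF finC])
    finally show ?thesis by (simp add: fx_def)
  qed
  have t0: "t 0 = fx 0"
    using fx[of 0] by (simp add: t_def p_def)
  have tS: "t (Suc k) = fx (Suc k) - t k" if "k < m" for k
  proof -
    have "(\<Sum>s\<in>?C (Suc k). lookup (extend f1 (extend h (bd s))) s)
        = (\<Sum>s\<in>?C (Suc k). lookup (extend (\<lambda>u. extend f1 (h u)) (bd s)) s)"
      by (simp add: extend_extend)
    also have "\<dots> = (\<Sum>u\<in>?C k. lookup (extend bd (extend f1 (h u))) u)"
    proof (rule finite_trace_commute[OF finC finC])
      show "keys (extend f1 (h u)) \<subseteq> ?C (Suc k)" if "u \<in> ?C k" for u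
        by (rule fC, rule h(1)[OF \<open>k < m\<close> that])
    qed (rule keys_bd)
    also have "\<dots> = (\<Sum>u\<in>?C k. lookup (extend f1 (p u)) u)"
    proof (rule sum.cong[OF refl])
      fix u assume u: "u \<in> ?C k"
      have "extend bd (extend f1 (h u)) = extend f1 (boundary (h u))"
        using chain_map_boundary[of f "h u"] by (simp add: cm boundary_eq_extend)
      then show "lookup (extend bd (extend f1 (h u))) u = lookup (extend f1 (p u)) u"
        using h(2)[OF that u] by (simp add: p_def)
    qed
    finally show ?thesis
      using fx[of "Suc k"]
      by (simp add: t_def p_def extend_diff lookup_minus sum_subtractf)
  qed
  have "t k = (\<Sum>j\<le>k. (- 1) ^ (k - j) * fx j)" if "k \<le> m" for k
    using that
  proof (induction k)
    case (Suc k)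
    have "(\<Sum>j\<le>k. (- 1) ^ (Suc k - j) * fx j) = - (\<Sum>j\<le>k. (- 1) ^ (k - j) * fx j)"
      by (simp add: Suc_diff_le flip: sum_negf)
    with Suc tS[of k] show ?case by simp
  qed (simp add: t0)
  then show ?thesis using tr by (simp add: t_def fx_def)
qed

end

section \<open>Intervals of the noncrossing partition lattice\<close>

definition conn :: "'a set set \<Rightarrow> 'a \<Rightarrow> 'a \<Rightarrow> bool" where
  "conn \<pi> x y \<longleftrightarrow> (\<exists>B\<in>\<pi>. x \<in> B \<and> y \<in> B)"

lemma partition_on_block_eq:
  "partition_on U \<pi> \<Longrightarrow> A \<in> \<pi> \<Longrightarrow> B \<in> \<pi> \<Longrightarrow> x \<in> A \<Longrightarrow> x \<in> B \<Longrightarrow> A = B"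
  by (auto simp: partition_on_def disjoint_def)

lemma conn_refl: "partition_on U \<pi> \<Longrightarrow> x \<in> U \<Longrightarrow> conn \<pi> x x"
  by (auto simp: conn_def partition_on_def)

lemma conn_sym: "conn \<pi> x y \<Longrightarrow> conn \<pi> y x"
  by (auto simp: conn_def)

lemma conn_trans: "partition_on U \<pi> \<Longrightarrow> conn \<pi> x y \<Longrightarrow> conn \<pi> y z \<Longrightarrow> conn \<pi> x z"
  by (auto simp: conn_def dest: partition_on_block_eq)

lemma conn_block:
  assumes "partition_on U \<pi>" "B \<in> \<pi>" "x \<in> B"
  shows "conn \<pi> x y \<longleftrightarrow> y \<in> B"
proof
  assume "conn \<pi> x y"
  then obtain C where "C \<in> \<pi>" "x \<in> C" "y \<in> C" by (auto simp: conn_def)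
  with partition_on_block_eq[OF assms(1) assms(2) this(1) assms(3)] show "y \<in> B" by simp
qed (use assms in \<open>auto simp: conn_def\<close>)

lemma refines_iff_conn:
  assumes "partition_on U \<pi>" "partition_on U \<tau>"
  shows "refines U \<pi> \<tau> \<longleftrightarrow> (\<forall>x y. conn \<pi> x y \<longrightarrow> conn \<tau> x y)"
proof (intro iffI allI impI)
  fix x y assume r: "refines U \<pi> \<tau>" and "conn \<pi> x y"
  then obtain B where "B \<in> \<pi>" "x \<in> B" "y \<in> B" by (auto simp: conn_def)
  moreover from this r obtain C where "C \<in> \<tau>" "B \<subseteq> C" by (auto simp: refines_def)
  ultimately show "conn \<tau> x y" by (auto simp: conn_def)
next
  assume *: "\<forall>x y. conn \<pi> x y \<longrightarrow> conn \<tau> x y"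
  have "\<exists>Y\<in>\<tau>. X \<subseteq> Y" if X: "X \<in> \<pi>" for X
  proof -
    have "X \<noteq> {}" using X partition_onD3[OF assms(1)] by auto
    then obtain x where x: "x \<in> X" by auto
    then have "conn \<pi> x x" using X by (auto simp: conn_def)
    then have "conn \<tau> x x" using * by simp
    then obtain Y where Y: "Y \<in> \<tau>" "x \<in> Y" by (auto simp: conn_def)
    have "y \<in> Y" if y: "y \<in> X" for y
    proof -
      have "conn \<pi> x y" using X x y by (auto simp: conn_def)
      with * have "conn \<tau> x y" by simp
      with conn_block[OF assms(2) Y] show ?thesis by simp
    qed
    then show ?thesis using Y by auto
  qed
  then show "refines U \<pi> \<tau>" using assms by (simp add: refines_def)
qed

lemma noncrossing_iff_conn:
  fixes \<pi> :: "nat set set"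
  assumes "partition_on U \<pi>"
  shows "noncrossing \<pi> \<longleftrightarrow>
    (\<forall>a b c d. a < b \<and> b < c \<and> c < d \<and> conn \<pi> a c \<and> conn \<pi> b d \<longrightarrow> conn \<pi> a b)"
proof
  assume *: "noncrossing \<pi>"
  show "\<forall>a b c d. a < b \<and> b < c \<and> c < d \<and> conn \<pi> a c \<and> conn \<pi> b d \<longrightarrow> conn \<pi> a b"
  proof (intro allI impI, elim conjE)
    fix a b c d assume h: "a < b" "b < c" "c < d" "conn \<pi> a c" "conn \<pi> b d"
    then obtain A B where AB: "A \<in> \<pi>" "a \<in> A" "c \<in> A" "B \<in> \<pi>" "b \<in> B" "d \<in> B"
      by (auto simp: conn_def)
    with * h(1-3) have "A = B" unfolding noncrossing_def by blast
    with AB show "conn \<pi> a b" by (auto simp: conn_def)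
  qed
next
  assume *: "\<forall>a b c d. a < b \<and> b < c \<and> c < d \<and> conn \<pi> a c \<and> conn \<pi> b d \<longrightarrow> conn \<pi> a b"
  show "noncrossing \<pi>"
    unfolding noncrossing_def
  proof (intro ballI allI impI, elim conjE)
    fix A B a b c d assume h: "A \<in> \<pi>" "B \<in> \<pi>" "a < b" "b < c" "c < d" "a \<in> A" "c \<in> A" "b \<in> B" "d \<in> B"
    then have "conn \<pi> a c" "conn \<pi> b d" by (auto simp: conn_def)
    with * h have "conn \<pi> a b" by blast
    then have "b \<in> A" using conn_block[OF assms, of A a b] h by simp
    with h show "A = B" by (intro partition_on_block_eq[OF assms, of A B b])
  qed
qed

lemma noncrossingD:
  assumes "partition_on U \<pi>" "noncrossing \<pi>"
    and "a < b" "b < c" "c < d" "conn \<pi> a c" "conn \<pi> b (d::nat)"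
  shows "conn \<pi> a b" "conn \<pi> a d"
proof -
  show "conn \<pi> a b" using assms noncrossing_iff_conn[OF assms(1)] by blast
  then show "conn \<pi> a d" using assms(7) by (rule conn_trans[OF assms(1)])
qed

section \<open>Merging two blocks without creating a crossing\<close>

definition merge :: "'a set set \<Rightarrow> 'a \<Rightarrow> 'a \<Rightarrow> 'a set set" where
  "merge \<pi> a b = insert (\<Union>{B \<in> \<pi>. a \<in> B \<or> b \<in> B}) {B \<in> \<pi>. a \<notin> B \<and> b \<notin> B}"

lemma partition_on_merge:
  assumes "partition_on U \<pi>" "a \<in> U"
  shows "partition_on U (merge \<pi> a b)"
proof (rule partition_onI)
  show "\<Union>(merge \<pi> a b) = U" using assms by (auto simp: merge_def partition_on_def)
  show "{} \<notin> merge \<pi> a b" using assms by (auto simp: merge_def partition_on_def)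
next
  have d: "X \<in> \<pi> \<Longrightarrow> Y \<in> \<pi> \<Longrightarrow> X \<noteq> Y \<Longrightarrow> X \<inter> Y = {}" for X Y
    using assms(1) by (auto simp: partition_on_def disjoint_def)
  fix X Y assume "X \<in> merge \<pi> a b" "Y \<in> merge \<pi> a b" "X \<noteq> Y"
  then show "disjnt X Y"
    using d by (auto simp: merge_def disjnt_def)
qed

lemma conn_merge:
  assumes "partition_on U \<pi>"
  shows "conn (merge \<pi> a b) x y \<longleftrightarrow>
    conn \<pi> x y \<or> ((conn \<pi> x a \<or> conn \<pi> x b) \<and> (conn \<pi> y a \<or> conn \<pi> y b))"
  unfolding merge_def conn_def by (auto 0 4)

lemma card_merge:
  assumes "partition_on U \<pi>" "finite U" "a \<in> U" "b \<in> U" "\<not> conn \<pi> a b"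
  shows "Suc (card (merge \<pi> a b)) = card \<pi>"
proof -
  obtain A B where AB: "A \<in> \<pi>" "a \<in> A" "B \<in> \<pi>" "b \<in> B" using assms by (auto simp: partition_on_def)
  then have ne: "A \<noteq> B" using assms(5) by (auto simp: conn_def)
  have eq: "X = A \<longleftrightarrow> a \<in> X" "X = B \<longleftrightarrow> b \<in> X" if "X \<in> \<pi>" for X
    using AB that partition_on_block_eq[OF assms(1)] by blast+
  have m: "merge \<pi> a b = insert (A \<union> B) (\<pi> - {A, B})"
    unfolding merge_def using eq AB by (intro arg_cong2[where f = insert]) auto
  have fin: "finite \<pi>" using assms finite_elements by blast
  have "A \<union> B \<notin> \<pi> - {A, B}" using eq AB by blast
  then have "card (merge \<pi> a b) = Suc (card (\<pi> - {A, B}))" using fin by (simp add: m)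
  moreover have "card \<pi> = card (\<pi> - {A, B}) + 2"
    using fin AB ne card_Diff_subset[of "{A, B}" \<pi>] card_mono[of \<pi> "{A, B}"] by simp
  ultimately show ?thesis by simp
qed

text \<open>The pairs lying in a common block of the Kreweras complement of \<open>\<pi>\<close>, that is, those
  whose blocks can be merged without creating a crossing.\<close>

definition mergeable :: "nat set \<Rightarrow> nat set set \<Rightarrow> nat \<Rightarrow> nat \<Rightarrow> bool" where
  "mergeable U \<pi> a b \<longleftrightarrow> a \<in> U \<and> b \<in> U \<and> a < b \<and>
     (\<forall>x y. conn \<pi> x y \<longrightarrow> (a < x \<and> x \<le> b \<longleftrightarrow> a < y \<and> y \<le> b))"

lemma mergeable_not_conn: "mergeable U \<pi> a b \<Longrightarrow> \<not> conn \<pi> a b"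
  by (auto simp: mergeable_def)

lemma mergeableD: "mergeable U \<pi> a b \<Longrightarrow> conn \<pi> x y \<Longrightarrow> a < x \<and> x \<le> b \<longleftrightarrow> a < y \<and> y \<le> b"
  by (simp add: mergeable_def)

text \<open>Mergeability of \<open>a\<close> and \<open>b\<close> says that the half-open interval
  {a<..b} cuts no block. For \<open>x < y < z\<close> the interval {x<..z} is the disjoint union of
  {x<..y} and {y<..z}, so if two of the three cut no block, neither does the third. Made symmetric
  and reflexive, the relation is thus an equivalence.\<close>

lemma mergeable_trans:
  assumes "mergeable U \<pi> x y" "mergeable U \<pi> y z"
  shows "mergeable U \<pi> x z"
proof -
  have "x < p \<and> p \<le> z \<longleftrightarrow> x < q \<and> q \<le> z" if "conn \<pi> p q" for p q
    using mergeableD[OF assms(1) that] mergeableD[OF assms(2) that] assms by (auto simp: mergeable_def)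
  then show ?thesis using assms by (auto simp: mergeable_def)
qed

lemma mergeable_left:
  assumes "mergeable U \<pi> x z" "mergeable U \<pi> y z" "x < y"
  shows "mergeable U \<pi> x y"
proof -
  have "x < p \<and> p \<le> y \<longleftrightarrow> x < q \<and> q \<le> y" if "conn \<pi> p q" for p q
    using mergeableD[OF assms(1) that] mergeableD[OF assms(2) that] assms by (auto simp: mergeable_def)
  then show ?thesis using assms by (auto simp: mergeable_def)
qed

lemma mergeable_right:
  assumes "mergeable U \<pi> x y" "mergeable U \<pi> x z" "y < z"
  shows "mergeable U \<pi> y z"
proof -
  have "y < p \<and> p \<le> z \<longleftrightarrow> y < q \<and> q \<le> z" if "conn \<pi> p q" for p q
    using mergeableD[OF assms(1) that] mergeableD[OF assms(2) that] assms by (auto simp: mergeable_def)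
  then show ?thesis using assms by (auto simp: mergeable_def)
qed

text \<open>The interval {z<..y} is the intersection of {x<..y} and {z<..w}, and if two intervals
  cut no block, neither does their intersection.\<close>

lemma mergeable_inter:
  assumes "mergeable U \<pi> x y" "mergeable U \<pi> z w" "x \<le> z" "z < y" "y \<le> w"
  shows "mergeable U \<pi> z y"
proof -
  have "z < p \<and> p \<le> y \<longleftrightarrow> z < q \<and> q \<le> y" if "conn \<pi> p q" for p q
    using mergeableD[OF assms(1) that] mergeableD[OF assms(2) that] assms by (auto simp: mergeable_def)
  then show ?thesis using assms by (auto simp: mergeable_def)
qed

lemma mergeable_merge:
  assumes "partition_on U \<pi>" "mergeable U \<pi> a b"
  shows "mergeable U (merge \<pi> a b) x y \<longleftrightarrow>
    mergeable U \<pi> x y \<and> (x < a \<and> a \<le> y \<longleftrightarrow> x < b \<and> b \<le> y)"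
proof -
  have "conn \<pi> a a" "conn \<pi> b b" using assms conn_refl by (auto simp: mergeable_def)
  then show ?thesis
    unfolding mergeable_def conn_merge[OF assms(1)] by (auto 0 3) 
qed

text \<open>A crossing that uses the merged block has one point in the old block of \<open>a\<close>
  and one in that of \<open>b\<close>. As {a<..b} cuts no block, it locates the other points, and
  with \<open>a\<close> or \<open>b\<close> in place of one point a crossing of \<open>\<pi>\<close>
  arises.\<close>

lemma noncrossing_merge:
  assumes \<pi>: "partition_on U \<pi>" "noncrossing \<pi>" and ab: "mergeable U \<pi> a b"
  shows "noncrossing (merge \<pi> a b)"
  unfolding noncrossing_iff_conn[OF partition_on_merge[OF \<pi>(1)], of a b, OF ab[unfolded mergeable_def, THEN conjunct1]]
proof (intro allI impI, elim conjE, rule ccontr)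
  fix p q r s assume lt: "p < q" "q < r" "r < s"
    and pr: "conn (merge \<pi> a b) p r" and qs: "conn (merge \<pi> a b) q s"
    and n: "\<not> conn (merge \<pi> a b) p q"
  note c = conn_merge[OF \<pi>(1)]
  note tr = conn_trans[OF \<pi>(1)] and sy = conn_sym
  note nc = noncrossingD[OF \<pi>]
  have ab': "a < b" and I: "\<And>x y. conn \<pi> x y \<Longrightarrow> (a < x \<and> x \<le> b \<longleftrightarrow> a < y \<and> y \<le> b)"
    using ab by (auto simp: mergeable_def)
  have np: "\<not> conn \<pi> p q" using n c by blast
  have aa: "conn \<pi> a a" "conn \<pi> b b" using ab conn_refl[OF \<pi>(1)] by (auto simp: mergeable_def)
  \<comment> \<open>Exactly one of the pairs \<open>p, r\<close> and \<open>q, s\<close> is joined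
    by the merging alone. If neither were, the crossing would be one of \<open>\<pi>\<close>; if
    both were, \<open>p\<close> and \<open>q\<close> would lie together in the merged block.\<close>
  consider "conn \<pi> p a" "conn \<pi> r b" "conn \<pi> q s" | "conn \<pi> p b" "conn \<pi> r a" "conn \<pi> q s"
    | "conn \<pi> q a" "conn \<pi> s b" "conn \<pi> p r" | "conn \<pi> q b" "conn \<pi> s a" "conn \<pi> p r"
    using pr qs n np lt nc[of p q r s] unfolding c by (metis tr sy)
  then show False
  proof cases
    case 1
    then have q: "\<not> conn \<pi> q a" "\<not> conn \<pi> q b" "\<not> conn \<pi> s b" using n unfolding c by (metis tr sy)+
    have rI: "a < r" "r \<le> b" using I[OF 1(2)] ab' by auto
    have pI: "p \<le> a" using I[OF 1(1)] ab' rI lt by auto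
    show False
    proof (cases "a < q")
      case True
      then have "s \<le> b" using I[OF 1(3)] rI lt by auto
      moreover have "s \<noteq> b" using q aa by auto
      ultimately show False using nc(1)[of q r s b] 1 lt q(2) tr sy by (metis le_neq_implies_less)
    next
      case False
      then have "q < a" using q aa by (metis linorder_neqE_nat)
      moreover have "b < s" using I[OF 1(3)] False lt rI by auto
      ultimately show False using nc(1)[of p q a s] 1 lt np ab' by auto
    qed
  next
    case 2
    then have q: "\<not> conn \<pi> q a" "\<not> conn \<pi> q b" "\<not> conn \<pi> s b" using n unfolding c by (metis tr sy)+
    have pI: "a < p" "p \<le> b" using I[OF 2(1)] ab' by auto
    have rI: "b < r" using I[OF 2(2)] pI lt by auto
    have "b < q" using I[OF 2(3)] pI rI lt by auto
    then show False using nc(1)[of a q r s] 2 lt ab' q(1) sy by (metis order.strict_trans)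
  next
    case 3
    then have q: "\<not> conn \<pi> p a" "\<not> conn \<pi> r a" "\<not> conn \<pi> p b" using n unfolding c by (metis tr sy)+
    have sI: "a < s" "s \<le> b" using I[OF 3(2)] ab' by auto
    have qI: "q \<le> a" using I[OF 3(1)] sI lt by auto
    have "r \<le> a" using I[OF 3(3)] qI lt sI by auto
    moreover have "r \<noteq> a" using q aa by auto
    ultimately show False using nc(1)[of p q r a] 3 lt np by auto
  next
    case 4
    then have q: "\<not> conn \<pi> p a" "\<not> conn \<pi> r b" "\<not> conn \<pi> p b" using n unfolding c by (metis tr sy)+
    have qI: "a < q" "q \<le> b" using I[OF 4(1)] ab' by auto
    have sI: "b < s" using I[OF 4(2)] qI lt by auto
    show False
    proof (cases "r \<le> b")
      case True
      moreover have "r \<noteq> b" using q aa by auto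
      ultimately show False using nc(1)[of p q r b] 4 lt np by auto
    next
      case False
      then have "p \<le> a" using I[OF 4(3)] qI lt by auto
      moreover have "p \<noteq> a" using q aa by auto
      ultimately show False using nc(1)[of p a r s] 4(3) conn_sym[OF 4(2)] lt qI q(1) by simp
    qed
  qed
qed

section \<open>Inversions and the removal of a closest one\<close>

definition inversions :: "nat set \<Rightarrow> (nat \<Rightarrow> nat) \<Rightarrow> nat set set \<Rightarrow> (nat \<times> nat) set" where
  "inversions U g \<pi> = {(a, b). mergeable U \<pi> a b \<and> g b < g a}"

lemma finite_inversions: "finite U \<Longrightarrow> finite (inversions U g \<pi>)"
  by (rule finite_subset[of _ "U \<times> U"]) (auto simp: inversions_def mergeable_def)

text \<open>Closeness refers to the values of \<open>g\<close>, not to the positions. Only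
  injectivity is asked of \<open>g\<close>, since the construction below has to be iterated with
  functions whose values leave the original range.\<close>

locale closest_inversion =
  fixes U :: "nat set" and \<pi> :: "nat set set" and g :: "nat \<Rightarrow> nat" and a b :: nat
  assumes \<pi>: "partition_on U \<pi>" and g: "inj_on g U" and fin: "finite U"
    and inv: "(a, b) \<in> inversions U g \<pi>"
    and closest: "\<And>c d. (c, d) \<in> inversions U g \<pi> \<Longrightarrow> g a - g b \<le> g c - g d"
begin

text \<open>No value between \<open>g b\<close> and \<open>g a\<close> is taken in the block of the Kreweras complement of
  \<open>\<pi>\<close> that contains \<open>a\<close> and \<open>b\<close>, so that \<open>g'\<close> loses only the inversion \<open>(a, b)\<close>. In
  \<open>g''\<close> the position \<open>a\<close> is inverted with all later ones.\<close>

definition "g' = g(a := g b, b := g a)"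
definition "g'' = g(a := Suc (Max (g ` U)))"

abbreviation linked :: "nat \<Rightarrow> nat \<Rightarrow> bool" where
  "linked x y \<equiv> mergeable U \<pi> x y \<or> mergeable U \<pi> y x"

lemma ab: "mergeable U \<pi> a b" "g b < g a" "a < b" "a \<in> U" "b \<in> U"
  using inv by (auto simp: inversions_def mergeable_def)

lemma linked_in: "linked x y \<Longrightarrow> x \<in> U \<and> y \<in> U \<and> x \<noteq> y"
  by (auto simp: mergeable_def)

lemma linked_trans: "linked x y \<Longrightarrow> linked y z \<Longrightarrow> x \<noteq> z \<Longrightarrow> linked x z"
  by (metis mergeable_left mergeable_right mergeable_trans linorder_neqE_nat)

text \<open>If the value at \<open>c\<close> lay strictly in between, \<open>c\<close> would form a
  closer inversion: with \<open>b\<close> if \<open>c\<close> comes before \<open>b\<close>, with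
  \<open>a\<close> otherwise.\<close>

lemma not_between:
  assumes "linked c a"
  shows "\<not> (g b < g c \<and> g c < g a)"
proof
  assume c: "g b < g c \<and> g c < g a"
  then have "c \<noteq> a" "c \<noteq> b" by auto
  then have "linked c b" using linked_trans[of c a b] assms ab by blast
  show False
  proof (cases "c < b")
    case True
    then have "(c, b) \<in> inversions U g \<pi>" using \<open>linked c b\<close> c by (auto simp: inversions_def mergeable_def)
    from closest[OF this] c show False by linarith
  next
    case False
    then have "a < c" using ab by simp
    then have "(a, c) \<in> inversions U g \<pi>" using assms c by (auto simp: inversions_def mergeable_def)
    from closest[OF this] c show False by linarith
  qed
qed

lemma linked_less_iff:
  assumes "linked c a" "c \<noteq> b"
  shows "g c < g a \<longleftrightarrow> g c < g b" "g a < g c \<longleftrightarrow> g b < g c"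
proof -
  have "c \<in> U" "c \<noteq> a" using assms linked_in by blast+
  then have "g c \<noteq> g a" "g c \<noteq> g b" using g ab assms(2) by (auto simp: inj_on_def)
  then show "g c < g a \<longleftrightarrow> g c < g b" "g a < g c \<longleftrightarrow> g b < g c"
    using not_between[OF assms(1)] ab(2) by auto
qed

lemma linked_ab: "linked c b \<Longrightarrow> c \<noteq> a \<Longrightarrow> linked c a"
  using linked_trans[of c b a] ab(1) by blast

lemma g'_simps: "g' a = g b" "g' b = g a" "c \<noteq> a \<Longrightarrow> c \<noteq> b \<Longrightarrow> g' c = g c"
  using ab(3) by (auto simp: g'_def)

lemma g''_simps: "c \<noteq> a \<Longrightarrow> g'' c = g c" "c \<in> U \<Longrightarrow> c \<noteq> a \<Longrightarrow> g'' c < g'' a"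
  using fin by (auto simp: g''_def less_Suc_eq_le)

lemma inj_g': "inj_on g' U"
  using g ab by (auto simp: inj_on_def g'_def)

lemma inj_g'': "inj_on g'' U"
proof (rule inj_onI)
  fix x y assume "x \<in> U" "y \<in> U" "g'' x = g'' y"
  then show "x = y"
    using g''_simps[of x] g''_simps[of y] inj_onD[OF g, of x y]
    by (cases "x = a"; cases "y = a") auto
qed

text \<open>By \<open>not_between\<close> the positions linked to \<open>a\<close> and
  \<open>b\<close> compare with \<open>g a\<close> exactly as with \<open>g b\<close>. Exchanging
  these two values therefore affects only the comparison of \<open>a\<close> with
  \<open>b\<close>.\<close>

lemma g'_less_iff:
  assumes "mergeable U \<pi> c d" "(c, d) \<noteq> (a, b)"
  shows "g' d < g' c \<longleftrightarrow> g d < g c"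
proof -
  have cd: "linked c d" "c \<noteq> d" "c < d" using assms by (auto simp: mergeable_def)
  consider "c \<noteq> a" "c \<noteq> b" "d \<noteq> a" "d \<noteq> b" | "c = a" "d \<noteq> b" | "d = a" "c \<noteq> b"
    | "c = b" "d \<noteq> a" | "d = b" "c \<noteq> a"
    using assms(2) cd ab(3) by fastforce
  then show ?thesis
  proof cases
    case 2
    then show ?thesis using linked_less_iff[of d] cd g'_simps by auto
  next
    case 3
    then show ?thesis using linked_less_iff[of c] cd g'_simps by auto
  next
    case 4
    then show ?thesis using linked_less_iff[of d] linked_ab[of d] cd g'_simps by auto
  next
    case 5
    then show ?thesis using linked_less_iff[of c] linked_ab[of c] cd g'_simps by auto
  qed (simp add: g'_simps)
qed

lemma inversions_insert: "inversions U g \<pi> = insert (a, b) (inversions U g' \<pi>)"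
  and not_inversion: "(a, b) \<notin> inversions U g' \<pi>"
proof -
  show *: "(a, b) \<notin> inversions U g' \<pi>"
    using ab(2) by (simp add: inversions_def g'_simps)
  have eq: "x \<in> inversions U g \<pi> \<longleftrightarrow> x \<in> inversions U g' \<pi>" if "x \<noteq> (a, b)" for x
    using that g'_less_iff by (cases x) (auto simp: inversions_def)
  show "inversions U g \<pi> = insert (a, b) (inversions U g' \<pi>)"
  proof (rule Set.set_eqI)
    fix x
    show "x \<in> inversions U g \<pi> \<longleftrightarrow> x \<in> insert (a, b) (inversions U g' \<pi>)"
      by (cases "x = (a, b)") (simp_all add: inv eq)
  qed
qed

lemma mergeable_iff:
  "mergeable U (merge \<pi> a b) x y \<longleftrightarrow>
    mergeable U \<pi> x y \<and> (x < a \<and> a \<le> y \<longleftrightarrow> x < b \<and> b \<le> y)"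
  by (rule mergeable_merge[OF \<pi> ab(1)])

text \<open>This describes the overlap of the two pieces in the gluing by inversions at the merged
  partition. An inversion \<open>(c, d)\<close> survives the merging unless {c<..d} contains exactly
  one of \<open>a\<close> and \<open>b\<close>. In that case \<open>a\<close> or \<open>b\<close>
  forms a new pair with an endpoint, connected because \<open>\<tau>\<close> is noncrossing and
  joins \<open>a\<close> to \<open>b\<close>. Every mergeable pair \<open>(a, x)\<close> is an
  inversion of \<open>g''\<close>; this is the reason for the large value at
  \<open>a\<close>.\<close>

lemma inversions_merge:
  assumes \<tau>: "partition_on U \<tau>" "noncrossing \<tau>" and cab: "conn \<tau> a b"
  shows "(\<exists>(c, d)\<in>inversions U g' \<pi>. conn \<tau> c d) \<longleftrightarrow>
    (\<exists>(c, d)\<in>inversions U g'' (merge \<pi> a b). conn \<tau> c d)"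
    (is "?L \<longleftrightarrow> ?R")
proof
  note tr = conn_trans[OF \<tau>(1)] and sy = conn_sym
  assume ?L
  then obtain c d where m: "mergeable U \<pi> c d" and lt: "g' d < g' c" and cd: "conn \<tau> c d"
    by (auto simp: inversions_def)
  have cU: "c \<in> U" "d \<in> U" "c < d" using m by (auto simp: mergeable_def)
  have R: ?R if "mergeable U (merge \<pi> a b) x y" "g'' y < g'' x" "conn \<tau> x y" for x y
    using that by (auto simp: inversions_def)
  consider "c < a \<and> a \<le> d \<longleftrightarrow> c < b \<and> b \<le> d" | "c < a" "a \<le> d" "d < b" | "a \<le> c" "c < b" "b \<le> d"
    using ab(3) by linarith
  then show ?R
  proof cases
    case 1
    have "d \<noteq> a" using 1 ab(3) cU by auto
    have "(c, d) \<noteq> (a, b)" using lt ab(2) g'_simps by auto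
    then have "g d < g c" using g'_less_iff[OF m] lt by simp
    then have "g'' d < g'' c" using g''_simps cU \<open>d \<noteq> a\<close> by (cases "c = a") auto
    then show ?thesis using R[of c d] m 1 cd by (simp add: mergeable_iff)
  next
    case 2
    show ?thesis
    proof (cases "d = a")
      case True
      have "mergeable U \<pi> c b" using mergeable_trans[OF _ ab(1), of c] m True by simp
      moreover have "conn \<tau> c b" using tr[OF _ cab, of c] cd True by simp
      moreover have "g b < g c" using lt True g'_simps 2 cU by auto
      ultimately show ?thesis
        using R[of c b] 2 True ab(3) g''_simps by (auto simp: mergeable_iff)
    next
      case False
      then have "a < d" using 2 by simp
      have "mergeable U \<pi> a d" using 2 \<open>a < d\<close> ab(3) 
        by (intro mergeable_inter[OF m ab(1)]) simp_all
      moreover have "conn \<tau> a d"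
        using tr[OF conn_sym[OF noncrossingD(1)[OF \<tau>, of c a d b]] cd] 2 \<open>a < d\<close> cd cab by simp
      ultimately show ?thesis
        using R[of a d] 2 \<open>a < d\<close> g''_simps(2)[of d] cU by (auto simp: mergeable_iff)
    qed
  next
    case 3
    show ?thesis
    proof (cases "c = a")
      case True
      then have "d \<noteq> b" using lt ab(2) g'_simps by auto
      then have "b < d" using 3 by simp
      have "mergeable U \<pi> b d" using m True \<open>b < d\<close> by (intro mergeable_right[OF ab(1)]) simp_all
      moreover have "conn \<tau> b d" using tr[OF conn_sym[OF cab], of d] cd True by simp
      moreover have "g d < g b" using lt True g'_simps \<open>b < d\<close> ab(3) by auto
      ultimately show ?thesis
        using R[of b d] \<open>b < d\<close> ab(3) True g''_simps(1) by (auto simp: mergeable_iff)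
    next
      case False
      then have "a < c" using 3 by simp
      have "mergeable U \<pi> c b" using 3 \<open>a < c\<close> by (intro mergeable_inter[OF ab(1) m]) simp_all
      from mergeable_left[OF ab(1) this \<open>a < c\<close>] have "mergeable U \<pi> a c" .
      moreover have "conn \<tau> a c"
      proof (cases "b = d")
        case True
        then show ?thesis using tr[OF cab, of c] conn_sym[OF cd] by simp
      next
        case False
        then show ?thesis using noncrossingD(1)[OF \<tau>, of a c b d] 3 \<open>a < c\<close> cd cab by simp
      qed
      ultimately show ?thesis
        using R[of a c] 3 \<open>a < c\<close> g''_simps(2)[of c] cU by (auto simp: mergeable_iff)
    qed
  qed
next
  note tr = conn_trans[OF \<tau>(1)] and sy = conn_sym
  assume ?R
  then obtain c d where mm: "mergeable U (merge \<pi> a b) c d" and lt: "g'' d < g'' c"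
    and cd: "conn \<tau> c d"
    by (auto simp: inversions_def)
  then have m: "mergeable U \<pi> c d" and k: "c < a \<and> a \<le> d \<longleftrightarrow> c < b \<and> b \<le> d"
    by (auto simp: mergeable_iff)
  have cU: "c \<in> U" "d \<in> U" "c < d" using m by (auto simp: mergeable_def)
  have L: ?L if "mergeable U \<pi> x y" "g' y < g' x" "conn \<tau> x y" for x y
    using that by (auto simp: inversions_def)
  have "d \<noteq> a" using k ab(3) cU by auto
  show ?L
  proof (cases "c = a")
    case True
    then have db: "d < b" using k cU ab(3) by (metis le_less_linear order_less_irrefl)
    have mdb: "mergeable U \<pi> d b" using mergeable_right[of U \<pi> a d b] m True ab(1) db by simp
    have cdb: "conn \<tau> d b" using tr[OF conn_sym[OF cd], of b] cab True by simp
    have "g d \<noteq> g b" using inj_onD[OF g, of d b] cU ab(5) db by auto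
    \<comment> \<open>The pair \<open>(a, d)\<close> is an inversion of \<open>g'\<close> only if
      \<open>g d\<close> is below \<open>g b\<close>. Otherwise \<open>g d\<close> exceeds
      \<open>g a\<close> as well, since no linked value lies in between, and \<open>(d, b)\<close>
      is an inversion of \<open>g'\<close>.\<close>
    then consider "g b < g d" | "g d < g b" by linarith
    then show ?thesis
    proof cases
      case 1
      then have "g a < g d" using linked_less_iff[of d] m True db by auto
      then show ?thesis using L[of d b] mdb cdb g'_simps db \<open>d \<noteq> a\<close> by auto
    next
      case 2
      then show ?thesis using L[of a d] m True cd g'_simps db \<open>d \<noteq> a\<close> by auto
    qed
  next
    case False
    then have "g d < g c" using lt g''_simps \<open>d \<noteq> a\<close> by simp
    moreover have "(c, d) \<noteq> (a, b)" using False by simp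
    ultimately show ?thesis using L[of c d] g'_less_iff[OF m] m cd by simp
  qed
qed

end

definition proper_nc :: "nat \<Rightarrow> nat set set set" where
  "proper_nc n = nc_partitions n - {{{1..n}}}"

definition coarsenings :: "nat \<Rightarrow> nat set set \<Rightarrow> nat set set set" where
  "coarsenings n \<pi> = {\<tau> \<in> proper_nc n. refines {1..n} \<pi> \<tau>}"

definition linking :: "nat \<Rightarrow> (nat \<times> nat) set \<Rightarrow> nat set set \<Rightarrow> nat set set set" where
  "linking n T \<pi> = {\<tau> \<in> coarsenings n \<pi>. \<exists>(a, b)\<in>T. conn \<tau> a b}"

lemma nc_partitionsD: "\<pi> \<in> nc_partitions n \<Longrightarrow> partition_on {1..n} \<pi> \<and> noncrossing \<pi>"
  by (simp add: nc_partitions_def set_partitions_def)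

lemma proper_ncD: "\<pi> \<in> proper_nc n \<Longrightarrow> partition_on {1..n} \<pi> \<and> noncrossing \<pi> \<and> \<pi> \<noteq> {{1..n}}"
  by (auto simp: proper_nc_def dest: nc_partitionsD)

lemma refines_merge_iff:
  assumes "partition_on U \<pi>" "partition_on U \<tau>" "a \<in> U" "b \<in> U"
  shows "refines U (merge \<pi> a b) \<tau> \<longleftrightarrow> refines U \<pi> \<tau> \<and> conn \<tau> a b"
proof -
  note tr = conn_trans[OF assms(2)]
  have aa: "conn \<pi> a a" "conn \<pi> b b" using assms(3,4) by (simp_all add: conn_refl[OF assms(1)])
  have "(\<forall>x y. conn (merge \<pi> a b) x y \<longrightarrow> conn \<tau> x y) \<longleftrightarrow> (\<forall>x y. conn \<pi> x y \<longrightarrow> conn \<tau> x y) \<and> conn \<tau> a b"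
  proof (intro iffI conjI allI impI)
    assume *: "\<forall>x y. conn (merge \<pi> a b) x y \<longrightarrow> conn \<tau> x y"
    show "conn \<tau> x y" if "conn \<pi> x y" for x y
      using * that conn_merge[OF assms(1), of a b x y] by simp
    show "conn \<tau> a b"
      using * aa conn_merge[OF assms(1), of a b a b] by simp
  next
    fix x y assume *: "(\<forall>x y. conn \<pi> x y \<longrightarrow> conn \<tau> x y) \<and> conn \<tau> a b"
      and "conn (merge \<pi> a b) x y"
    then consider "conn \<pi> x y" | "conn \<pi> x a \<or> conn \<pi> x b" "conn \<pi> y a \<or> conn \<pi> y b"
      using conn_merge[OF assms(1), of a b x y] by blast
    then show "conn \<tau> x y"
    proof cases
      case 2
      have "conn \<tau> z a" if "conn \<pi> z a \<or> conn \<pi> z b" for z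
      proof -
        have "conn \<tau> z a \<or> conn \<tau> z b" using that * by blast
        then show ?thesis using tr[of z b a] conn_sym[of \<tau> a b] * by blast
      qed
      then have "conn \<tau> x a" "conn \<tau> y a" using 2 by simp_all
      then show ?thesis using tr[of x a y] conn_sym[of \<tau> y a] by simp
    qed (use * in simp)
  qed
  then show ?thesis
    using refines_iff_conn[OF assms(1,2)]
      refines_iff_conn[OF partition_on_merge[OF assms(1,3), of b] assms(2)] by simp
qed

text \<open>Stated for an arbitrary order embedding \<open>f\<close>, so that the result applies to
  every chamber. Coarser partitions are smaller: the coarsenings of \<open>\<pi>\<close> become a
  principal downset, a cone with apex \<open>f \<pi>\<close>.\<close>

locale nc_embedding =
  fixes n :: nat and f :: "nat set set \<Rightarrow> 'p" and lt :: "'p \<Rightarrow> 'p \<Rightarrow> bool" and K :: "'k::field itself"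
  assumes inj: "inj_on f (proper_nc n)"
    and lt_iff: "\<And>x y. x \<in> proper_nc n \<Longrightarrow> y \<in> proper_nc n \<Longrightarrow>
      lt (f x) (f y) \<longleftrightarrow> refines {1..n} y x \<and> x \<noteq> y"
begin

abbreviation "U \<equiv> {1..n}"

lemma acyclic_coarsenings:
  assumes "\<pi> \<in> proper_nc n"
  shows "acyclic_below TYPE('k) (f ` coarsenings n \<pi>) lt m"
proof (rule acyclic_below_cone)
  have r: "refines U \<pi> \<pi>" using assms proper_ncD refines_refl by blast
  then show "f \<pi> \<in> f ` coarsenings n \<pi>" using assms by (simp add: coarsenings_def)
  show "\<not> lt (f \<pi>) (f \<pi>)" using lt_iff[OF assms assms] by simp
  fix x assume "x \<in> f ` coarsenings n \<pi>"
  then obtain \<tau> where \<tau>: "x = f \<tau>" "\<tau> \<in> proper_nc n" "refines U \<pi> \<tau>" by (auto simp: coarsenings_def)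
  show "lt x (f \<pi>)" if "x \<noteq> f \<pi>" using that \<tau> lt_iff[OF \<tau>(2) assms] by auto
  show "\<not> lt (f \<pi>) x" using \<tau> lt_iff[OF assms \<tau>(2)] refines_asym[of U \<pi> \<tau>] by auto
qed

lemma linking_down:
  assumes x: "x \<in> f ` proper_nc n" and y: "y \<in> f ` linking n T \<pi>" and "lt x y"
  shows "x \<in> f ` linking n T \<pi>"
proof -
  from x obtain \<tau>' where \<tau>': "x = f \<tau>'" "\<tau>' \<in> proper_nc n" by auto
  from y obtain \<tau> a b where \<tau>: "y = f \<tau>" "\<tau> \<in> proper_nc n" "refines U \<pi> \<tau>" "(a, b) \<in> T" "conn \<tau> a b"
    by (auto simp: linking_def coarsenings_def)
  have r: "refines U \<tau> \<tau>'" using lt_iff[OF \<tau>'(2) \<tau>(2)] \<open>lt x y\<close> \<tau> \<tau>' by simp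
  then have "conn \<tau>' a b"
    using refines_iff_conn[of U \<tau> \<tau>'] \<tau>(2,5) \<tau>'(2) proper_ncD by blast
  moreover have "refines U \<pi> \<tau>'" using r \<tau>(3) refines_trans by blast
  ultimately show ?thesis using \<tau> \<tau>' by (auto simp: linking_def coarsenings_def)
qed

lemma coarsenings_down:
  assumes x: "x \<in> f ` proper_nc n" and y: "y \<in> f ` coarsenings n \<pi>" and "lt x y"
  shows "x \<in> f ` coarsenings n \<pi>"
proof -
  from x obtain \<tau>' where \<tau>': "x = f \<tau>'" "\<tau>' \<in> proper_nc n" by auto
  from y obtain \<tau> where \<tau>: "y = f \<tau>" "\<tau> \<in> proper_nc n" "refines U \<pi> \<tau>"
    by (auto simp: coarsenings_def)
  have "refines U \<tau> \<tau>'" using lt_iff[OF \<tau>'(2) \<tau>(2)] \<open>lt x y\<close> \<tau> \<tau>' by simp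
  then have "refines U \<pi> \<tau>'" using \<tau>(3) refines_trans by blast
  then show ?thesis using \<tau>' by (auto simp: coarsenings_def)
qed

text \<open>The partitions that join \<open>a\<close> and \<open>b\<close> are the coarsenings of
  \<open>merge \<pi> a b\<close> and form a cone. The others are taken care of by \<open>g'\<close>,
  which has one inversion less. The two parts meet in a set of the same kind for \<open>g''\<close>
  and the merged partition. Merging lowers \<open>card \<pi> - 2\<close> by one, just the loss that
  \<open>acyclic_below_Un\<close> permits in the intersection.\<close>

theorem acyclic_linking:
  assumes "\<pi> \<in> nc_partitions n" "inj_on g U" "inversions U g \<pi> \<noteq> {}"
  shows "acyclic_below TYPE('k) (f ` linking n (inversions U g \<pi>) \<pi>) lt (card \<pi> - 2)"
  using assms
proof (induction "card \<pi>" arbitrary: \<pi> g rule: less_induct)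
  case (less \<pi>)
  note outer = less.hyps
  show ?case
    using less.prems
  proof (induction "card (inversions U g \<pi>)" arbitrary: g rule: less_induct)
    case (less g)
    have nc: "partition_on U \<pi>" "noncrossing \<pi>" using less.prems nc_partitionsD by auto
    have "\<exists>x. is_arg_min (\<lambda>(c, d). g c - g d) (\<lambda>x. x \<in> inversions U g \<pi>) x"
      by (rule ex_is_arg_min_if_finite) (use less.prems finite_inversions in auto)
    then obtain x where "is_arg_min (\<lambda>(c, d). g c - g d) (\<lambda>x. x \<in> inversions U g \<pi>) x" ..
    then obtain a b where inv: "(a, b) \<in> inversions U g \<pi>"
      and min: "\<And>c d. (c, d) \<in> inversions U g \<pi> \<Longrightarrow> g a - g b \<le> g c - g d"
      by (cases x) (fastforce simp: is_arg_min_linorder)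
    interpret closest_inversion U \<pi> g a b
      using nc less.prems(2) inv min by unfold_locales auto
    let ?\<pi> = "merge \<pi> a b"
    have m: "partition_on U ?\<pi>" by (rule partition_on_merge[OF nc(1) ab(4)])
    have mnc: "?\<pi> \<in> nc_partitions n"
      using m noncrossing_merge[OF nc ab(1)]
      by (simp add: nc_partitions_def set_partitions_def)
    have cm: "Suc (card ?\<pi>) = card \<pi>"
      by (rule card_merge[OF nc(1)]) (use ab mergeable_not_conn in auto)
    have rm: "refines U ?\<pi> \<tau> \<longleftrightarrow> refines U \<pi> \<tau> \<and> conn \<tau> a b" if "partition_on U \<tau>" for \<tau>
      by (rule refines_merge_iff[OF nc(1) that ab(4,5)])
    let ?A = "f ` linking n (inversions U g' \<pi>) \<pi>" and ?B = "f ` coarsenings n ?\<pi>"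
    have union: "f ` linking n (inversions U g \<pi>) \<pi> = ?A \<union> ?B"
    proof -
      have "linking n (inversions U g \<pi>) \<pi> = linking n (inversions U g' \<pi>) \<pi> \<union> coarsenings n ?\<pi>"
        using rm unfolding linking_def coarsenings_def inversions_insert
        by (auto dest: proper_ncD)
      then show ?thesis by (simp add: image_Un)
    qed
    have eq: "\<tau> \<in> nc_partitions n \<Longrightarrow> refines U ?\<pi> \<tau> \<Longrightarrow>
        (\<exists>(c, d)\<in>inversions U g' \<pi>. conn \<tau> c d) \<longleftrightarrow> (\<exists>(c, d)\<in>inversions U g'' ?\<pi>. conn \<tau> c d)" for \<tau>
      using inversions_merge[of \<tau>] rm nc_partitionsD by blast
    have inter: "?A \<inter> ?B = f ` linking n (inversions U g'' ?\<pi>) ?\<pi>"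
    proof -
      have "linking n (inversions U g' \<pi>) \<pi> \<inter> coarsenings n ?\<pi> = linking n (inversions U g'' ?\<pi>) ?\<pi>"
      proof (rule Set.set_eqI)
        fix \<tau>
        show "\<tau> \<in> linking n (inversions U g' \<pi>) \<pi> \<inter> coarsenings n ?\<pi> \<longleftrightarrow> \<tau> \<in> linking n (inversions U g'' ?\<pi>) ?\<pi>"
        proof (cases "\<tau> \<in> proper_nc n \<and> refines U ?\<pi> \<tau>")
          case True
          then have "refines U \<pi> \<tau>" using rm proper_ncD by blast
          then show ?thesis using True eq[of \<tau>] by (simp add: linking_def coarsenings_def proper_nc_def)
        qed (auto simp: linking_def coarsenings_def)
      qed
      moreover have "f ` (X \<inter> Y) = f ` X \<inter> f ` Y" if "X \<subseteq> proper_nc n" "Y \<subseteq> proper_nc n" for X Y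
        using inj that by (rule inj_on_image_Int)
      ultimately show ?thesis
        by (metis (no_types, lifting) coarsenings_def linking_def mem_Collect_eq subsetI)
    qed
    \<comment> \<open>If all blocks have been merged into one, there is no proper coarsening and no
      apex. But then \<open>\<pi>\<close> has two blocks and the bound is \<open>0\<close>.\<close>
    have B: "acyclic_below TYPE('k) ?B lt (card \<pi> - 2)"
    proof (cases "?\<pi> = {U}")
      case True
      then show ?thesis using cm by simp
    next
      case False
      then show ?thesis using mnc by (intro acyclic_coarsenings) (simp add: proper_nc_def)
    qed
    show ?case
    proof (cases "inversions U g' \<pi> = {}")
      case True
      then have "?A = {}" by (simp add: linking_def)
      then show ?thesis using B union by simp
    next
      case False
      \<comment> \<open>The one-block partition is not in \<open>proper_nc\<close>, yet
        \<open>eq\<close> covers it. It joins every pair, so an inversion of \<open>g'\<close>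
        forces one of \<open>g''\<close>, as the outer induction hypothesis demands.\<close>
      have Un: "{U} \<in> nc_partitions n" "partition_on U {U}"
      proof -
        show "partition_on U {U}" using ab(4) by (intro partition_on_space) auto
        then show "{U} \<in> nc_partitions n"
          by (auto simp: nc_partitions_def set_partitions_def noncrossing_def)
      qed
      obtain c d where cd: "(c, d) \<in> inversions U g' \<pi>" using False by auto
      then have "c \<in> U" "d \<in> U" by (simp_all add: inversions_def mergeable_def)
      then have "conn {U} c d" by (simp add: conn_def)
      with cd have "\<exists>(c, d)\<in>inversions U g' \<pi>. conn {U} c d" by blast
      moreover have "refines U ?\<pi> {U}"
        using m Un(2) by (auto simp: refines_def partition_on_def)
      ultimately have ne: "inversions U g'' ?\<pi> \<noteq> {}"
        using eq[OF Un(1)] by auto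
      have "card (inversions U g' \<pi>) < card (inversions U g \<pi>)"
        unfolding inversions_insert
        using card_insert_disjoint[OF finite_inversions[OF fin] not_inversion] by linarith
      then have A: "acyclic_below TYPE('k) ?A lt (card \<pi> - 2)"
        using less.hyps less.prems(1) inj_g' False by blast
      have "acyclic_below TYPE('k) (?A \<inter> ?B) lt (card ?\<pi> - 2)"
        unfolding inter using outer[of ?\<pi> g''] cm mnc inj_g'' ne by simp
      moreover have "card ?\<pi> - 2 = card \<pi> - 2 - 1" using cm by simp
      ultimately have AB: "acyclic_below TYPE('k) (?A \<inter> ?B) lt (card \<pi> - 2 - 1)" by simp
      have sub: "?A \<union> ?B \<subseteq> f ` proper_nc n" by (auto simp: linking_def coarsenings_def)
      show ?thesis
        unfolding union
      proof (rule acyclic_below_Un[OF A B AB])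
        fix x y assume x: "x \<in> ?A \<union> ?B" and lt: "lt x y"
        have x: "x \<in> f ` proper_nc n" using sub x by (rule subsetD)
        show "x \<in> ?A" if "y \<in> ?A" using linking_down[OF x that lt] .
        show "x \<in> ?B" if "y \<in> ?B" using coarsenings_down[OF x that lt] .
      qed
    qed
  qed
qed

end

section \<open>Chambers\<close>

text \<open>Every element of \<open>Pi2_bar n\<close> is of this form, and the elements with fixed \<open>g\<close> form the
  principal downset generated by the finest one, a copy of the noncrossing partition lattice.\<close>

definition perm_pair :: "(nat \<Rightarrow> nat) \<Rightarrow> nat set set \<Rightarrow> partition_pair" where
  "perm_pair g \<tau> = (\<tau>, (`) g ` \<tau>, \<lambda>B\<in>\<tau>. g ` B)"

lemma partition_on_memD: "partition_on U \<tau> \<Longrightarrow> B \<in> \<tau> \<Longrightarrow> x \<in> B \<Longrightarrow> x \<in> U"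
  by (auto simp: partition_on_def)

lemma partition_on_blockE:
  assumes "partition_on U \<tau>" "x \<in> U"
  obtains B where "B \<in> \<tau>" "x \<in> B"
  using assms by (auto simp: partition_on_def)

lemma fst_perm_pair [simp]: "fst (perm_pair g \<tau>) = \<tau>"
  by (simp add: perm_pair_def)

lemma perm_pair_cong: "(\<And>B. B \<in> \<tau> \<Longrightarrow> g ` B = h ` B) \<Longrightarrow> perm_pair g \<tau> = perm_pair h \<tau>"
  by (auto simp: perm_pair_def restrict_def fun_eq_iff intro!: image_cong)

lemma perm_pair_eqD: "perm_pair g \<tau> = perm_pair h \<tau>' \<Longrightarrow> \<tau> = \<tau>' \<and> (\<forall>B\<in>\<tau>. g ` B = h ` B)"
  by (auto simp: perm_pair_def restrict_def fun_eq_iff split: if_splits)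

lemma Pi2_act_perm_pair: "Pi2_act \<sigma> (perm_pair g \<tau>) = perm_pair (\<sigma> \<circ> g) \<tau>"
  by (auto simp: perm_pair_def image_image restrict_def fun_eq_iff image_comp comp_def)

lemma partition_on_image_perm:
  assumes "g permutes U" "partition_on U \<tau>"
  shows "partition_on U ((`) g ` \<tau>)"
proof -
  have "partition_on (g ` U) ((`) g ` \<tau> - {{}})"
    using assms by (intro partition_on_inj_image permutes_inj_on)
  moreover have "{} \<notin> (`) g ` \<tau>" using partition_onD3[OF assms(2)] by auto
  ultimately show ?thesis using permutes_image[OF assms(1)] by simp
qed

lemma perm_pair_in_Pi2:
  assumes "g permutes {1..n}" "\<tau> \<in> nc_partitions n"
  shows "perm_pair g \<tau> \<in> Pi2 n"
proof -
  have inj: "inj g" using assms permutes_inj by blast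
  have "partition_on {1..n} ((`) g ` \<tau>)"
    using partition_on_image_perm[OF assms(1)] nc_partitionsD[OF assms(2)] by blast
  moreover have "bij_betw (\<lambda>B\<in>\<tau>. g ` B) \<tau> ((`) g ` \<tau>)"
    using inj by (auto simp: bij_betw_def inj_on_def inj_image_eq_iff)
  moreover have "card (g ` B) = card B" for B
    using inj by (intro card_image) (auto simp: inj_on_def)
  ultimately show ?thesis
    using assms by (simp add: perm_pair_def Pi2_def set_partitions_def)
qed

lemma perm_pair_in_Pi2_bar:
  assumes "g permutes {1..n}" "\<tau> \<in> proper_nc n"
  shows "perm_pair g \<tau> \<in> Pi2_bar n"
proof -
  have "perm_pair g \<tau> \<noteq> Pi2_min n"
    using assms(2) by (auto simp: perm_pair_def Pi2_min_def proper_nc_def)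
  then show ?thesis using perm_pair_in_Pi2[OF assms(1)] assms(2) by (simp add: Pi2_bar_def proper_nc_def)
qed

text \<open>Bijections from each block \<open>B\<close> to \<open>l B\<close> are glued together.
  The resulting \<open>g\<close> is far from unique, since only the images of the blocks matter;
  this is how different chambers come to overlap.\<close>

lemma Pi2_perm_pairE:
  assumes "x \<in> Pi2 n"
  obtains g \<tau> where "g permutes {1..n}" "\<tau> \<in> nc_partitions n" "x = perm_pair g \<tau>"
proof -
  let ?U = "{1..n}"
  obtain \<pi> \<rho> l where x: "x = (\<pi>, \<rho>, l)" by (cases x)
  have \<pi>: "\<pi> \<in> nc_partitions n" and \<rho>: "partition_on ?U \<rho>" and l: "l \<in> extensional \<pi>"
    "bij_betw l \<pi> \<rho>" "\<And>B. B \<in> \<pi> \<Longrightarrow> card (l B) = card B"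
    using assms by (auto simp: x Pi2_def set_partitions_def)
  have p: "partition_on ?U \<pi>" using \<pi> nc_partitionsD by blast
  have "\<exists>b. bij_betw b B (l B)" if B: "B \<in> \<pi>" for B
  proof (rule finite_same_card_bij)
    have "l B \<in> \<rho>" using l(2) B by (auto simp: bij_betw_def)
    moreover have "X \<subseteq> ?U" if "X \<in> \<pi> \<or> X \<in> \<rho>" for X using that p \<rho> by (auto simp: partition_on_def)
    ultimately show "finite B" "finite (l B)" using B finite_subset[of _ ?U] by auto
    show "card B = card (l B)" using l(3)[OF B] by simp
  qed
  then obtain b where b: "\<And>B. B \<in> \<pi> \<Longrightarrow> bij_betw (b B) B (l B)" by metis
  define g where "g i = (if i \<in> ?U then b (THE B. B \<in> \<pi> \<and> i \<in> B) i else i)" for i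
  have g: "g i = b B i" if "B \<in> \<pi>" "i \<in> B" for B i
  proof -
    have "(THE B. B \<in> \<pi> \<and> i \<in> B) = B"
      using that partition_on_block_eq[OF p] by (intro the_equality) auto
    moreover have "i \<in> ?U" using that p by (auto simp: partition_on_def)
    ultimately show ?thesis by (simp add: g_def)
  qed
  have gB: "g ` B = l B" if "B \<in> \<pi>" for B
  proof -
    have "g ` B = b B ` B" using g[OF that] by (intro image_cong) auto
    then show ?thesis using b[OF that] by (simp add: bij_betw_def)
  qed
  have im: "(`) g ` \<pi> = \<rho>"
    using gB l(2) by (auto simp: bij_betw_def)
  have "g ` ?U = ?U"
  proof -
    have "g ` \<Union>\<pi> = \<Union>((`) g ` \<pi>)" by auto
    then show ?thesis using im partition_onD1[OF p] partition_onD1[OF \<rho>] by simp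
  qed
  \<comment> \<open>A map of a finite set onto itself is injective.\<close>
  then have "bij_betw g ?U ?U"
    by (simp add: bij_betw_def eq_card_imp_inj_on)
  then have "g permutes ?U"
    by (intro bij_imp_permutes) (auto simp: g_def)
  moreover have "x = perm_pair g \<pi>"
    using l(1) gB im by (auto simp: x perm_pair_def fun_eq_iff extensional_def)
  ultimately show ?thesis using that \<pi> by blast
qed

lemma Pi2_min_eq: "Pi2_min n = perm_pair id {{1..n}}"
  by (simp add: Pi2_min_def perm_pair_def)

lemma Pi2_bar_perm_pairE:
  assumes "x \<in> Pi2_bar n"
  obtains g \<tau> where "g permutes {1..n}" "\<tau> \<in> proper_nc n" "x = perm_pair g \<tau>"
proof -
  obtain g \<tau> where g: "g permutes {1..n}" "\<tau> \<in> nc_partitions n" "x = perm_pair g \<tau>"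
    using assms Pi2_perm_pairE[of x n] by (auto simp: Pi2_bar_def)
  have "\<tau> \<noteq> {{1..n}}"
  proof
    assume "\<tau> = {{1..n}}"
    then have "x = Pi2_min n"
      unfolding g(3) Pi2_min_eq using permutes_image[OF g(1)] by (auto intro!: perm_pair_cong)
    then show False using assms by (simp add: Pi2_bar_def)
  qed
  with g that show ?thesis by (simp add: proper_nc_def)
qed

lemma Union_blocks_subset:
  assumes "refines U \<pi> \<tau>" "B \<in> \<tau>"
  shows "\<Union>{A \<in> \<pi>. A \<subseteq> B} = B"
proof
  show "B \<subseteq> \<Union>{A \<in> \<pi>. A \<subseteq> B}"
  proof
    fix x assume x: "x \<in> B"
    then have "x \<in> \<Union>\<pi>" using assms partition_onD1[of U] unfolding refines_def by blast
    then obtain A where A: "A \<in> \<pi>" "x \<in> A" by auto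
    then obtain C where C: "C \<in> \<tau>" "A \<subseteq> C" using assms(1) by (auto simp: refines_def)
    then have "C = B" using assms A x partition_on_block_eq[of U \<tau> C B x] by (auto simp: refines_def)
    then show "x \<in> \<Union>{A \<in> \<pi>. A \<subseteq> B}" using A C by auto
  qed
qed auto

lemma Pi2_le_perm_pair_iff:
  assumes "g permutes {1..n}"
  shows "Pi2_le n (perm_pair g \<tau>) (perm_pair g \<pi>) \<longleftrightarrow> refines {1..n} \<pi> \<tau>"
proof
  assume r: "refines {1..n} \<pi> \<tau>"
  then have p: "partition_on {1..n} \<pi>" "partition_on {1..n} \<tau>" by (auto simp: refines_def)
  have "\<exists>Y\<in>(`) g ` \<tau>. X \<subseteq> Y" if "X \<in> (`) g ` \<pi>" for X
    using r that by (auto simp: refines_def) (meson image_mono)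
  then have "refines {1..n} ((`) g ` \<pi>) ((`) g ` \<tau>)"
    using partition_on_image_perm[OF assms] p by (simp add: refines_def)
  then show "Pi2_le n (perm_pair g \<tau>) (perm_pair g \<pi>)"
    using r by (auto simp: perm_pair_def subset_iff)
qed (simp add: perm_pair_def)

text \<open>Each block of the coarser partition is a union of blocks of \<open>\<pi>\<close>, and
  the order forces its value to be the union of their images under \<open>g\<close>. So whatever
  lies below belongs to the same \<open>g\<close>.\<close>

lemma Pi2_le_perm_pairD:
  assumes z: "z \<in> Pi2 n" and le: "Pi2_le n z (perm_pair g \<pi>)"
  shows "z = perm_pair g (fst z) \<and> refines {1..n} \<pi> (fst z)"
proof -
  obtain \<tau> \<rho> l where zz: "z = (\<tau>, \<rho>, l)" by (cases z)
  have r: "refines {1..n} \<pi> \<tau>"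
    and ll: "\<And>S. S \<subseteq> \<pi> \<Longrightarrow> \<Union>S \<in> \<tau> \<Longrightarrow> l (\<Union>S) = \<Union>((\<lambda>B\<in>\<pi>. g ` B) ` S)"
    using le by (auto simp: zz perm_pair_def)
  have l: "l \<in> extensional \<tau>" "bij_betw l \<tau> \<rho>" using z by (auto simp: zz Pi2_def)
  have lB: "l B = g ` B" if "B \<in> \<tau>" for B
  proof -
    let ?S = "{A \<in> \<pi>. A \<subseteq> B}"
    have S: "\<Union>?S = B" by (rule Union_blocks_subset[OF r that])
    then have "l B = \<Union>((\<lambda>B\<in>\<pi>. g ` B) ` ?S)" using ll[of ?S] that by simp
    also have "\<dots> = \<Union>((\<lambda>B. g ` B) ` ?S)" by (intro arg_cong[where f = Union] image_cong) auto
    also have "\<dots> = g ` \<Union>?S" by auto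
    finally show ?thesis by (simp only: S)
  qed
  have "\<rho> = (`) g ` \<tau>" using l(2) lB by (auto simp: bij_betw_def)
  then have "z = perm_pair g \<tau>"
    using l(1) lB by (auto simp: zz perm_pair_def fun_eq_iff extensional_def)
  with r show ?thesis by (simp add: zz)
qed

lemma Pi2_less_perm_pairE:
  assumes "z \<in> Pi2_bar n" "Pi2_less n z (perm_pair g \<pi>)"
  obtains \<tau> where "\<tau> \<in> proper_nc n" "z = perm_pair g \<tau>" "refines {1..n} \<pi> \<tau>" "\<tau> \<noteq> \<pi>"
proof -
  have z: "z = perm_pair g (fst z)" "refines {1..n} \<pi> (fst z)"
    using assms Pi2_le_perm_pairD[of z n g \<pi>] by (auto simp: Pi2_less_def Pi2_bar_def)
  moreover obtain h \<tau> where "z = perm_pair h \<tau>" "\<tau> \<in> proper_nc n"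
    using assms(1) by (rule Pi2_bar_perm_pairE)
  ultimately show ?thesis
    using assms(2) that[of "fst z"] by (auto simp: Pi2_less_def)
qed

lemma Pi2_less_perm_pair_iff:
  assumes "g permutes {1..n}"
  shows "Pi2_less n (perm_pair g \<tau>) (perm_pair g \<pi>) \<longleftrightarrow> refines {1..n} \<pi> \<tau> \<and> \<tau> \<noteq> \<pi>"
  using Pi2_le_perm_pair_iff[OF assms] by (auto simp: Pi2_less_def dest: perm_pair_eqD)

lemma nc_embedding_perm_pair:
  assumes "g permutes {1..n}"
  shows "nc_embedding n (perm_pair g) (Pi2_less n)"
  by unfold_locales (auto simp: inj_on_def Pi2_less_perm_pair_iff[OF assms] dest: perm_pair_eqD)

lemma finite_nc_partitions: "finite (nc_partitions n)"
  by (rule finite_subset[OF _ finitely_many_partition_on[of "{1..n}"]])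
    (auto dest: nc_partitionsD)

lemma finite_Pi2: "finite (Pi2 n)"
proof (rule finite_subset)
  show "Pi2 n \<subseteq> (\<lambda>(g, \<tau>). perm_pair g \<tau>) ` ({g. g permutes {1..n}} \<times> nc_partitions n)"
    by (auto elim!: Pi2_perm_pairE)
  show "finite \<dots>"
    using finite_permutations[of "{1..n}"] finite_nc_partitions by simp
qed

lemma finite_Pi2_bar: "finite (Pi2_bar n)"
  using finite_Pi2 by (simp add: Pi2_bar_def)

lemma Pi2_act_Pi2_bar:
  assumes "\<sigma> permutes {1..n}" "x \<in> Pi2_bar n"
  shows "Pi2_act \<sigma> x \<in> Pi2_bar n"
proof -
  obtain g \<tau> where "g permutes {1..n}" "\<tau> \<in> proper_nc n" "x = perm_pair g \<tau>"
    using assms(2) by (rule Pi2_bar_perm_pairE)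
  with perm_pair_in_Pi2_bar[OF permutes_compose[OF this(1) assms(1)]] show ?thesis
    by (simp add: Pi2_act_perm_pair)
qed

lemma Pi2_act_less:
  assumes \<sigma>: "\<sigma> permutes {1..n}" and x: "x \<in> Pi2_bar n" and y: "y \<in> Pi2_bar n" and lt: "Pi2_less n x y"
  shows "Pi2_less n (Pi2_act \<sigma> x) (Pi2_act \<sigma> y)"
proof -
  obtain g \<pi> where g: "g permutes {1..n}" "y = perm_pair g \<pi>" using y by (rule Pi2_bar_perm_pairE)
  obtain \<tau> where "x = perm_pair g \<tau>" "refines {1..n} \<pi> \<tau>" "\<tau> \<noteq> \<pi>"
    using x lt unfolding g(2) by (rule Pi2_less_perm_pairE)
  then show ?thesis
    using g permutes_compose[OF g(1) \<sigma>] by (simp add: Pi2_act_perm_pair Pi2_less_perm_pair_iff)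
qed

section \<open>The number of blocks as a rank\<close>

lemma refines_card_less:
  assumes "refines U P Q" "P \<noteq> Q" "finite U"
  shows "card Q < card P"
proof -
  have P: "partition_on U P" and Q: "partition_on U Q" using assms by (auto simp: refines_def)
  have fin: "finite P" using P assms(3) finite_elements by blast
  obtain f where f: "\<And>X. X \<in> P \<Longrightarrow> f X \<in> Q \<and> X \<subseteq> f X"
    using assms(1) by (auto simp: refines_def) metis
  have sub: "X = f A" if "A \<in> P" "X \<in> Q" "A \<subseteq> X" for A X
  proof -
    have "A \<noteq> {}" using that partition_onD3[OF P] by auto
    then obtain a where "a \<in> A" by auto
    then show ?thesis
      using partition_on_block_eq[OF Q, of X "f A" a] that f[of A] by auto
  qed
  have surj: "f ` P = Q"
  proof
    show "Q \<subseteq> f ` P"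
    proof
      fix X assume X: "X \<in> Q"
      then have "\<Union>{A \<in> P. A \<subseteq> X} = X" using Union_blocks_subset[OF assms(1)] by simp
      moreover have "X \<noteq> {}" using X partition_onD3[OF Q] by auto
      ultimately obtain A where "A \<in> P" "A \<subseteq> X" by blast
      then show "X \<in> f ` P" using sub X by blast
    qed
  qed (use f in auto)
  then have "card Q \<le> card P" using card_image_le[OF fin, of f] by simp
  moreover have "card Q \<noteq> card P"
  proof
    assume "card Q = card P"
    then have inj: "inj_on f P" using surj fin by (intro eq_card_imp_inj_on) auto
    have "f A = A" if A: "A \<in> P" for A
    proof
      show "f A \<subseteq> A"
      proof
        fix x assume x: "x \<in> f A"
        have "\<Union>{B \<in> P. B \<subseteq> f A} = f A" using Union_blocks_subset[OF assms(1)] f[OF A] by simp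
        then obtain B where B: "B \<in> P" "B \<subseteq> f A" "x \<in> B" using x by blast
        then have "f A = f B" using sub f[OF A] by blast
        then show "x \<in> A" using inj A B by (auto simp: inj_on_def)
      qed
    qed (use f A in simp)
    then have "P = Q" using surj by force
    then show False using assms(2) by simp
  qed
  ultimately show ?thesis by simp
qed

lemma card_partition_le:
  assumes "partition_on U P" "finite U"
  shows "card P \<le> card U"
proof -
  have "\<exists>x. x \<in> X" if "X \<in> P" for X
    using that partition_onD3[OF assms(1)] by (cases "X = {}") auto
  then obtain c where c: "\<And>X. X \<in> P \<Longrightarrow> c X \<in> X" by metis
  have "inj_on c P" using c partition_on_block_eq[OF assms(1)] by (metis inj_onI)
  moreover have "c ` P \<subseteq> U" using c assms(1) by (auto simp: partition_on_def)
  ultimately show ?thesis using assms(2) card_inj_on_le by blast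
qed

lemma card_proper_nc:
  assumes "\<tau> \<in> proper_nc n" "1 \<le> n"
  shows "card \<tau> \<in> {2..n}"
proof -
  have p: "partition_on {1..n} \<tau>" "\<tau> \<noteq> {{1..n}}" using assms proper_ncD by auto
  then have "\<tau> \<noteq> {}" using assms(2) by (auto simp: partition_on_def)
  moreover have fin: "finite \<tau>" using p finite_elements by blast
  moreover have "card \<tau> \<noteq> 1"
  proof
    assume "card \<tau> = 1"
    then obtain A where "\<tau> = {A}" by (auto simp: card_1_singleton_iff)
    then show False using p by (auto simp: partition_on_def)
  qed
  moreover from fin \<open>\<tau> \<noteq> {}\<close> have "0 < card \<tau>" by (simp add: card_gt_0_iff)
  ultimately have "2 \<le> card \<tau>" by linarith
  then show ?thesis using card_partition_le[OF p(1)] by simp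
qed

text \<open>The number of blocks increases strictly along a chain and lies between \<open>2\<close>
  and \<open>n\<close>, which leaves room for \<open>n - 1\<close> elements.\<close>

lemma strict_chains_Pi2_bar_top:
  assumes "1 \<le> n"
  shows "strict_chains (Pi2_bar n) (Pi2_less n) n = {}"
proof (rule ccontr)
  assume "\<not> ?thesis"
  then obtain xs where xs: "set xs \<subseteq> Pi2_bar n" "sorted_wrt (Pi2_less n) xs" "length xs = n"
    by (auto simp: strict_chains_def)
  let ?r = "\<lambda>x. card (fst x)"
  have lt: "?r x < ?r y" if xy: "x \<in> Pi2_bar n" "y \<in> Pi2_bar n" "Pi2_less n x y" for x y
  proof -
    obtain g \<pi> where g: "y = perm_pair g \<pi>" using xy(2) by (rule Pi2_bar_perm_pairE)
    obtain \<tau> where "x = perm_pair g \<tau>" "refines {1..n} \<pi> \<tau>" "\<tau> \<noteq> \<pi>"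
      using xy(1,3) unfolding g by (rule Pi2_less_perm_pairE)
    then show ?thesis using refines_card_less[of "{1..n}" \<pi> \<tau>] g by simp
  qed
  have "sorted_wrt (\<lambda>x y. ?r x < ?r y) xs"
  proof (rule sorted_wrt_mono_rel[OF _ xs(2)])
    fix x y assume "x \<in> set xs" "y \<in> set xs" "Pi2_less n x y"
    with xs(1) show "?r x < ?r y" by (intro lt) auto
  qed
  then have "sorted_wrt (<) (List.map ?r xs)" by (simp add: sorted_wrt_map)
  then have "distinct (List.map ?r xs)" using strict_sorted_iff by blast
  then have "card (?r ` set xs) = n" using xs(3) distinct_card by fastforce
  moreover have "?r ` set xs \<subseteq> {2..n}"
    using xs(1) card_proper_nc[OF _ assms] by (auto elim!: Pi2_bar_perm_pairE dest!: subsetD)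
  then have "card (?r ` set xs) \<le> n - 1"
    using card_mono[of "{2..n}" "?r ` set xs"] by simp
  ultimately show False using assms by simp
qed

text \<open>Chambers are added in the order of decreasing \<open>energy\<close>: among the permutations giving rise
  to the same pair, the one that increases on every block has the largest energy.\<close>

definition energy :: "nat set \<Rightarrow> (nat \<Rightarrow> nat) \<Rightarrow> nat" where
  "energy U g = (\<Sum>i\<in>U. i * g i)"

text \<open>The rearrangement inequality: the exchange adds \<open>(b - a) * (g a - g b)\<close> to
  the energy.\<close>

lemma energy_transpose:
  assumes "finite U" "a \<in> U" "b \<in> U" "a < b" "g b < g a"
  shows "energy U g < energy U (g \<circ> transpose a b)"
proof -
  have split: "energy U h = a * h a + b * h b + (\<Sum>i\<in>U - {a, b}. i * h i)" for h
  proof -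
    have "energy U h = sum (\<lambda>i. i * h i) (U - {a, b}) + sum (\<lambda>i. i * h i) {a, b}"
      unfolding energy_def using assms by (intro sum.subset_diff) auto
    then show ?thesis using assms(4) by simp
  qed
  have "(\<Sum>i\<in>U - {a, b}. i * (g \<circ> transpose a b) i) = (\<Sum>i\<in>U - {a, b}. i * g i)"
    by (rule sum.cong) (auto simp: transpose_def)
  moreover have "a * g a + b * g b < a * g b + b * g a"
  proof -
    have "a * (g a - g b) < b * (g a - g b)" using assms(4,5) by simp
    moreover have "x * g a = x * g b + x * (g a - g b)" for x
      using assms(5) by (simp flip: distrib_left)
    from this[of a] this[of b] calculation show ?thesis by linarith
  qed
  ultimately show ?thesis by (simp add: split)
qed

lemma strict_mono_on_unique:
  fixes g h :: "nat \<Rightarrow> nat"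
  assumes g: "strict_mono_on B g" and h: "strict_mono_on B h" and im: "g ` B = h ` B"
  shows "x \<in> B \<Longrightarrow> g x = h x"
proof (induction x rule: less_induct)
  case (less x)
  have key: "\<not> p x < q x" if p: "strict_mono_on B p" and q: "strict_mono_on B q" and "p ` B = q ` B"
    and IH: "\<And>y. y < x \<Longrightarrow> y \<in> B \<Longrightarrow> p y = q y" for p q :: "nat \<Rightarrow> nat"
  proof
    assume lt: "p x < q x"
    have "p x \<in> q ` B" using that(3) less.prems by blast
    then obtain z where z: "z \<in> B" "p x = q z" by auto
    consider "z < x" | "z = x" | "x < z" by linarith
    then show False
    proof cases
      case 1
      then have "p z < p x" using strict_mono_onD[OF p z(1) less.prems] by simp
      then show False using IH[OF 1 z(1)] z(2) by simp
    next
      case 2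
      then show False using z lt by simp
    next
      case 3
      then have "q x < q z" using strict_mono_onD[OF q less.prems z(1)] by simp
      then show False using z lt by simp
    qed
  qed
  show ?case
    using key[OF g h im] key[OF h g im[symmetric]] less.IH by (metis linorder_neqE_nat)
qed

lemma transpose_image_block:
  assumes "partition_on U \<tau>" "conn \<tau> a b" "B \<in> \<tau>"
  shows "(g \<circ> transpose a b) ` B = g ` B"
proof -
  have "a \<in> B \<longleftrightarrow> b \<in> B"
    using conn_block[OF assms(1,3), of a b] conn_block[OF assms(1,3), of b a] assms(2)
      conn_sym[OF assms(2)] by auto
  then have "transpose a b ` B = B" by (rule transpose_image_eq)
  then show ?thesis by (simp only: image_comp[symmetric])
qed

text \<open>A competitor of largest energy cannot increase on every block, or it would be
  \<open>g\<close> by \<open>strict_mono_on_unique\<close>. Exchanging two inverted values inside a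
  block keeps the images of the blocks and raises the energy, a contradiction.\<close>

lemma energy_less_increasing:
  assumes \<tau>: "partition_on {1..n} \<tau>" and g: "g permutes {1..n}"
    and mono: "\<And>B. B \<in> \<tau> \<Longrightarrow> strict_mono_on B g"
    and h: "h permutes {1..n}" "h \<noteq> g" "\<And>B. B \<in> \<tau> \<Longrightarrow> h ` B = g ` B"
  shows "energy {1..n} h < energy {1..n} g"
proof (rule ccontr)
  let ?E = "energy {1..n}"
  define S where "S = {h. h permutes {1..n} \<and> h \<noteq> g \<and> (\<forall>B\<in>\<tau>. h ` B = g ` B) \<and> ?E g \<le> ?E h}"
  assume "\<not> ?E h < ?E g"
  then have "h \<in> S" using h by (simp add: S_def)
  moreover have "finite S"
    by (rule finite_subset[OF _ finite_permutations[of "{1..n}"]]) (auto simp: S_def)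
  ultimately have fS: "finite S" and "S \<noteq> {}" by auto
  then have "Max (?E ` S) \<in> ?E ` S" by (intro Max_in) auto
  then obtain k where k: "k \<in> S" "?E k = Max (?E ` S)" by auto
  have max: "?E y \<le> ?E k" if "y \<in> S" for y using that k(2) fS by simp
  have kp: "k permutes {1..n}" using k by (simp add: S_def)
  have "\<exists>B\<in>\<tau>. \<not> strict_mono_on B k"
  proof (rule ccontr)
    assume "\<not> ?thesis"
    then have mk: "\<And>B. B \<in> \<tau> \<Longrightarrow> strict_mono_on B k" by blast
    have "k i = g i" for i
    proof (cases "i \<in> {1..n}")
      case True
      with \<tau> obtain B where "B \<in> \<tau>" "i \<in> B" by (rule partition_on_blockE)
      then show ?thesis using strict_mono_on_unique[OF mk mono, of B i] k by (simp add: S_def)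
    next
      case False
      then show ?thesis using kp g by (simp add: permutes_not_in)
    qed
    then show False using k by (auto simp: S_def)
  qed
  then obtain B a b where B: "B \<in> \<tau>" "a \<in> B" "b \<in> B" "a < b" "\<not> k a < k b"
    by (auto simp: strict_mono_on_def)
  then have U: "a \<in> {1..n}" "b \<in> {1..n}" using partition_on_memD[OF \<tau>] by blast+
  have "k a \<noteq> k b" using permutes_inj[OF kp] B by (auto simp: inj_eq)
  with B have lt: "k b < k a" by simp
  let ?k = "k \<circ> transpose a b"
  have E: "?E k < ?E ?k" by (rule energy_transpose) (use U B lt in auto)
  have cab: "conn \<tau> a b" using B by (auto simp: conn_def)
  have kS: "\<And>C. C \<in> \<tau> \<Longrightarrow> k ` C = g ` C" "?E g \<le> ?E k" using k(1) by (simp_all add: S_def)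
  have "?k ` C = g ` C" if "C \<in> \<tau>" for C
    using transpose_image_block[OF \<tau> cab that, of k] kS(1)[OF that] by (rule trans)
  moreover have "?k permutes {1..n}" by (rule permutes_compose[OF permutes_swap_id[OF U] kp])
  moreover have "?E g < ?E ?k" using kS(2) E by (rule le_less_trans)
  moreover from this have "?k \<noteq> g" by auto
  ultimately have "?k \<in> S" by (simp add: S_def del: o_apply)
  from max[OF this] E show False by simp
qed

section \<open>Gluing the chambers\<close>

lemma singletons_nc: "(\<lambda>x. {x}) ` {1..n} \<in> nc_partitions n"
  using partition_on_singletons[of "{1..n}"]
  by (auto simp: nc_partitions_def set_partitions_def noncrossing_def)

lemma coarsenings_singletons: "coarsenings n ((\<lambda>x. {x}) ` {1..n}) = proper_nc n"
proof -
  have "refines {1..n} ((\<lambda>x. {x}) ` {1..n}) \<tau>" if "\<tau> \<in> proper_nc n" for \<tau>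
  proof -
    have p: "partition_on {1..n} \<tau>" using that proper_ncD by blast
    have "\<exists>Y\<in>\<tau>. X \<subseteq> Y" if X: "X \<in> (\<lambda>x. {x}) ` {1..n}" for X
    proof -
      obtain x where x: "x \<in> {1..n}" "X = {x}" using X by (rule imageE)
      obtain B where "B \<in> \<tau>" "x \<in> B" by (rule partition_on_blockE[OF p x(1)])
      then show ?thesis using x(2) by blast
    qed
    then show ?thesis using p partition_on_singletons[of "{1..n}"] by (simp add: refines_def)
  qed
  then show ?thesis by (auto simp: coarsenings_def)
qed

lemma inversions_singletons:
  "inversions U g ((\<lambda>x. {x}) ` U) = {(a, b). a \<in> U \<and> b \<in> U \<and> a < b \<and> g b < g a}"
  by (auto simp: inversions_def mergeable_def conn_def)

text \<open>The chamber split off is that of a \<open>g\<close> of least energy in \<open>G\<close>.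
  If one of its elements also lies in another chamber, \<open>g\<close> does not increase on every
  block, as it would then have more energy than the other permutation. Conversely, exchanging the
  values of an inversion inside a block leads to larger energy, hence to a permutation in
  \<open>G\<close>, and to the same element. So the intersection is a \<open>linking\<close> set of
  the finest partition.\<close>

lemma acyclic_Union_chambers:
  assumes n: "2 \<le> n"
    and "G \<subseteq> {g. g permutes {1..n}}" "G \<noteq> {}"
    and "\<And>g h. g \<in> G \<Longrightarrow> h permutes {1..n} \<Longrightarrow> energy {1..n} g < energy {1..n} h \<Longrightarrow> h \<in> G"
  shows "acyclic_below TYPE('k::field) (\<Union>g\<in>G. perm_pair g ` proper_nc n) (Pi2_less n) (n - 1)"
  using assms(2-)
proof (induction "card G" arbitrary: G rule: less_induct)
  case (less G)
  let ?U = "{1..n}" and ?E = "energy {1..n}"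
  let ?fin = "(\<lambda>x. {x}) ` ?U"
  have fin: "finite G" using less.prems(1) finite_permutations[of ?U] finite_subset by blast
  then have "Min (?E ` G) \<in> ?E ` G" using less.prems(2) by (intro Min_in) auto
  then obtain g where g: "g \<in> G" "?E g = Min (?E ` G)" by auto
  have min: "?E g \<le> ?E h" if "h \<in> G" for h using that g(2) fin by simp
  have gp: "g permutes ?U" using g(1) less.prems by auto
  interpret nc_embedding n "perm_pair g" "Pi2_less n" "TYPE('k)"
    by (rule nc_embedding_perm_pair[OF gp])
  have cfin: "card ?fin = n" by (simp add: card_image)
  have "?fin \<noteq> {?U}"
  proof
    assume "?fin = {?U}"
    then have "card ?fin = 1" by simp
    then show False using cfin n by simp
  qed
  then have "?fin \<in> proper_nc n" using singletons_nc by (simp add: proper_nc_def)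
  from acyclic_coarsenings[OF this]
  have B: "acyclic_below TYPE('k) (perm_pair g ` proper_nc n) (Pi2_less n) (n - 1)"
    by (simp only: coarsenings_singletons)
  define G' where "G' = G - {g}"
  let ?A = "\<Union>g\<in>G'. perm_pair g ` proper_nc n" and ?B = "perm_pair g ` proper_nc n"
  have un: "(\<Union>g\<in>G. perm_pair g ` proper_nc n) = ?A \<union> ?B" using g(1) by (auto simp: G'_def)
  have incr: "\<exists>a b. conn \<tau> a b \<and> (a, b) \<in> inversions ?U g ?fin"
    if \<tau>: "partition_on ?U \<tau>" and h: "h \<in> G'" "\<And>B. B \<in> \<tau> \<Longrightarrow> h ` B = g ` B" for \<tau> h
  proof (rule ccontr)
    assume no: "\<not> ?thesis"
    have mono: "strict_mono_on B g" if B: "B \<in> \<tau>" for B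
    proof (rule strict_mono_onI)
      fix a b assume ab: "a \<in> B" "b \<in> B" "a < b"
      then have "a \<in> ?U" "b \<in> ?U" using partition_on_memD[OF \<tau> B] by blast+
      moreover have "conn \<tau> a b" using B ab by (auto simp: conn_def)
      ultimately have "\<not> g b < g a" using no ab by (auto simp: inversions_singletons)
      moreover have "g a \<noteq> g b" using permutes_inj[OF gp] ab by (auto simp: inj_eq)
      ultimately show "g a < g b" by simp
    qed
    have hG: "h permutes ?U" "h \<noteq> g" "h \<in> G" using h(1) less.prems(1) by (auto simp: G'_def)
    have "?E h < ?E g" by (rule energy_less_increasing[OF \<tau> gp mono hG(1,2) h(2)])
    with min[OF hG(3)] show False by simp
  qed
  show ?case
  proof (cases "G' = {}")
    case True
    then show ?thesis using B un by simp
  next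
    case False
    have up: "h \<in> G'" if k: "k \<in> G'" and h: "h permutes ?U" "?E k < ?E h" for k h
    proof -
      have kG: "k \<in> G" using k by (simp add: G'_def)
      have "h \<noteq> g" using min[OF kG] h(2) by auto
      then show ?thesis using less.prems(3)[OF kG h] by (simp add: G'_def)
    qed
    have A: "acyclic_below TYPE('k) ?A (Pi2_less n) (n - 1)"
    proof (rule less.hyps)
      show "card G' < card G" unfolding G'_def using fin g(1) by (rule card_Diff1_less)
      show "G' \<subseteq> {g. g permutes ?U}" using less.prems(1) by (auto simp: G'_def)
    qed (fact False, rule up)
    \<comment> \<open>All permutations agree on the one-block partition. So \<open>incr\<close>,
      applied to it and to any remaining permutation, yields an inversion.\<close>
    have ne: "inversions ?U g ?fin \<noteq> {}"
    proof -
      obtain h where h: "h \<in> G'" using False by auto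
      then have "h permutes ?U" using less.prems(1) by (auto simp: G'_def)
      then have "h ` ?U = g ` ?U" using permutes_image[OF gp] permutes_image[of h ?U] by simp
      moreover have "partition_on ?U {?U}" using n by (intro partition_on_space) simp
      ultimately obtain a b where "(a, b) \<in> inversions ?U g ?fin"
        using incr[of "{?U}" h] h by auto
      then show ?thesis by blast
    qed
    have "?A \<inter> ?B = perm_pair g ` linking n (inversions ?U g ?fin) ?fin"
    proof
      show "?A \<inter> ?B \<subseteq> perm_pair g ` linking n (inversions ?U g ?fin) ?fin"
      proof
        fix x assume "x \<in> ?A \<inter> ?B"
        then obtain h \<tau> \<tau>' where x: "x = perm_pair g \<tau>" "\<tau> \<in> proper_nc n" "h \<in> G'" "x = perm_pair h \<tau>'"
          by blast
        have "perm_pair g \<tau> = perm_pair h \<tau>'" using x(1,4) by simp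
        from conjunct2[OF perm_pair_eqD[OF this]]
        have eq: "h ` C = g ` C" if "C \<in> \<tau>" for C using that by simp
        have "partition_on ?U \<tau>" using proper_ncD[OF x(2)] by simp
        from incr[OF this x(3) eq] obtain a b where "conn \<tau> a b" "(a, b) \<in> inversions ?U g ?fin"
          by blast
        then have "\<tau> \<in> linking n (inversions ?U g ?fin) ?fin"
          unfolding linking_def coarsenings_singletons using x(2) by blast
        then show "x \<in> perm_pair g ` linking n (inversions ?U g ?fin) ?fin" using x(1) by blast
      qed
      show "perm_pair g ` linking n (inversions ?U g ?fin) ?fin \<subseteq> ?A \<inter> ?B"
      proof
        fix x assume "x \<in> perm_pair g ` linking n (inversions ?U g ?fin) ?fin"
        then obtain \<tau> a b where x: "x = perm_pair g \<tau>" "\<tau> \<in> proper_nc n" "conn \<tau> a b"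
          "(a, b) \<in> inversions ?U g ?fin"
          unfolding linking_def coarsenings_singletons by blast
        let ?h = "g \<circ> transpose a b"
        have ab: "a \<in> ?U" "b \<in> ?U" "a < b" "g b < g a"
          using x(4) unfolding inversions_singletons by auto
        have hp: "?h permutes ?U" by (rule permutes_compose[OF permutes_swap_id gp]) (use ab in auto)
        have "?E g < ?E ?h" by (rule energy_transpose) (use ab in auto)
        then have "?h \<in> G'" using less.prems(3)[OF g(1) hp] by (auto simp: G'_def)
        moreover have "x = perm_pair ?h \<tau>"
          unfolding x(1) using proper_ncD[OF x(2)]
          by (intro perm_pair_cong transpose_image_block[OF _ x(3), symmetric]) blast+
        ultimately show "x \<in> ?A \<inter> ?B" using x by blast
      qed
    qed
    moreover have "card ?fin - 2 = n - 1 - 1" using cfin by simp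
    ultimately have AB: "acyclic_below TYPE('k) (?A \<inter> ?B) (Pi2_less n) (n - 1 - 1)"
      using acyclic_linking[OF singletons_nc permutes_inj_on[OF gp] ne] by (simp only:)
    have bar: "perm_pair h ` proper_nc n \<subseteq> Pi2_bar n" if "h \<in> G" for h
    proof (rule image_subsetI)
      show "perm_pair h \<tau> \<in> Pi2_bar n" if "\<tau> \<in> proper_nc n" for \<tau>
        using \<open>h \<in> G\<close> less.prems(1) by (intro perm_pair_in_Pi2_bar that) auto
    qed
    have down: "x \<in> perm_pair h ` proper_nc n"
      if x: "x \<in> ?A \<union> ?B" and y: "y \<in> perm_pair h ` proper_nc n" and lt: "Pi2_less n x y" for x y h
    proof -
      have "x \<in> (\<Union>g\<in>G. perm_pair g ` proper_nc n)" using x un by simp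
      then obtain k where "k \<in> G" "x \<in> perm_pair k ` proper_nc n" by (rule UN_E)
      then have x: "x \<in> Pi2_bar n" using bar by blast
      from y obtain \<pi> where "y = perm_pair h \<pi>" by auto
      with lt have "Pi2_less n x (perm_pair h \<pi>)" by simp
      with x obtain \<tau> where "\<tau> \<in> proper_nc n" "x = perm_pair h \<tau>" by (rule Pi2_less_perm_pairE)
      then show ?thesis by simp
    qed
    show ?thesis
      unfolding un
    proof (rule acyclic_below_Un[OF A B AB])
      fix x y assume xy: "x \<in> ?A \<union> ?B" "Pi2_less n x y"
      show "x \<in> ?A" if y: "y \<in> ?A"
      proof -
        from y obtain h where "h \<in> G'" "y \<in> perm_pair h ` proper_nc n" by (rule UN_E)
        with down[OF xy(1) this(2) xy(2)] show ?thesis by (intro UN_I)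
      qed
      show "x \<in> ?B" if "y \<in> ?B" using down[OF xy(1) that xy(2)] .
    qed
  qed
qed

theorem acyclic_Pi2_bar: "acyclic_below TYPE('k::field) (Pi2_bar n) (Pi2_less n) (n - 1)"
proof (cases "2 \<le> n")
  case True
  have "(\<Union>g\<in>{g. g permutes {1..n}}. perm_pair g ` proper_nc n) = Pi2_bar n"
  proof
    show "Pi2_bar n \<subseteq> (\<Union>g\<in>{g. g permutes {1..n}}. perm_pair g ` proper_nc n)"
    proof
      fix x assume "x \<in> Pi2_bar n"
      then obtain g \<tau> where "g permutes {1..n}" "\<tau> \<in> proper_nc n" "x = perm_pair g \<tau>"
        by (rule Pi2_bar_perm_pairE)
      then show "x \<in> (\<Union>g\<in>{g. g permutes {1..n}}. perm_pair g ` proper_nc n)" by blast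
    qed
    show "(\<Union>g\<in>{g. g permutes {1..n}}. perm_pair g ` proper_nc n) \<subseteq> Pi2_bar n"
      by (intro UN_least image_subsetI perm_pair_in_Pi2_bar) simp_all
  qed
  moreover have "{g. g permutes {1..n}} \<noteq> {}" using permutes_id by blast
  ultimately show ?thesis
    using acyclic_Union_chambers[OF True subset_refl, where 'k = 'k] by simp
qed simp

text \<open>Dimension \<open>n - 2\<close> belongs to chains of \<open>n - 1\<close> elements. It is
  the top degree, and all degrees below it are acyclic.\<close>

lemma Pi2_character_eq:
  assumes "1 \<le> n" "\<sigma> permutes {1..n}"
  shows "(Pi2_character n (int n - 2) \<sigma> :: 'k::field) =
    (\<Sum>k\<le>n - 1. (- 1) ^ (n - 1 - k) * of_nat (card {xs \<in> strict_chains (Pi2_bar n) (Pi2_less n) k.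
      List.map (Pi2_act \<sigma>) xs = xs}))"
proof -
  interpret top_homology "Pi2_bar n" "Pi2_less n" "n - 1" "TYPE('k)"
    using finite_Pi2_bar strict_chains_Pi2_bar_top[OF assms(1)] assms(1) by unfold_locales auto
  have eq: "int n - 2 = int (n - 1) - 1" using assms(1) by simp
  show ?thesis
    unfolding Pi2_character_def eq
    by (rule trace_homology_map[OF acyclic_Pi2_bar Pi2_act_Pi2_bar[OF assms(2)] Pi2_act_less[OF assms(2)]])
qed

section \<open>An identity of Hurwitz\<close>

lemma sum_Pow_insert:
  assumes "finite Z" "z \<notin> Z"
  shows "(\<Sum>S\<in>Pow (insert z Z). f S) = (\<Sum>S\<in>Pow Z. f S) + (\<Sum>S\<in>Pow Z. f (insert z S))"
proof -
  have "inj_on (insert z) (Pow Z)" using assms(2) by (auto simp: inj_on_def)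
  moreover have "Pow Z \<inter> insert z ` Pow Z = {}" using assms(2) by auto
  ultimately show ?thesis
    using assms(1) by (simp add: Pow_insert sum.union_disjoint sum.reindex)
qed

text \<open>The sum is an iterated finite difference of \<open>x ^ j\<close> at \<open>c\<close>,
  with one step \<open>w z\<close> for each \<open>z\<close> in \<open>Z\<close>. Each difference
  lowers the degree, so \<open>card Z > j\<close> of them give \<open>0\<close>.\<close>

lemma alternating_sum_power_eq_0:
  fixes w :: "'z \<Rightarrow> real"
  assumes "finite Z" "j < card Z"
  shows "(\<Sum>S\<in>Pow Z. (- 1) ^ card S * (c - sum w S) ^ j) = 0"
  using assms
proof (induction Z arbitrary: j rule: finite_induct)
  case (insert z Z)
  define g where "g = (\<lambda>i. \<Sum>S\<in>Pow Z. (- 1) ^ card S * (c - sum w S) ^ i)"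
  have IH: "g i = 0" if "i < j" for i
    using insert that unfolding g_def by simp
  have S: "(- 1) ^ card (insert z S) * (c - sum w (insert z S)) ^ j =
      - (\<Sum>i\<le>j. of_nat (j choose i) * (- w z) ^ (j - i) * ((- 1) ^ card S * (c - sum w S) ^ i))"
    if "S \<in> Pow Z" for S
  proof -
    have fS: "finite S" "z \<notin> S" using that insert finite_subset by auto
    have "(c - sum w (insert z S)) ^ j = ((c - sum w S) + (- w z)) ^ j"
      using fS by (simp add: algebra_simps)
    also have "\<dots> = (\<Sum>i\<le>j. of_nat (j choose i) * (c - sum w S) ^ i * (- w z) ^ (j - i))"
      by (rule binomial_ring)
    finally show ?thesis
      using fS by (simp add: sum_distrib_left mult_ac flip: sum_negf)
  qed
  have "(\<Sum>S\<in>Pow (insert z Z). (- 1) ^ card S * (c - sum w S) ^ j) =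
      g j + (\<Sum>S\<in>Pow Z. (- 1) ^ card (insert z S) * (c - sum w (insert z S)) ^ j)"
    using sum_Pow_insert[OF insert.hyps] by (simp add: g_def)
  also have "(\<Sum>S\<in>Pow Z. (- 1) ^ card (insert z S) * (c - sum w (insert z S)) ^ j) =
      - (\<Sum>S\<in>Pow Z. \<Sum>i\<le>j. of_nat (j choose i) * (- w z) ^ (j - i) * ((- 1) ^ card S * (c - sum w S) ^ i))"
    using S by (simp flip: sum_negf)
  also have "\<dots> = - (\<Sum>i\<le>j. of_nat (j choose i) * (- w z) ^ (j - i) * g i)"
    unfolding g_def by (subst sum.swap) (simp add: sum_distrib_left)
  also have "(\<Sum>i\<le>j. of_nat (j choose i) * (- w z) ^ (j - i) * g i) = g j"
  proof -
    have "(\<Sum>i\<le>j. of_nat (j choose i) * (- w z) ^ (j - i) * g i)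
        = (\<Sum>i<j. of_nat (j choose i) * (- w z) ^ (j - i) * g i) + g j"
      by (simp flip: lessThan_Suc_atMost)
    then show ?thesis using IH by simp
  qed
  finally show ?case by simp
qed simp

text \<open>As functions of \<open>y\<close>, both sides have the same derivative by induction on \<open>Z\<close>, and both
  vanish at \<open>- 1\<close> for nonempty \<open>Z\<close>.\<close>

lemma hurwitz_identity_real:
  fixes w :: "'z \<Rightarrow> real"
  assumes "finite Z"
  shows "y ^ card Z + (\<Sum>S\<in>Pow Z - {{}}. (1 - sum w S) ^ (card S - 1) * (y + sum w S) ^ card (Z - S))
    = (y + 1) ^ card Z"
  using assms
proof (induction "card Z" arbitrary: Z y rule: less_induct)
  case (less Z)
  define c where "c = (\<lambda>S. if S = {} then 1 else (1 - sum w S) ^ (card S - 1))"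
  define F where "F = (\<lambda>Z y. \<Sum>S\<in>Pow Z. c S * (y + sum w S) ^ card (Z - S))"
  have F: "F Z y = y ^ card Z + (\<Sum>S\<in>Pow Z - {{}}. (1 - sum w S) ^ (card S - 1) * (y + sum w S) ^ card (Z - S))"
    if "finite Z" for Z y
  proof -
    have "F Z y = c {} * (y + sum w {}) ^ card (Z - {}) + (\<Sum>S\<in>Pow Z - {{}}. c S * (y + sum w S) ^ card (Z - S))"
      unfolding F_def using that by (intro sum.remove) auto
    moreover have "(\<Sum>S\<in>Pow Z - {{}}. c S * (y + sum w S) ^ card (Z - S)) =
        (\<Sum>S\<in>Pow Z - {{}}. (1 - sum w S) ^ (card S - 1) * (y + sum w S) ^ card (Z - S))"
      by (rule sum.cong) (auto simp: c_def)
    ultimately show ?thesis by (simp add: c_def)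
  qed
  have "F Z y = (y + 1) ^ card Z"
  proof (cases "Z = {}")
    case True
    then show ?thesis by (simp add: F_def c_def)
  next
    case False
    \<comment> \<open>At \<open>- 1\<close> the two powers in each summand combine to
      \<open>(1 - sum w S) ^ (card Z - 1)\<close>, up to a sign that alternates with
      \<open>card S\<close>; the exponent is just small enough for
      \<open>alternating_sum_power_eq_0\<close>.\<close>
    have m1: "F Z (- 1) = 0"
    proof -
      have "c S * (- 1 + sum w S) ^ card (Z - S) = (- 1) ^ card Z * ((- 1) ^ card S * (1 - sum w S) ^ (card Z - 1))"
        if S: "S \<in> Pow Z" for S
      proof -
        have fS: "finite S" "card S \<le> card Z" using S less.prems finite_subset card_mono by auto
        have cZS: "card (Z - S) = card Z - card S" using S fS by (simp add: card_Diff_subset)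
        have "(- 1 + sum w S) ^ card (Z - S) = (- 1) ^ card (Z - S) * (1 - sum w S) ^ card (Z - S)"
          by (simp flip: power_mult_distrib)
        moreover have "(- 1 :: real) ^ card (Z - S) = (- 1) ^ card Z * (- 1) ^ card S"
          using fS(2) by (simp add: cZS minus_one_power_iff)
        moreover have "c S * (1 - sum w S) ^ card (Z - S) = (1 - sum w S) ^ (card Z - 1)"
        proof (cases "S = {}")
          case False
          then have "0 < card S" using fS by (simp add: card_gt_0_iff)
          then have "card S - 1 + card (Z - S) = card Z - 1" using fS(2) cZS by simp
          then show ?thesis using False by (simp add: c_def flip: power_add)
        qed (simp add: c_def)
        ultimately show ?thesis by (simp add: mult_ac)
      qed
      then have "F Z (- 1) = (- 1) ^ card Z * (\<Sum>S\<in>Pow Z. (- 1) ^ card S * (1 - sum w S) ^ (card Z - 1))"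
        by (simp add: F_def sum_distrib_left)
      then show ?thesis
        using alternating_sum_power_eq_0[of Z "card Z - 1" 1 w] less.prems False
        by (simp add: card_gt_0_iff)
    qed
    have deriv: "DERIV (\<lambda>y. F Z y - (y + 1) ^ card Z) y :> 0" for y
    proof -
      have "DERIV (\<lambda>y. F Z y) y :> (\<Sum>S\<in>Pow Z. c S * (real (card (Z - S)) * (y + sum w S) ^ (card (Z - S) - 1)))"
        unfolding F_def by (auto intro!: derivative_eq_intros sum.cong)
      \<comment> \<open>The factor \<open>card (Z - S)\<close> counts the \<open>z\<close> outside
        \<open>S\<close>. Sorting by \<open>z\<close> turns the derivative into a sum of the same
        expressions for the sets \<open>Z - {z}\<close>.\<close>
      also have "(\<Sum>S\<in>Pow Z. c S * (real (card (Z - S)) * (y + sum w S) ^ (card (Z - S) - 1))) =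
          (\<Sum>S\<in>Pow Z. \<Sum>z\<in>Z. if z \<in> S then 0 else c S * (y + sum w S) ^ card (Z - {z} - S))"
      proof (rule sum.cong[OF refl])
        fix S
        have "(\<Sum>z\<in>Z. if z \<in> S then 0 else c S * (y + sum w S) ^ card (Z - {z} - S)) =
            (\<Sum>z\<in>Z - S. c S * (y + sum w S) ^ card (Z - {z} - S))"
          using less.prems by (intro sum.mono_neutral_cong_right) auto
        also have "\<dots> = (\<Sum>z\<in>Z - S. c S * (y + sum w S) ^ (card (Z - S) - 1))"
        proof (rule sum.cong[OF refl])
          fix z assume "z \<in> Z - S"
          moreover have "Z - {z} - S = (Z - S) - {z}" by auto
          ultimately show "c S * (y + sum w S) ^ card (Z - {z} - S) = c S * (y + sum w S) ^ (card (Z - S) - 1)"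
            by (simp only: card_Diff_singleton)
        qed
        finally show "c S * (real (card (Z - S)) * (y + sum w S) ^ (card (Z - S) - 1)) =
            (\<Sum>z\<in>Z. if z \<in> S then 0 else c S * (y + sum w S) ^ card (Z - {z} - S))" by simp
      qed
      also have "\<dots> = (\<Sum>z\<in>Z. F (Z - {z}) y)"
      proof (subst sum.swap, rule sum.cong[OF refl])
        fix z
        show "(\<Sum>S\<in>Pow Z. if z \<in> S then 0 else c S * (y + sum w S) ^ card (Z - {z} - S)) = F (Z - {z}) y"
          unfolding F_def using less.prems by (intro sum.mono_neutral_cong_right) auto
      qed
      also have "\<dots> = (\<Sum>z\<in>Z. (y + 1) ^ (card Z - 1))"
      proof (rule sum.cong[OF refl])
        fix z assume z: "z \<in> Z"
        then have "card (Z - {z}) < card Z" using less.prems by (intro card_Diff1_less)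
        from less.hyps[OF this] show "F (Z - {z}) y = (y + 1) ^ (card Z - 1)"
          using F[of "Z - {z}" y] less.prems z by simp
      qed
      finally have "DERIV (\<lambda>y. F Z y) y :> real (card Z) * (y + 1) ^ (card Z - 1)" by simp
      then show ?thesis by (auto intro!: derivative_eq_intros)
    qed
    have "F Z y - (y + 1) ^ card Z = F Z (- 1) - (- 1 + 1) ^ card Z"
      using deriv by (intro DERIV_isconst_all) blast
    then show ?thesis using m1 False less.prems by (simp add: power_0_left)
  qed
  then show ?case using F less.prems by simp
qed

text \<open>In Hurwitz' formula \<open>x * (x + w(S)) ^ (|S| - 1) * (y - w(S)) ^ |Z - S|\<close>,
  summed over all \<open>S\<close>, equals \<open>(x + y) ^ |Z|\<close>. Here \<open>x = 1\<close>,
  \<open>y = k\<close>, the weights are negated, and the term of the empty set stands apart.\<close>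

lemma hurwitz_identity:
  fixes w :: "'z \<Rightarrow> nat" and k :: int
  assumes "finite Z"
  shows "k ^ card Z + (\<Sum>S\<in>Pow Z - {{}}. (1 - int (sum w S)) ^ (card S - 1) * (k + int (sum w S)) ^ card (Z - S))
    = (k + 1) ^ card Z" (is "?l = ?r")
proof -
  have "real_of_int ?l = real_of_int ?r"
    using hurwitz_identity_real[OF assms, of "real_of_int k" "\<lambda>z. real (w z)"] by simp
  then show ?thesis by (simp only: of_int_eq_iff)
qed

section \<open>Labelled noncrossing partitions\<close>

definition crossing :: "nat set \<Rightarrow> nat set \<Rightarrow> bool" where
  "crossing A B \<longleftrightarrow> (\<exists>a\<in>A. \<exists>b\<in>B. \<exists>c\<in>A. \<exists>d\<in>B. a < b \<and> b < c \<and> c < d)"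

definition clash :: "nat set \<Rightarrow> nat set \<Rightarrow> bool" where
  "clash A B \<longleftrightarrow> crossing A B \<or> crossing B A"

lemma clash_sym: "clash A B \<longleftrightarrow> clash B A"
  by (auto simp: clash_def)

lemma noncrossing_iff_clash: "noncrossing P \<longleftrightarrow> (\<forall>A\<in>P. \<forall>B\<in>P. A \<noteq> B \<longrightarrow> \<not> clash A B)"
proof
  assume "noncrossing P"
  then have "\<not> crossing A B" if "A \<in> P" "B \<in> P" "A \<noteq> B" for A B
    using that unfolding noncrossing_def crossing_def by blast
  then show "\<forall>A\<in>P. \<forall>B\<in>P. A \<noteq> B \<longrightarrow> \<not> clash A B" unfolding clash_def by blast
next
  assume *: "\<forall>A\<in>P. \<forall>B\<in>P. A \<noteq> B \<longrightarrow> \<not> clash A B"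
  show "noncrossing P"
    unfolding noncrossing_def
  proof (intro ballI allI impI, rule ccontr)
    fix A B a b c d assume AB: "A \<in> P" "B \<in> P" "A \<noteq> B"
      and "a < b \<and> b < c \<and> c < d \<and> a \<in> A \<and> c \<in> A \<and> b \<in> B \<and> d \<in> B"
    then have "crossing A B" unfolding crossing_def by blast
    with * AB show False unfolding clash_def by blast
  qed
qed

lemma noncrossing_insert:
  "noncrossing (insert Q P) \<longleftrightarrow> noncrossing P \<and> (\<forall>C\<in>P. C \<noteq> Q \<longrightarrow> \<not> clash Q C)"
  unfolding noncrossing_iff_clash using clash_sym[of Q] by blast

text \<open>A crossing can use \<open>p\<close> only as its first point, and there \<open>q\<close>
  serves as well, because both precede all of \<open>C\<close>.\<close>

lemma crossing_insert_Min:
  assumes "p < q" "q \<in> Q" "q \<notin> C" "\<And>x. x \<in> Q \<union> C \<Longrightarrow> q \<le> x"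
  shows "clash (insert p Q) C \<longleftrightarrow> clash Q C"
proof
  have lt: "q < x" if "x \<in> C" for x using assms that by (metis UnI2 le_neq_implies_less)
  assume "clash (insert p Q) C"
  then show "clash Q C" unfolding clash_def
  proof
    assume "crossing (insert p Q) C"
    then obtain a b c d where "a \<in> insert p Q" "b \<in> C" "c \<in> insert p Q" "d \<in> C" "a < b" "b < c" "c < d"
      unfolding crossing_def by blast
    moreover from this have "c \<in> Q" using lt[of b] assms(1) by auto
    ultimately have "crossing Q C" using lt assms(2) unfolding crossing_def by blast
    then show "crossing Q C \<or> crossing C Q" ..
  next
    assume "crossing C (insert p Q)"
    then obtain a b c d where h: "a \<in> C" "b \<in> insert p Q" "c \<in> C" "d \<in> insert p Q" "a < b" "b < c" "c < d"
      unfolding crossing_def by blast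
    then have "b \<in> Q" "d \<in> Q" using lt[of a] lt[of c] assms(1) by auto
    with h have "crossing C Q" unfolding crossing_def by blast
    then show "crossing Q C \<or> crossing C Q" ..
  qed
next
  assume "clash Q C"
  then show "clash (insert p Q) C" unfolding clash_def crossing_def by blast
qed

text \<open>\<open>B\<close> stands before \<open>R\<close>, so a crossing of
  \<open>B \<union> R\<close> with \<open>C\<close> either has its later point of the union in
  \<open>R\<close>, and its earlier point may be replaced by \<open>p\<close> or lies in
  \<open>R\<close> itself, or gives one of \<open>B\<close> with \<open>C\<close>. In the other
  direction \<open>q\<close> replaces \<open>p\<close>.\<close>

lemma clash_Un_iff:
  assumes p: "p < q" "q \<in> B" "p \<notin> C" "q \<notin> C" "\<And>x. x \<in> B \<union> R \<union> C \<Longrightarrow> q \<le> x"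
    and BR: "\<And>x y. x \<in> B \<Longrightarrow> y \<in> R \<Longrightarrow> x < y"
  shows "clash (B \<union> R) C \<longleftrightarrow> clash (insert p R) C \<or> clash B C"
proof
  have lt: "q < x" "p < x" if "x \<in> C" for x
  proof -
    have "q \<le> x" "x \<noteq> q" using p that by auto
    then show "q < x" "p < x" using p(1) by auto
  qed
  have I: "crossing X Y" if "a \<in> X" "b \<in> Y" "c \<in> X" "d \<in> Y" "a < b" "b < c" "c < d" for X Y a b c d
    using that unfolding crossing_def by blast
  {
    assume "clash (B \<union> R) C"
    then consider "crossing (B \<union> R) C" | "crossing C (B \<union> R)" unfolding clash_def by blast
    then show "clash (insert p R) C \<or> clash B C"
    proof cases
      case 1
      then obtain a b c d where h: "a \<in> B \<union> R" "b \<in> C" "c \<in> B \<union> R" "d \<in> C" "a < b" "b < c" "c < d"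
        unfolding crossing_def by blast
      show ?thesis
      proof (cases "c \<in> B")
        case True
        then have "a \<in> B" using h BR[of c a] by auto
        with True h I[of a B b C c d] show ?thesis unfolding clash_def by blast
      next
        case False
        then have "c \<in> R" using h by blast
        then have "crossing (insert p R) C" using h lt(2) by (intro I[of p _ b _ c d]) auto
        then show ?thesis unfolding clash_def by blast
      qed
    next
      case 2
      then obtain a b c d where h: "a \<in> C" "b \<in> B \<union> R" "c \<in> C" "d \<in> B \<union> R" "a < b" "b < c" "c < d"
        unfolding crossing_def by blast
      show ?thesis
      proof (cases "b \<in> B")
        case True
        then have "crossing B C" using h lt(1) p(2) by (intro I[of q _ a _ b c]) auto
        then show ?thesis unfolding clash_def by blast
      next
        case False
        then have "b \<in> R" "d \<in> R" using h BR[of d b] by auto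
        then have "crossing C (insert p R)" using h by (intro I[of a _ b _ c d]) auto
        then show ?thesis unfolding clash_def by blast
      qed
    qed
  }
  assume "clash (insert p R) C \<or> clash B C"
  then consider "clash B C" | "crossing (insert p R) C" | "crossing C (insert p R)" unfolding clash_def by blast
  then show "clash (B \<union> R) C"
  proof cases
    case 1
    then show ?thesis unfolding clash_def crossing_def by blast
  next
    case 2
    then obtain a b c d where h: "a \<in> insert p R" "b \<in> C" "c \<in> insert p R" "d \<in> C" "a < b" "b < c" "c < d"
      unfolding crossing_def by blast
    then have "c \<in> R" using lt(2)[of b] by auto
    then have "crossing (B \<union> R) C" using h lt(1) p(2) by (intro I[of q _ b _ c d]) auto
    then show ?thesis unfolding clash_def by blast
  next
    case 3
    then obtain a b c d where h: "a \<in> C" "b \<in> insert p R" "c \<in> C" "d \<in> insert p R" "a < b" "b < c" "c < d"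
      unfolding crossing_def by blast
    then have "b \<in> R" "d \<in> R" using lt(2)[of a] lt(2)[of c] by auto
    then have "crossing C (B \<union> R)" using h by (intro I[of a _ b _ c d]) auto
    then show ?thesis unfolding clash_def by blast
  qed
qed

text \<open>Any crossing forces one of the form \<open>p < q < y < x\<close> with \<open>y\<close>
  in \<open>R\<close> and \<open>x\<close> in \<open>B\<close>.\<close>

lemma clash_separated_iff:
  assumes "p < q" "q \<in> B" "p \<notin> B" "\<And>x. x \<in> B \<union> R \<Longrightarrow> q \<le> x" "B \<inter> R = {}"
  shows "\<not> clash (insert p R) B \<longleftrightarrow> (\<forall>x\<in>B. \<forall>y\<in>R. x < y)"
proof (intro iffI ballI)
  fix x y assume n: "\<not> clash (insert p R) B" and x: "x \<in> B" and y: "y \<in> R"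
  show "x < y"
  proof (rule ccontr)
    assume "\<not> x < y"
    moreover have "x \<noteq> y" "y \<noteq> q" using assms x y by auto
    moreover have "q \<le> y" using assms y by auto
    ultimately have "p < q" "q < y" "y < x" using assms(1) by auto
    then have "crossing (insert p R) B" using x y assms(2) unfolding crossing_def by blast
    with n show False unfolding clash_def by blast
  qed
next
  assume lt: "\<forall>x\<in>B. \<forall>y\<in>R. x < y"
  have pB: "p < x" if "x \<in> B" for x using assms(1) assms(4)[of x] that by auto
  show "\<not> clash (insert p R) B"
  proof
    assume "clash (insert p R) B"
    then consider a b c d where "a \<in> insert p R" "b \<in> B" "c \<in> insert p R" "d \<in> B" "a < b" "b < c" "c < d"
      | a b c d where "a \<in> B" "b \<in> insert p R" "c \<in> B" "d \<in> insert p R" "a < b" "b < c" "c < d"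
      unfolding clash_def crossing_def by blast
    then show False
    proof cases
      case 1
      then have "c \<in> R" using pB[of b] by auto
      with lt 1 have "d < c" by blast
      with 1 show False by simp
    next
      case 2
      then have "b \<in> R" using pB[of a] by auto
      with lt 2 have "c < b" by blast
      with 2 show False by simp
    qed
  qed
qed

text \<open>Serves to cut a labelled block out of a merged one. Its label prescribes its size and it
  stands before the rest, so it consists of the smallest elements.\<close>

definition initial :: "nat \<Rightarrow> nat set \<Rightarrow> nat set" where
  "initial j X = {x \<in> X. card {y \<in> X. y < x} < j}"

lemma initial_eq:
  fixes X :: "nat set"
  assumes "finite X" "B \<subseteq> X" "\<And>x y. x \<in> B \<Longrightarrow> y \<in> X - B \<Longrightarrow> x < y"
  shows "initial (card B) X = B"
proof (rule Set.set_eqI)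
  fix x
  have fB: "finite B" using assms finite_subset by blast
  have "card {y \<in> X. y < x} < card B" if x: "x \<in> B"
  proof -
    have "{y \<in> X. y < x} \<subseteq> B - {x}" using assms(3)[OF x] by force
    then have "card {y \<in> X. y < x} \<le> card (B - {x})" using fB by (intro card_mono) auto
    also have "\<dots> < card B" using fB x by (intro card_Diff1_less)
    finally show ?thesis .
  qed
  moreover have "card B \<le> card {y \<in> X. y < x}" if "x \<in> X" "x \<notin> B"
    using that assms by (intro card_mono) auto
  ultimately show "x \<in> initial (card B) X \<longleftrightarrow> x \<in> B"
    using assms(2) by (cases "x \<in> B"; cases "x \<in> X") (auto simp: initial_def)
qed

lemma initial_exists:
  fixes X :: "nat set"
  assumes "finite X" "j \<le> card X"
  shows "\<exists>B\<subseteq>X. card B = j \<and> (\<forall>x\<in>B. \<forall>y\<in>X - B. x < y)"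
  using assms(2)
proof (induction j)
  case (Suc j)
  then obtain B where B: "B \<subseteq> X" "card B = j" "\<forall>x\<in>B. \<forall>y\<in>X - B. x < y" by auto
  have fB: "finite B" using B(1) assms(1) finite_subset by blast
  have "X - B \<noteq> {}" using B Suc.prems by auto
  then have m: "Min (X - B) \<in> X - B" "\<And>y. y \<in> X - B \<Longrightarrow> Min (X - B) \<le> y"
    using assms(1) Min_in[of "X - B"] by auto
  have "x < y" if "x \<in> insert (Min (X - B)) B" "y \<in> X - insert (Min (X - B)) B" for x y
    using that m(2)[of y] B(3) by (cases "x = Min (X - B)") auto
  then show ?case
    using B m(1) fB by (intro exI[of _ "insert (Min (X - B)) B"]) auto
qed (rule exI[of _ "{}"], simp)

lemma initial_props:
  fixes X :: "nat set"
  assumes "finite X" "j \<le> card X"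
  shows "initial j X \<subseteq> X" "card (initial j X) = j" "x \<in> initial j X \<Longrightarrow> y \<in> X - initial j X \<Longrightarrow> x < y"
proof -
  obtain B where B: "B \<subseteq> X" "card B = j" "\<forall>x\<in>B. \<forall>y\<in>X - B. x < y"
    using initial_exists[OF assms] by blast
  then have "initial j X = B" using initial_eq[OF assms(1) B(1)] by blast
  with B show "initial j X \<subseteq> X" "card (initial j X) = j"
    "x \<in> initial j X \<Longrightarrow> y \<in> X - initial j X \<Longrightarrow> x < y" by auto
qed

text \<open>A labelled partition is given as the set of the pairs of a block and its label.\<close>

definition labelled :: "('z \<Rightarrow> nat) \<Rightarrow> nat set \<Rightarrow> 'z set \<Rightarrow> (nat set \<times> 'z set) set \<Rightarrow> bool" where
  "labelled w L Z D \<longleftrightarrow> (\<forall>p\<in>D. fst p \<noteq> {} \<and> snd p \<noteq> {} \<and> card (fst p) = sum w (snd p)) \<and>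
     (\<forall>p\<in>D. \<forall>q\<in>D. p \<noteq> q \<longrightarrow> fst p \<inter> fst q = {} \<and> snd p \<inter> snd q = {}) \<and>
     \<Union>(fst ` D) = L \<and> \<Union>(snd ` D) = Z"

definition label_weight :: "('z \<Rightarrow> nat) \<Rightarrow> (nat set \<times> 'z set) set \<Rightarrow> int" where
  "label_weight w D = (\<Prod>p\<in>D. (1 - int (sum w (snd p))) ^ (card (snd p) - 1))"

lemma labelled_memD:
  assumes "labelled w L Z D" "p \<in> D"
  shows "fst p \<noteq> {}" "snd p \<noteq> {}" "card (fst p) = sum w (snd p)" "fst p \<subseteq> L" "snd p \<subseteq> Z"
  using assms by (auto simp: labelled_def)

lemma labelled_disjoint:
  "labelled w L Z D \<Longrightarrow> p \<in> D \<Longrightarrow> q \<in> D \<Longrightarrow> p \<noteq> q \<Longrightarrow> fst p \<inter> fst q = {} \<and> snd p \<inter> snd q = {}"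
  by (simp add: labelled_def)

lemma labelled_subset: "labelled w L Z D \<Longrightarrow> D \<subseteq> Pow L \<times> Pow Z"
  by (auto simp: labelled_def)

lemma finite_labelled: "labelled w L Z D \<Longrightarrow> finite L \<Longrightarrow> finite Z \<Longrightarrow> finite D"
  by (rule finite_subset[OF labelled_subset]) auto

lemma labelled_insert:
  assumes "(B, S) \<notin> D"
  shows "labelled w X Z (insert (B, S) D) \<longleftrightarrow>
    B \<noteq> {} \<and> S \<noteq> {} \<and> card B = sum w S \<and> B \<subseteq> X \<and> S \<subseteq> Z \<and> labelled w (X - B) (Z - S) D"
    (is "?l \<longleftrightarrow> ?r")
proof
  assume l: ?l
  have d: "B \<inter> fst p = {}" "S \<inter> snd p = {}" if "p \<in> D" for p
  proof -
    have "p \<noteq> (B, S)" using that assms by auto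
    then show "B \<inter> fst p = {}" "S \<inter> snd p = {}"
      using labelled_disjoint[OF l, of "(B, S)" p] that by auto
  qed
  have "B \<union> \<Union>(fst ` D) = X" "S \<union> \<Union>(snd ` D) = Z"
    using l by (simp_all add: labelled_def)
  moreover have "B \<inter> \<Union>(fst ` D) = {}" "S \<inter> \<Union>(snd ` D) = {}" using d by blast+
  ultimately have "\<Union>(fst ` D) = X - B" "\<Union>(snd ` D) = Z - S" by auto
  then have "labelled w (X - B) (Z - S) D"
    using l by (simp add: labelled_def)
  then show ?r using labelled_memD[OF l, of "(B, S)"] by simp
next
  assume r: ?r
  then have D: "labelled w (X - B) (Z - S) D" by simp
  have d: "B \<inter> fst p = {}" "S \<inter> snd p = {}" if "p \<in> D" for p
    using labelled_memD(4,5)[OF D that] by auto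
  have "\<Union>(fst ` D) = X - B" "\<Union>(snd ` D) = Z - S" using D by (simp_all add: labelled_def)
  then have "\<Union>(fst ` insert (B, S) D) = X" "\<Union>(snd ` insert (B, S) D) = Z" using r by auto
  moreover have "fst p \<inter> fst q = {} \<and> snd p \<inter> snd q = {}"
    if "p \<in> insert (B, S) D" "q \<in> insert (B, S) D" "p \<noteq> q" for p q
    using that d[of p] d[of q] labelled_disjoint[OF D, of p q] by auto
  moreover have "fst p \<noteq> {} \<and> snd p \<noteq> {} \<and> card (fst p) = sum w (snd p)" if "p \<in> insert (B, S) D" for p
    using that r labelled_memD(1-3)[OF D, of p] by auto
  ultimately show ?l unfolding labelled_def by blast
qed

text \<open>Labelled noncrossing partitions of \<open>L\<close> in which the block of the minimum carries no label.
  They satisfy a recursion on \<open>L\<close>: once the minimum is removed, the next element either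
  belongs to the unlabelled block or starts a labelled one, which can then be merged with the
  rest of the unlabelled block, all of whose elements come later.\<close>

definition configs :: "('z \<Rightarrow> nat) \<Rightarrow> nat set \<Rightarrow> nat \<Rightarrow> 'z set \<Rightarrow> (nat set \<times> (nat set \<times> 'z set) set) set" where
  "configs w L k Z = {(Q, D). Min L \<in> Q \<and> Q \<subseteq> L \<and> card Q = Suc k \<and> labelled w (L - Q) Z D \<and>
     noncrossing (insert Q (fst ` D))}"

lemma finite_configs: "finite L \<Longrightarrow> finite Z \<Longrightarrow> finite (configs w L k Z)"
proof (rule finite_subset)
  show "configs w L k Z \<subseteq> Pow L \<times> Pow (Pow L \<times> Pow Z)"
    unfolding configs_def using labelled_subset[of w _ Z] by fastforce
qed auto

context
  fixes w :: "'z \<Rightarrow> nat" and L :: "nat set" and k :: nat and Z :: "'z set" and p q :: nat and L' :: "nat set"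
  assumes L: "finite L" "p \<in> L" "p = Min L" "L' = L - {p}" "L' \<noteq> {}" "q = Min L'"
    and Z: "finite Z" "\<And>z. z \<in> Z \<Longrightarrow> 0 < w z"
begin

lemma min_facts: "finite L'" "q \<in> L'" "x \<in> L' \<Longrightarrow> q \<le> x" "p < q" "p \<notin> L'"
proof -
  show f: "finite L'" and "p \<notin> L'" using L by auto
  show q: "q \<in> L'" using Min_in[OF f L(5)] L(6) by simp
  show "x \<in> L' \<Longrightarrow> q \<le> x" using f L(6) by simp
  have "p \<le> q" "p \<noteq> q" using q L by auto
  then show "p < q" by simp
qed

text \<open>Once \<open>p\<close> is gone, \<open>q\<close> is the minimum and takes over its role;
  by \<open>crossing_insert_Min\<close> the unlabelled block crosses the same blocks with and
  without \<open>p\<close>.\<close>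

lemma configs_extend:
  assumes "0 < k" "Q \<subseteq> L'"
  shows "(insert p Q, D) \<in> configs w L k Z \<and> q \<in> insert p Q \<longleftrightarrow> (Q, D) \<in> configs w L' (k - 1) Z"
proof (cases "q \<in> Q \<and> labelled w (L' - Q) Z D")
  case False
  moreover have "L - insert p Q = L' - Q" using L by auto
  ultimately show ?thesis using min_facts(4) L(6) by (auto simp: configs_def)
next
  case True
  have fQ: "finite Q" "p \<notin> Q" using assms(2) min_facts finite_subset by auto
  have LQ: "L - insert p Q = L' - Q" using L by auto
  have cl: "clash (insert p Q) C \<longleftrightarrow> clash Q C" "C \<noteq> insert p Q" "C \<noteq> Q" if "C \<in> fst ` D" for C
  proof -
    have C: "C \<subseteq> L' - Q" using that True labelled_memD(4) by blast
    then have "q \<notin> C" using True by auto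
    then show "C \<noteq> insert p Q" "C \<noteq> Q" using True by auto
    show "clash (insert p Q) C \<longleftrightarrow> clash Q C"
      by (rule crossing_insert_Min[OF min_facts(4)]) (use True \<open>q \<notin> C\<close> C assms(2) min_facts(3) in auto)
  qed
  then have "(\<forall>C\<in>fst ` D. C \<noteq> insert p Q \<longrightarrow> \<not> clash (insert p Q) C) \<longleftrightarrow>
      (\<forall>C\<in>fst ` D. C \<noteq> Q \<longrightarrow> \<not> clash Q C)"
    by (intro ball_cong refl) (simp add: cl)
  then have "noncrossing (insert (insert p Q) (fst ` D)) \<longleftrightarrow> noncrossing (insert Q (fst ` D))"
    by (simp only: noncrossing_insert)
  moreover have "insert p Q \<subseteq> L" using assms(2) L by auto
  moreover have "card (insert p Q) = Suc k \<longleftrightarrow> card Q = Suc (k - 1)" using fQ assms(1) by simp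
  ultimately show ?thesis
    unfolding configs_def using True LQ L(3,6) assms(2) by simp
qed

text \<open>Here \<open>q\<close> starts a block \<open>B\<close> with label \<open>S\<close>. Not
  crossing \<open>insert p R\<close> means that \<open>B\<close> stands before \<open>R\<close>, and
  by \<open>clash_Un_iff\<close> the two cross no other block exactly if \<open>B \<union> R\<close>
  crosses none. The new unlabelled block has \<open>k + sum w S\<close> elements, which is parameter
  \<open>k + sum w S - 1\<close>.\<close>

lemma configs_merge:
  assumes B: "q \<in> B" "B \<subseteq> L'" and R: "R \<subseteq> L'" "B \<inter> R = {}" and S: "S \<noteq> {}"
    and D: "(B, S) \<notin> D"
  shows "(insert p R, insert (B, S) D) \<in> configs w L k Z \<longleftrightarrow>
    S \<subseteq> Z \<and> card B = sum w S \<and> (\<forall>x\<in>B. \<forall>y\<in>R. x < y) \<and> (B \<union> R, D) \<in> configs w L' (k + sum w S - 1) (Z - S)"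
proof (cases "S \<subseteq> Z \<and> card B = sum w S \<and> labelled w (L' - (B \<union> R)) (Z - S) D")
  case False
  have "L - insert p R - B = L' - (B \<union> R)" using L by auto
  then have "labelled w (L - insert p R) Z (insert (B, S) D) \<Longrightarrow>
      S \<subseteq> Z \<and> card B = sum w S \<and> labelled w (L' - (B \<union> R)) (Z - S) D"
    by (simp add: labelled_insert[OF D])
  with False show ?thesis by (auto simp: configs_def)
next
  case True
  have fin: "finite B" "finite R" using B R finite_subset[OF _ min_facts(1)] by blast+
  have pBR: "p \<notin> B" "p \<notin> R" using B R min_facts(5) by auto
  have qR: "q \<notin> R" using B R by auto
  have LBR: "L - insert p R - B = L' - (B \<union> R)" using L by auto
  have "B \<subseteq> L - insert p R" using B R pBR L by auto
  then have lab: "labelled w (L - insert p R) Z (insert (B, S) D)"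
    using True B(1) S by (auto simp: labelled_insert[OF D] LBR)
  have C: "C \<subseteq> L' - (B \<union> R)" "q \<notin> C" "p \<notin> C" if "C \<in> fst ` D" for C
  proof -
    show "C \<subseteq> L' - (B \<union> R)" using that True labelled_memD(4) by blast
    then show "q \<notin> C" "p \<notin> C" using B min_facts(5) by auto
  qed
  have sep: "\<not> clash (insert p R) B \<longleftrightarrow> (\<forall>x\<in>B. \<forall>y\<in>R. x < y)"
    by (rule clash_separated_iff[OF min_facts(4) B(1) pBR(1)]) (use B R min_facts(3) in auto)
  have "noncrossing (insert (insert p R) (fst ` insert (B, S) D)) \<longleftrightarrow>
      noncrossing (fst ` D) \<and> (\<forall>C\<in>fst ` D. \<not> clash B C) \<and> \<not> clash (insert p R) B \<and>
      (\<forall>C\<in>fst ` D. \<not> clash (insert p R) C)"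
  proof -
    have Q: "B \<noteq> insert p R" using pBR by auto
    have ne: "C \<noteq> B" "C \<noteq> insert p R" if "C \<in> fst ` D" for C using C[OF that] B by auto
    have "(\<forall>C\<in>fst ` D. C \<noteq> insert p R \<longrightarrow> \<not> clash (insert p R) C) \<longleftrightarrow> (\<forall>C\<in>fst ` D. \<not> clash (insert p R) C)"
      by (intro ball_cong refl) (simp add: ne(2))
    then have "noncrossing (insert (insert p R) (insert B (fst ` D))) \<longleftrightarrow>
        noncrossing (insert B (fst ` D)) \<and> \<not> clash (insert p R) B \<and> (\<forall>C\<in>fst ` D. \<not> clash (insert p R) C)"
      by (simp only: noncrossing_insert[of "insert p R"] ball_simps Q not_False_eq_True simp_thms)
    moreover have "(\<forall>C\<in>fst ` D. C \<noteq> B \<longrightarrow> \<not> clash B C) \<longleftrightarrow> (\<forall>C\<in>fst ` D. \<not> clash B C)"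
      by (intro ball_cong refl) (simp add: ne(1))
    then have "noncrossing (insert B (fst ` D)) \<longleftrightarrow> noncrossing (fst ` D) \<and> (\<forall>C\<in>fst ` D. \<not> clash B C)"
      by (simp only: noncrossing_insert)
    moreover have "fst ` insert (B, S) D = insert B (fst ` D)" by simp
    ultimately show ?thesis by (simp only:) blast
  qed
  also have "\<dots> \<longleftrightarrow> (\<forall>x\<in>B. \<forall>y\<in>R. x < y) \<and> noncrossing (insert (B \<union> R) (fst ` D))"
  proof (cases "\<forall>x\<in>B. \<forall>y\<in>R. x < y")
    case lt: True
    have cl: "clash (B \<union> R) C \<longleftrightarrow> clash (insert p R) C \<or> clash B C" "C \<noteq> B \<union> R" if "C \<in> fst ` D" for C
    proof -
      show "clash (B \<union> R) C \<longleftrightarrow> clash (insert p R) C \<or> clash B C"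
        by (rule clash_Un_iff[OF min_facts(4) B(1)]) (use C[OF that] B R lt min_facts(3) in auto)
      show "C \<noteq> B \<union> R" using C[OF that] B by auto
    qed
    have "(\<forall>C\<in>fst ` D. C \<noteq> B \<union> R \<longrightarrow> \<not> clash (B \<union> R) C) \<longleftrightarrow>
        (\<forall>C\<in>fst ` D. \<not> clash (insert p R) C \<and> \<not> clash B C)"
      by (intro ball_cong refl) (simp add: cl)
    then show ?thesis using lt sep by (simp only: noncrossing_insert) blast
  qed (use sep in blast)
  finally have nc: "noncrossing (insert (insert p R) (fst ` insert (B, S) D)) \<longleftrightarrow>
      (\<forall>x\<in>B. \<forall>y\<in>R. x < y) \<and> noncrossing (insert (B \<union> R) (fst ` D))" .
  have "card B \<noteq> 0" using B fin by auto
  then have W: "0 < sum w S" "card B = sum w S" using True by auto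
  have card: "card (insert p R) = Suc k \<longleftrightarrow> card (B \<union> R) = Suc (k + sum w S - 1)"
    using fin pBR R(2) W by (simp add: card_Un_disjoint)
  have "insert p R \<subseteq> L" "B \<union> R \<subseteq> L'" using B R L by auto
  then show ?thesis
    using True lab nc card B(1) L(3,6) by (auto simp: configs_def)
qed

lemma sum_w_pos:
  assumes "S \<subseteq> Z" "S \<noteq> {}"
  shows "0 < sum w S"
proof (rule sum_pos)
  show "0 < w z" if "z \<in> S" for z using that assms(1) by (intro Z(2)) auto
qed (use assms Z(1) finite_subset in auto)

text \<open>Sorting by the block of \<open>q\<close> produces the left side of
  \<open>hurwitz_identity\<close>: the unlabelled case gives the isolated power, and the case of
  label \<open>S\<close> the summand of \<open>S\<close>.\<close>

lemma sum_configs_step: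
  assumes k: "0 < k \<or> Z \<noteq> {}"
    and IH1: "0 < k \<Longrightarrow> (\<Sum>(Q, D)\<in>configs w L' (k - 1) Z. label_weight w D) = int k ^ card Z"
    and IH2: "\<And>S. S \<subseteq> Z \<Longrightarrow> S \<noteq> {} \<Longrightarrow>
      (\<Sum>(Q, D)\<in>configs w L' (k + sum w S - 1) (Z - S). label_weight w D) = (int k + int (sum w S)) ^ card (Z - S)"
  shows "(\<Sum>(Q, D)\<in>configs w L k Z. label_weight w D) = (int k + 1) ^ card Z"
proof -
  define C1 where "C1 = {(Q, D) \<in> configs w L k Z. q \<in> Q}"
  define C2 where "C2 = {(Q, D) \<in> configs w L k Z. q \<notin> Q}"
  let ?f = "\<lambda>(Q :: nat set, D). label_weight w D"
  have finC: "finite (configs w L k Z)" using finite_configs L(1) Z(1) by blast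
  have "configs w L k Z = C1 \<union> C2" "C1 \<inter> C2 = {}" by (auto simp: C1_def C2_def)
  then have split: "(\<Sum>x\<in>configs w L k Z. ?f x) = (\<Sum>x\<in>C1. ?f x) + (\<Sum>x\<in>C2. ?f x)"
    using finC by (metis finite_Un sum.union_disjoint)
  have s1: "(\<Sum>x\<in>C1. ?f x) = int k ^ card Z"
  proof (cases "0 < k")
    case True
    have "(\<Sum>x\<in>C1. ?f x) = (\<Sum>x\<in>configs w L' (k - 1) Z. ?f x)"
    proof (rule sum.reindex_bij_witness[where i = "\<lambda>(Q, D). (insert p Q, D)" and j = "\<lambda>(Q, D). (Q - {p}, D)"])
      fix x assume x: "x \<in> C1"
      obtain Q D where [simp]: "x = (Q, D)" by (cases x)
      have Q: "(Q, D) \<in> configs w L k Z" "q \<in> Q" using x by (auto simp: C1_def)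
      then have pQ: "p \<in> Q" "Q \<subseteq> L" using L(3) by (auto simp: configs_def)
      then have ins: "insert p (Q - {p}) = Q" "Q - {p} \<subseteq> L'" using L by auto
      then show "(\<lambda>(Q, D). (insert p Q, D)) ((\<lambda>(Q, D). (Q - {p}, D)) x) = x" by simp
      show "(\<lambda>(Q, D). (Q - {p}, D)) x \<in> configs w L' (k - 1) Z"
        using configs_extend[OF True ins(2), of D] Q unfolding ins(1) by simp
      show "?f ((\<lambda>(Q, D). (Q - {p}, D)) x) = ?f x" by simp
    next
      fix x assume x: "x \<in> configs w L' (k - 1) Z"
      obtain Q D where [simp]: "x = (Q, D)" by (cases x)
      have "Q \<subseteq> L'" using x by (simp add: configs_def)
      moreover from this have "p \<notin> Q" using min_facts by auto
      ultimately show "(\<lambda>(Q, D). (Q - {p}, D)) ((\<lambda>(Q, D). (insert p Q, D)) x) = x"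
        "(\<lambda>(Q, D). (insert p Q, D)) x \<in> C1"
        using configs_extend[OF True, of Q D] x by (auto simp: C1_def)
    qed
    then show ?thesis using IH1[OF True] by simp
  next
    case False
    \<comment> \<open>For \<open>k = 0\<close> the unlabelled block is \<open>{p}\<close>, and the
      power \<open>0 ^ card Z\<close> vanishes too, as \<open>Z\<close> is then nonempty.\<close>
    have "C1 = {}"
    proof (rule ccontr)
      assume "C1 \<noteq> {}"
      then obtain Q D where Q: "(Q, D) \<in> C1" by auto
      then have "p \<in> Q" "q \<in> Q" "card Q = 1" using L(3) False by (auto simp: C1_def configs_def)
      then show False using min_facts(4) by (auto simp: card_1_singleton_iff)
    qed
    then show ?thesis using False k Z(1) by (simp add: power_0_left)
  qed
  let ?T = "SIGMA S:Pow Z - {{}}. configs w L' (k + sum w S - 1) (Z - S)"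
  define sel :: "(nat set \<times> 'z set) set \<Rightarrow> nat set \<times> 'z set"
    where "sel = (\<lambda>D. THE b. b \<in> D \<and> q \<in> fst b)"
  have sel: "sel D = b" if "labelled w X Y D" "b \<in> D" "q \<in> fst b" for D b X Y
    unfolding sel_def using that labelled_disjoint[OF that(1), of b] by (intro the_equality) auto
  \<comment> \<open>The label \<open>S\<close> is kept as a separate component, because the merged
    block does not show it and \<open>bwd\<close> needs its weight to cut the block again.\<close>
  define fwd where "fwd = (\<lambda>(Q, D). (snd (sel D), fst (sel D) \<union> (Q - {p}), D - {sel D}))"
  define bwd where "bwd = (\<lambda>(S, Q, D). (insert p (Q - initial (sum w S) Q), insert (initial (sum w S) Q, S) D))"
  have "(\<Sum>x\<in>C2. ?f x) = (\<Sum>(S, Q, D)\<in>?T. (1 - int (sum w S)) ^ (card S - 1) * label_weight w D)"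
  proof (rule sum.reindex_bij_witness[where i = bwd and j = fwd])
    fix x assume x: "x \<in> C2"
    obtain Q D where xx: "x = (Q, D)" by (cases x)
    have Q: "(Q, D) \<in> configs w L k Z" "q \<notin> Q" using x by (auto simp: C2_def xx)
    then have QL: "p \<in> Q" "Q \<subseteq> L" and lab: "labelled w (L - Q) Z D" using L(3) by (auto simp: configs_def)
    have "q \<in> L - Q" using Q(2) min_facts(2) L(4) by auto
    then have "q \<in> \<Union>(fst ` D)" using lab by (simp add: labelled_def)
    then obtain b where b: "b \<in> D" "q \<in> fst b" by auto
    obtain B S where bBS: "b = (B, S)" by (cases b)
    have selD: "sel D = (B, S)" using sel[OF lab b] bBS by simp
    define R where "R = Q - {p}"
    have B: "q \<in> B" "B \<subseteq> L'" "B \<inter> R = {}" "S \<noteq> {}"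
      using labelled_memD[OF lab b(1)] b(2) QL(1) L(4) by (auto simp: bBS R_def)
    have R: "R \<subseteq> L'" "Q = insert p R" using QL L(4) by (auto simp: R_def)
    have D: "D = insert (B, S) (D - {(B, S)})" using b bBS by auto
    have "(insert p R, insert (B, S) (D - {(B, S)})) \<in> configs w L k Z" using Q(1) R(2) D by simp
    then have m: "S \<subseteq> Z" "card B = sum w S" "\<forall>x\<in>B. \<forall>y\<in>R. x < y"
      "(B \<union> R, D - {(B, S)}) \<in> configs w L' (k + sum w S - 1) (Z - S)"
      using configs_merge[OF B(1,2) R(1) B(3,4), of "D - {(B, S)}"] by auto
    have fx: "fwd x = (S, B \<union> R, D - {(B, S)})" by (simp add: fwd_def xx selD R_def)
    show "fwd x \<in> ?T" using m B(4) by (simp add: fx)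
    have fin: "finite (B \<union> R)" using B R min_facts(1) finite_subset[of _ L'] by auto
    have "initial (card B) (B \<union> R) = B" by (rule initial_eq[OF fin]) (use m(3) in auto)
    moreover have "B \<union> R - B = R" using B(3) by auto
    ultimately have "bwd (fwd x) = (insert p R, insert (B, S) (D - {(B, S)}))"
      by (simp add: fx bwd_def flip: m(2))
    then show "bwd (fwd x) = x" using R(2) D xx by simp
    have "finite D" using finite_labelled[OF lab] L(1) Z(1) by simp
    then have "label_weight w D = (1 - int (sum w S)) ^ (card S - 1) * label_weight w (D - {(B, S)})"
      unfolding label_weight_def using b(1) by (subst prod.remove[of D "(B, S)"]) (auto simp: bBS)
    then show "(case fwd x of (S, Q, D) \<Rightarrow> (1 - int (sum w S)) ^ (card S - 1) * label_weight w D) = ?f x"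
      unfolding fx by (simp add: xx)
  next
    fix t assume t: "t \<in> ?T"
    obtain S Q D where tt: "t = (S, Q, D)" by (cases t) auto
    have S: "S \<subseteq> Z" "S \<noteq> {}" and Q: "(Q, D) \<in> configs w L' (k + sum w S - 1) (Z - S)" using t tt by auto
    have W: "0 < sum w S" by (rule sum_w_pos[OF S])
    have QL: "q \<in> Q" "Q \<subseteq> L'" "card Q = k + sum w S" and lab: "labelled w (L' - Q) (Z - S) D"
      using Q W L(6) by (auto simp: configs_def)
    have finQ: "finite Q" using QL(2) min_facts(1) finite_subset by blast
    define B where "B = initial (sum w S) Q"
    define R where "R = Q - B"
    have le: "sum w S \<le> card Q" using QL(3) by simp
    have B: "B \<subseteq> Q" "card B = sum w S" "\<And>x y. x \<in> B \<Longrightarrow> y \<in> Q - B \<Longrightarrow> x < y"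
      unfolding B_def using initial_props[OF finQ le] by blast+
    have qB: "q \<in> B"
    proof (rule ccontr)
      assume "q \<notin> B"
      moreover obtain x where x: "x \<in> B" using B(2) W by fastforce
      ultimately have "x < q" using B(3) QL(1) by blast
      moreover have "q \<le> x" using x B(1) QL(2) min_facts(3) by auto
      ultimately show False by simp
    qed
    have D: "(B, S) \<notin> D"
    proof
      assume "(B, S) \<in> D"
      then have "B \<subseteq> L' - Q" using labelled_memD(4)[OF lab] by fastforce
      then show False using qB QL(1) by auto
    qed
    have BL: "B \<subseteq> L'" "R \<subseteq> L'" "B \<inter> R = {}" "B \<union> R = Q" using B QL by (auto simp: R_def)
    have bt: "bwd t = (insert p R, insert (B, S) D)" by (simp add: bwd_def tt B_def R_def)
    have cf: "bwd t \<in> configs w L k Z"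
      unfolding bt using configs_merge[OF qB BL(1,2,3) S(2) D] S(1) B(2,3) Q BL(4) by (auto simp: R_def)
    have "q \<notin> insert p R" using qB min_facts(4) by (auto simp: R_def)
    then show "bwd t \<in> C2" using cf bt by (auto simp: C2_def)
    have "labelled w (L - insert p R) Z (insert (B, S) D)" using cf bt by (simp add: configs_def)
    then have "sel (insert (B, S) D) = (B, S)" using qB by (intro sel) auto
    moreover have "p \<notin> R" using BL min_facts(5) by auto
    ultimately show "fwd (bwd t) = t" using D BL(4) unfolding bt by (simp add: fwd_def tt)
  qed
  also have "\<dots> = (\<Sum>S\<in>Pow Z - {{}}. \<Sum>(Q, D)\<in>configs w L' (k + sum w S - 1) (Z - S).
      (1 - int (sum w S)) ^ (card S - 1) * label_weight w D)"
    using Z(1) min_facts(1) by (subst sum.Sigma) (auto intro!: finite_configs)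
  also have "\<dots> = (\<Sum>S\<in>Pow Z - {{}}. (1 - int (sum w S)) ^ (card S - 1) * (int k + int (sum w S)) ^ card (Z - S))"
    using IH2 by (intro sum.cong refl) (auto simp: sum_distrib_left case_prod_unfold simp flip: sum_distrib_left)
  finally show ?thesis
    using split s1 hurwitz_identity[OF Z(1), of "int k" w] by simp
qed

end

text \<open>The value depends on the weights only through the size of \<open>L\<close>. This closes
  the induction: after a block labelled \<open>S\<close> is absorbed, just the new size of the
  unlabelled block and the number of remaining labels enter.\<close>

theorem sum_configs:
  assumes "finite L" "finite Z" "\<And>z. z \<in> Z \<Longrightarrow> 0 < w z" "card L = Suc (k + sum w Z)"
  shows "(\<Sum>(Q, D)\<in>configs w L k Z. label_weight w D) = (int k + 1) ^ card Z"
  using assms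
proof (induction "card L" arbitrary: L k Z rule: less_induct)
  case (less L)
  have "L \<noteq> {}" using less.prems(4) by auto
  then have p: "Min L \<in> L" using less.prems(1) by (intro Min_in)
  show ?case
  proof (cases "L = {Min L}")
    case True
    define p where "p = Min L"
    have Lp: "L = {p}" using True p_def by simp
    have "k = 0" "sum w Z = 0" using less.prems(4) Lp by auto
    then have "Z = {}" using less.prems(2,3) by fastforce
    have "configs w L k Z = {({p}, {})}"
    proof -
      have lab: "labelled w {} {} D \<longleftrightarrow> D = {}" for D
        using labelled_memD(1,4)[of w "{}" "{}" D] by (auto simp: labelled_def)
      have nc: "noncrossing {{p}}" by (auto simp: noncrossing_def)
      have "(Q, D) \<in> configs w L k Z \<longleftrightarrow> Q = {p} \<and> D = {}" for Q D
      proof (cases "Q = {p}")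
        case True
        then show ?thesis
          using nc by (auto simp: configs_def Lp \<open>Z = {}\<close> \<open>k = 0\<close> lab)
      qed (auto simp: configs_def Lp)
      then show ?thesis by auto
    qed
    then show ?thesis using \<open>Z = {}\<close> by (simp add: label_weight_def)
  next
    case False
    let ?L' = "L - {Min L}"
    have ne: "?L' \<noteq> {}" using False p by auto
    have c: "card ?L' = k + sum w Z" "card ?L' < card L"
      using less.prems(1,4) p by (simp_all add: card_Diff_singleton)
    have k: "0 < k \<or> Z \<noteq> {}"
    proof (rule ccontr)
      assume "\<not> ?thesis"
      then have "card ?L' = 0" using c by simp
      then show False using ne less.prems(1) by simp
    qed
    show ?thesis
    proof (rule sum_configs_step[OF less.prems(1) p refl refl ne refl less.prems(2,3) k])
      assume "0 < k"
      then show "(\<Sum>(Q, D)\<in>configs w ?L' (k - 1) Z. label_weight w D) = int k ^ card Z"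
        using less.hyps[OF c(2), of Z "k - 1"] less.prems c(1) by simp
    next
      fix S assume S: "S \<subseteq> Z" "S \<noteq> {}"
      have fS: "finite S" using S less.prems(2) finite_subset by blast
      have pos: "0 < sum w S"
      proof (rule sum_pos[OF fS S(2)])
        show "0 < w z" if "z \<in> S" for z using that S(1) by (intro less.prems(3)) auto
      qed
      have "sum w Z = sum w S + sum w (Z - S)" using sum.subset_diff[OF S(1) less.prems(2), of w] by simp
      then have "card ?L' = Suc (k + sum w S - 1 + sum w (Z - S))" using c(1) pos by simp
      from less.hyps[OF c(2) _ _ _ this] show
        "(\<Sum>(Q, D)\<in>configs w ?L' (k + sum w S - 1) (Z - S). label_weight w D) = (int k + int (sum w S)) ^ card (Z - S)"
        using less.prems(1-3) pos by (simp add: of_nat_diff)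
    qed
  qed
qed

definition nc_labelled :: "('z \<Rightarrow> nat) \<Rightarrow> nat set \<Rightarrow> 'z set \<Rightarrow> (nat set \<times> 'z set) set set" where
  "nc_labelled w L Z = {D. labelled w L Z D \<and> noncrossing (fst ` D)}"

text \<open>An artificial minimum \<open>0\<close> forms the unlabelled block \<open>{0}\<close>,
  which crosses nothing. With \<open>k = 0\<close> the sum is then a power of
  \<open>1\<close>.\<close>

theorem sum_nc_labelled:
  assumes L: "finite L" "0 \<notin> L" and Z: "finite Z" "\<And>z. z \<in> Z \<Longrightarrow> 0 < w z" and card: "card L = sum w Z"
  shows "(\<Sum>D\<in>nc_labelled w L Z. label_weight w D) = 1"
proof -
  have Min: "Min (insert 0 L) = 0" using L by (intro Min_eqI) auto
  have "configs w (insert 0 L) 0 Z = Pair {0} ` nc_labelled w L Z"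
  proof -
    have "Q = {0}" if "0 \<in> Q" "card Q = Suc 0" for Q :: "nat set"
      using that by (auto simp: card_Suc_eq)
    moreover have "insert 0 L - {0} = L" using L by auto
    moreover have "\<not> clash {0} C" for C by (auto simp: clash_def crossing_def)
    ultimately show ?thesis
      unfolding configs_def nc_labelled_def Min noncrossing_insert by auto
  qed
  moreover have "inj_on (Pair {0::nat}) (nc_labelled w L Z)" by (simp add: inj_on_def)
  ultimately have "(\<Sum>(Q, D)\<in>configs w (insert 0 L) 0 Z. label_weight w D) = (\<Sum>D\<in>nc_labelled w L Z. label_weight w D)"
    by (simp add: sum.reindex)
  then show ?thesis
    using sum_configs[of "insert 0 L" Z w 0] L Z card by simp
qed

section \<open>Refinements of a labelled partition\<close>

definition finer :: "(nat set \<times> 'z set) set \<Rightarrow> (nat set \<times> 'z set) set \<Rightarrow> bool" where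
  "finer E D \<longleftrightarrow> (\<forall>p\<in>E. \<exists>q\<in>D. fst p \<subseteq> fst q \<and> snd p \<subseteq> snd q)"

lemma noncrossing_subset: "noncrossing P \<Longrightarrow> Q \<subseteq> P \<Longrightarrow> noncrossing Q"
  unfolding noncrossing_def by blast

lemma labelled_restrict:
  assumes D: "labelled w L Z D" and E: "labelled w L Z E" and le: "finer E D" and q: "q \<in> D"
  shows "labelled w (fst q) (snd q) {p \<in> E. fst p \<subseteq> fst q}"
proof -
  have key: "fst p \<subseteq> fst q \<and> snd p \<subseteq> snd q" if p: "p \<in> E" and m: "fst p \<inter> fst q \<noteq> {} \<or> snd p \<inter> snd q \<noteq> {}" for p
  proof -
    obtain r where r: "r \<in> D" "fst p \<subseteq> fst r" "snd p \<subseteq> snd r" using le p unfolding finer_def by blast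
    have "r = q" using labelled_disjoint[OF D r(1) q] r m by blast
    then show ?thesis using r by simp
  qed
  have sd: "snd p \<subseteq> snd q" if "p \<in> E" "fst p \<subseteq> fst q" for p
    using key[OF that(1)] that labelled_memD(1)[OF E that(1)] by blast
  have "\<Union>(fst ` {p \<in> E. fst p \<subseteq> fst q}) = fst q"
  proof
    show "fst q \<subseteq> \<Union>(fst ` {p \<in> E. fst p \<subseteq> fst q})"
    proof
      fix x assume x: "x \<in> fst q"
      then have "x \<in> \<Union>(fst ` E)" using labelled_memD(4)[OF D q] E unfolding labelled_def by blast
      then obtain p where "p \<in> E" "x \<in> fst p" by auto
      then show "x \<in> \<Union>(fst ` {p \<in> E. fst p \<subseteq> fst q})" using key[of p] x by blast
    qed
  qed auto
  moreover have "\<Union>(snd ` {p \<in> E. fst p \<subseteq> fst q}) = snd q"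
  proof
    show "snd q \<subseteq> \<Union>(snd ` {p \<in> E. fst p \<subseteq> fst q})"
    proof
      fix x assume x: "x \<in> snd q"
      then have "x \<in> \<Union>(snd ` E)" using labelled_memD(5)[OF D q] E unfolding labelled_def by blast
      then obtain p where "p \<in> E" "x \<in> snd p" by auto
      then show "x \<in> \<Union>(snd ` {p \<in> E. fst p \<subseteq> fst q})" using key[of p] x by blast
    qed
    show "\<Union>(snd ` {p \<in> E. fst p \<subseteq> fst q}) \<subseteq> snd q" using sd by blast
  qed
  ultimately show ?thesis
    using E unfolding labelled_def by blast
qed

text \<open>The refinements of \<open>D\<close> correspond to families of refinements of its blocks.\<close>

lemma sum_finer:
  fixes w :: "'z \<Rightarrow> nat"
  assumes L: "finite L" "0 \<notin> L" and Z: "finite Z" "\<And>z. z \<in> Z \<Longrightarrow> 0 < w z"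
    and D: "D \<in> nc_labelled w L Z"
  shows "(\<Sum>E\<in>{E \<in> nc_labelled w L Z. finer E D}. label_weight w E) = 1"
proof -
  let ?N = "\<lambda>q. nc_labelled w (fst q) (snd q)"
  have lab: "labelled w L Z D" and nc: "noncrossing (fst ` D)" using D by (auto simp: nc_labelled_def)
  have finD: "finite D" by (rule finite_labelled[OF lab L(1) Z(1)])
  have fin: "finite (fst q)" "finite (snd q)" "0 \<notin> fst q" if "q \<in> D" for q
    using labelled_memD(4,5)[OF lab that] L Z(1) finite_subset by auto
  have finN: "finite (?N q)" if "q \<in> D" for q
  proof (rule finite_subset)
    show "?N q \<subseteq> Pow (Pow (fst q) \<times> Pow (snd q))"
      using labelled_subset unfolding nc_labelled_def by blast
  qed (use fin[OF that] in simp)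
  have one: "(\<Sum>E\<in>?N q. label_weight w E) = 1" if q: "q \<in> D" for q
  proof (rule sum_nc_labelled)
    show "0 < w z" if "z \<in> snd q" for z using that labelled_memD(5)[OF lab q] by (intro Z(2)) auto
    show "card (fst q) = sum w (snd q)" by (rule labelled_memD(3)[OF lab q])
  qed (use fin[OF q] in auto)
  define split where "split = (\<lambda>E :: (nat set \<times> 'z set) set. \<lambda>q\<in>D. {p \<in> E. fst p \<subseteq> fst q})"
  define join where "join = (\<lambda>f :: nat set \<times> 'z set \<Rightarrow> (nat set \<times> 'z set) set. \<Union>q\<in>D. f q)"
  have fsub: "fst p \<subseteq> fst q" "snd p \<subseteq> snd q" "fst p \<noteq> {}" "snd p \<noteq> {}"
    if "f \<in> Pi\<^sub>E D ?N" "q \<in> D" "p \<in> f q" for f p q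
  proof -
    have "labelled w (fst q) (snd q) (f q)" using PiE_mem[OF that(1,2)] by (simp add: nc_labelled_def)
    from labelled_memD[OF this that(3)] show "fst p \<subseteq> fst q" "snd p \<subseteq> snd q" "fst p \<noteq> {}" "snd p \<noteq> {}" by auto
  qed
  have sj: "split (join f) = f" if f: "f \<in> Pi\<^sub>E D ?N" for f
  proof (rule ext)
    fix q
    show "split (join f) q = f q"
    proof (cases "q \<in> D")
      case True
      have "p \<in> f q" if "p \<in> join f" "fst p \<subseteq> fst q" for p
      proof -
        from that(1) obtain r where r: "r \<in> D" "p \<in> f r" by (auto simp: join_def)
        have "r = q" using labelled_disjoint[OF lab r(1) True] fsub[OF f r] that(2) by blast
        then show ?thesis using r by simp
      qed
      moreover have "p \<in> join f \<and> fst p \<subseteq> fst q" if "p \<in> f q" for p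
        using fsub(1)[OF f True that] True that by (auto simp: join_def)
      ultimately have "{p \<in> join f. fst p \<subseteq> fst q} = f q" by blast
      then show ?thesis using True by (simp add: split_def)
    next
      case False
      then show ?thesis using PiE_arb[OF f, of q] by (simp add: split_def)
    qed
  qed
  have "(\<Sum>E\<in>{E \<in> nc_labelled w L Z. finer E D}. label_weight w E) = (\<Sum>f\<in>Pi\<^sub>E D ?N. \<Prod>q\<in>D. label_weight w (f q))"
  proof (rule sum.reindex_bij_witness[where i = join and j = split])
    fix E assume "E \<in> {E \<in> nc_labelled w L Z. finer E D}"
    then have E: "labelled w L Z E" "noncrossing (fst ` E)" "finer E D" by (auto simp: nc_labelled_def)
    show "join (split E) = E"
      using E(3) unfolding join_def split_def finer_def by auto
    have "{p \<in> E. fst p \<subseteq> fst q} \<in> ?N q" if "q \<in> D" for q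
      unfolding nc_labelled_def
      using labelled_restrict[OF lab E(1,3) that] noncrossing_subset[OF E(2)] by (auto simp: image_mono)
    then show "split E \<in> Pi\<^sub>E D ?N" by (auto simp: split_def)
    have disj: "q = r" if "q \<in> D" "r \<in> D" "p \<in> split E q" "p \<in> split E r" for p q r
    proof -
      have "fst p \<subseteq> fst q" "fst p \<subseteq> fst r" "p \<in> E" using that by (auto simp: split_def)
      then show ?thesis using labelled_disjoint[OF lab that(1,2)] labelled_memD(1)[OF E(1)] by blast
    qed
    have "label_weight w (\<Union>q\<in>D. split E q) = (\<Prod>q\<in>D. label_weight w (split E q))"
      unfolding label_weight_def
    proof (rule prod.UNION_disjoint[OF finD])
      have "finite E" using finite_labelled[OF E(1) L(1) Z(1)] .
      then show "\<forall>q\<in>D. finite (split E q)" by (simp add: split_def)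
      show "\<forall>q\<in>D. \<forall>r\<in>D. q \<noteq> r \<longrightarrow> split E q \<inter> split E r = {}" using disj by blast
    qed
    then show "(\<Prod>q\<in>D. label_weight w (split E q)) = label_weight w E"
      using \<open>join (split E) = E\<close> by (simp add: join_def)
  next
    fix f assume f: "f \<in> Pi\<^sub>E D ?N"
    show "split (join f) = f" by (rule sj[OF f])
    have fl: "labelled w (fst q) (snd q) (f q)" "noncrossing (fst ` f q)" if "q \<in> D" for q
      using PiE_mem[OF f that] by (simp_all add: nc_labelled_def)
    have un: "\<Union>(fst ` f q) = fst q" "\<Union>(snd ` f q) = snd q" if "q \<in> D" for q
      using fl(1)[OF that] by (simp_all add: labelled_def)
    have "labelled w L Z (join f)"
      unfolding labelled_def
    proof (intro conjI ballI impI)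
      show "\<Union>(fst ` join f) = L"
      proof -
        have "\<Union>(fst ` join f) = (\<Union>q\<in>D. \<Union>(fst ` f q))" by (auto simp: join_def)
        also have "\<dots> = (\<Union>q\<in>D. fst q)" using un(1) by simp
        also have "\<dots> = L" using lab by (simp add: labelled_def)
        finally show ?thesis .
      qed
      show "\<Union>(snd ` join f) = Z"
      proof -
        have "\<Union>(snd ` join f) = (\<Union>q\<in>D. \<Union>(snd ` f q))" by (auto simp: join_def)
        also have "\<dots> = (\<Union>q\<in>D. snd q)" using un(2) by simp
        also have "\<dots> = Z" using lab by (simp add: labelled_def)
        finally show ?thesis .
      qed
    next
      fix p assume "p \<in> join f"
      then obtain q where "q \<in> D" "p \<in> f q" by (auto simp: join_def)
      from labelled_memD[OF fl(1)[OF this(1)] this(2)]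
      show "fst p \<noteq> {}" "snd p \<noteq> {}" "card (fst p) = sum w (snd p)" by auto
      fix p' assume "p' \<in> join f" and ne: "p \<noteq> p'"
      then obtain q' where q': "q' \<in> D" "p' \<in> f q'" by (auto simp: join_def)
      have "fst p \<inter> fst p' = {} \<and> snd p \<inter> snd p' = {}"
      proof (cases "q = q'")
        case True
        then have "p' \<in> f q" using q'(2) by simp
        from labelled_disjoint[OF fl(1)[OF \<open>q \<in> D\<close>] \<open>p \<in> f q\<close> this ne] show ?thesis .
      next
        case False
        then have "fst q \<inter> fst q' = {}" "snd q \<inter> snd q' = {}"
          using labelled_disjoint[OF lab \<open>q \<in> D\<close> q'(1)] by simp_all
        then show ?thesis
          using fsub(1,2)[OF f \<open>q \<in> D\<close> \<open>p \<in> f q\<close>] fsub(1,2)[OF f q'] by (intro conjI) blast+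
      qed
      then show "fst p \<inter> fst p' = {}" "snd p \<inter> snd p' = {}" by auto
    qed
    moreover have "noncrossing (fst ` join f)"
      unfolding noncrossing_iff_clash
    proof (intro ballI impI notI)
      fix A B assume AB: "A \<in> fst ` join f" "B \<in> fst ` join f" "A \<noteq> B" "clash A B"
      from AB(1) obtain q where q: "q \<in> D" "A \<in> fst ` f q" by (auto simp: join_def)
      from AB(2) obtain r where r: "r \<in> D" "B \<in> fst ` f r" by (auto simp: join_def)
      have "A \<subseteq> fst q" "B \<subseteq> fst r"
        using Union_upper[OF q(2)] Union_upper[OF r(2)] un(1)[OF q(1)] un(1)[OF r(1)] by simp_all
      then have "clash (fst q) (fst r)" using AB(4) unfolding clash_def crossing_def by blast
      moreover have "fst q \<in> fst ` D" "fst r \<in> fst ` D" using q(1) r(1) by simp_all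
      ultimately have "fst q = fst r" using nc unfolding noncrossing_iff_clash by blast
      then have "q = r"
        using labelled_disjoint[OF lab q(1) r(1)] labelled_memD(1)[OF lab q(1)] by auto
      then have "B \<in> fst ` f q" using r(2) by simp
      then show False using fl(2)[OF q(1)] q(2) AB(3,4) unfolding noncrossing_iff_clash by blast
    qed
    moreover have "finer (join f) D"
      unfolding finer_def
    proof
      fix p assume "p \<in> join f"
      then obtain q where "q \<in> D" "p \<in> f q" by (auto simp: join_def)
      with fsub(1,2)[OF f this] show "\<exists>q\<in>D. fst p \<subseteq> fst q \<and> snd p \<subseteq> snd q" by blast
    qed
    ultimately show "join f \<in> {E \<in> nc_labelled w L Z. finer E D}" by (simp add: nc_labelled_def)
  qed
  \<comment> \<open>The blocks are refined independently, so the sum of products is a product of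
    sums, and each of these is \<open>1\<close> by \<open>sum_nc_labelled\<close>.\<close>
  also have "\<dots> = (\<Prod>q\<in>D. \<Sum>E\<in>?N q. label_weight w E)"
    using finD finN by (intro prod_sum_PiE[symmetric])
  also have "\<dots> = 1" using one by simp
  finally show ?thesis .
qed

section \<open>Alternating sums over chains\<close>

text \<open>A chain above \<open>x\<close> is empty or consists of some \<open>y\<close> followed by
  a chain above \<open>y\<close>. By induction the sum is \<open>1\<close> minus the sum of
  \<open>\<Phi>\<close> over the elements strictly above \<open>x\<close>, which is
  \<open>\<Phi> x\<close> by hypothesis.\<close>

lemma alternating_chain_sum:
  fixes \<Phi> :: "'p \<Rightarrow> int"
  assumes fin: "finite P"
    and trans: "\<And>x y z. x \<in> P \<Longrightarrow> y \<in> P \<Longrightarrow> z \<in> P \<Longrightarrow> lt x y \<Longrightarrow> lt y z \<Longrightarrow> lt x z"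
    and irrefl: "\<And>x. \<not> lt x x"
    and sum: "\<And>x. x \<in> P \<Longrightarrow> (\<Sum>y\<in>{y \<in> P. y = x \<or> lt x y}. \<Phi> y) = 1"
    and x: "x \<in> P"
  shows "(\<Sum>xs\<in>{xs. set xs \<subseteq> {y \<in> P. lt x y} \<and> sorted_wrt lt xs}. (- 1) ^ length xs) = \<Phi> x"
  using x
proof (induction "card {y \<in> P. lt x y}" arbitrary: x rule: less_induct)
  case (less x)
  let ?up = "\<lambda>x. {y \<in> P. lt x y}"
  let ?ch = "\<lambda>x. {xs. set xs \<subseteq> ?up x \<and> sorted_wrt lt xs}"
  have dist: "distinct xs" if "sorted_wrt lt xs" for xs
    using that irrefl by (induction xs) auto
  have finch: "finite (?ch x)" for x
  proof (rule finite_subset)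
    show "?ch x \<subseteq> {xs. set xs \<subseteq> ?up x \<and> distinct xs}" using dist by auto
    show "finite {xs. set xs \<subseteq> ?up x \<and> distinct xs}" using fin by (intro finite_subset_distinct) simp
  qed
  have sub: "?up y \<subset> ?up x" if "y \<in> ?up x" for y
  proof
    show "?up y \<subseteq> ?up x" using that less.prems trans[of x y] by auto
    show "?up y \<noteq> ?up x" using that irrefl by blast
  qed
  have dec: "?ch x = insert [] (\<Union>y\<in>?up x. (#) y ` ?ch y)"
  proof
    show "?ch x \<subseteq> insert [] (\<Union>y\<in>?up x. (#) y ` ?ch y)"
    proof
      fix xs assume xs: "xs \<in> ?ch x"
      show "xs \<in> insert [] (\<Union>y\<in>?up x. (#) y ` ?ch y)"
      proof (cases xs)
        case (Cons y ys)
        then have "y \<in> ?up x" "ys \<in> ?ch y" using xs by auto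
        then show ?thesis using Cons by blast
      qed simp
    qed
    show "insert [] (\<Union>y\<in>?up x. (#) y ` ?ch y) \<subseteq> ?ch x"
    proof
      fix xs assume "xs \<in> insert [] (\<Union>y\<in>?up x. (#) y ` ?ch y)"
      then consider "xs = []" | y ys where "y \<in> ?up x" "ys \<in> ?ch y" "xs = y # ys" by blast
      then show "xs \<in> ?ch x"
      proof cases
        case 2
        then have "set ys \<subseteq> ?up x" using sub[of y] by blast
        then show ?thesis using 2 by auto
      qed simp
    qed
  qed
  have IH: "(\<Sum>ys\<in>?ch y. (- 1) ^ length ys) = \<Phi> y" if "y \<in> ?up x" for y
    using that fin psubset_card_mono[OF _ sub[OF that]] by (intro less.hyps) auto
  have "(\<Sum>xs\<in>?ch x. (- 1 :: int) ^ length xs) = 1 + (\<Sum>xs\<in>(\<Union>y\<in>?up x. (#) y ` ?ch y). (- 1) ^ length xs)"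
    unfolding dec using fin finch by (subst sum.insert) auto
  also have "(\<Sum>xs\<in>(\<Union>y\<in>?up x. (#) y ` ?ch y). (- 1 :: int) ^ length xs) =
      (\<Sum>y\<in>?up x. \<Sum>xs\<in>(#) y ` ?ch y. (- 1) ^ length xs)"
    using fin finch by (intro sum.UNION_disjoint) auto
  also have "\<dots> = (\<Sum>y\<in>?up x. - \<Phi> y)"
  proof (rule sum.cong[OF refl])
    fix y assume "y \<in> ?up x"
    have "(\<Sum>xs\<in>(#) y ` ?ch y. (- 1 :: int) ^ length xs) = (\<Sum>ys\<in>?ch y. - ((- 1) ^ length ys))"
      by (subst sum.reindex) auto
    then show "(\<Sum>xs\<in>(#) y ` ?ch y. (- 1 :: int) ^ length xs) = - \<Phi> y"
      using IH[OF \<open>y \<in> ?up x\<close>] by (simp add: sum_negf)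
  qed
  also have "1 + \<dots> = \<Phi> x"
  proof -
    have "{y \<in> P. y = x \<or> lt x y} = insert x (?up x)" using less.prems by auto
    then have "\<Phi> x + (\<Sum>y\<in>?up x. \<Phi> y) = 1" using sum[OF less.prems] fin irrefl by simp
    then show ?thesis by (simp add: sum_negf)
  qed
  finally show ?case .
qed

section \<open>Fixed points of a permutation\<close>

lemma finer_antisym:
  assumes D: "labelled w L Z D" and E: "labelled w L Z E" and "finer D E" "finer E D"
  shows "D = E"
proof -
  have "D \<subseteq> E" if D: "labelled w L Z D" and E: "labelled w L Z E" and DE: "finer D E" and ED: "finer E D" for D E
  proof
    fix p assume p: "p \<in> D"
    then obtain q where q: "q \<in> E" "fst p \<subseteq> fst q" "snd p \<subseteq> snd q" using DE unfolding finer_def by blast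
    then obtain r where r: "r \<in> D" "fst q \<subseteq> fst r" "snd q \<subseteq> snd r" using ED unfolding finer_def by blast
    have "p = r" using labelled_disjoint[OF D p r(1)] labelled_memD(1)[OF D p] q r by blast
    then have "p = q" using q r by (intro prod_eqI) auto
    then show "p \<in> E" using q(1) by simp
  qed
  then show ?thesis using assms by blast
qed

locale fixed_points =
  fixes n :: nat and \<sigma> :: "nat \<Rightarrow> nat"
  assumes n: "1 \<le> n" and \<sigma>: "\<sigma> permutes {1..n}"
begin

abbreviation U :: "nat set" where "U \<equiv> {1..n}"

definition orbits :: "nat set \<Rightarrow> nat set set" where
  "orbits X = orbit \<sigma> ` X"

definition F :: "partition_pair set" where
  "F = {y \<in> Pi2 n. Pi2_act \<sigma> y = y}"

text \<open>For a fixed element each \<open>l B\<close> is a union of cycles, so its cycles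
  determine it. With lengths as weights, the condition \<open>card (l B) = card B\<close> becomes
  the size condition in \<open>labelled\<close>.\<close>

definition labels :: "partition_pair \<Rightarrow> (nat set \<times> nat set set) set" where
  "labels = (\<lambda>(\<pi>, \<rho>, l). (\<lambda>B. (B, orbits (l B))) ` \<pi>)"

lemma self_in_orbit: "i \<in> orbit \<sigma> i"
proof -
  have "permutation \<sigma>" using \<sigma> permutation_permutes by blast
  then show ?thesis by (rule permutation_self_in_orbit)
qed

lemma orbit_eq:
  assumes j: "j \<in> orbit \<sigma> i"
  shows "orbit \<sigma> j = orbit \<sigma> i"
proof (intro equalityI subsetI)
  have i: "i \<in> orbit \<sigma> j" by (rule orbit_swap[OF self_in_orbit j])
  fix k
  show "k \<in> orbit \<sigma> j \<Longrightarrow> k \<in> orbit \<sigma> i" by (rule orbit_trans[OF _ j])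
  show "k \<in> orbit \<sigma> i \<Longrightarrow> k \<in> orbit \<sigma> j" by (rule orbit_trans[OF _ i])
qed

lemma orbit_subset_invariant:
  assumes "\<sigma> ` X \<subseteq> X" "i \<in> X"
  shows "orbit \<sigma> i \<subseteq> X"
proof
  fix j assume "j \<in> orbit \<sigma> i"
  then show "j \<in> X" by induction (use assms in auto)
qed

lemma image_U: "\<sigma> ` U \<subseteq> U"
  by (rule equalityD1[OF permutes_image[OF \<sigma>]])

lemma orbit_subset_U: "i \<in> U \<Longrightarrow> orbit \<sigma> i \<subseteq> U"
  by (rule orbit_subset_invariant[OF image_U])

lemma Union_orbits:
  assumes "\<sigma> ` X \<subseteq> X"
  shows "\<Union>(orbits X) = X"
proof
  show "\<Union>(orbits X) \<subseteq> X"
    unfolding orbits_def by (intro UN_least orbit_subset_invariant assms)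
  show "X \<subseteq> \<Union>(orbits X)"
    unfolding orbits_def using self_in_orbit by (intro subsetI UN_I)
qed

lemma orbits_mem_eq:
  assumes "T \<in> orbits U" "i \<in> T"
  shows "T = orbit \<sigma> i"
proof -
  obtain j where "T = orbit \<sigma> j" using assms(1) unfolding orbits_def by (rule imageE)
  then show ?thesis using orbit_eq[of i j] assms(2) by simp
qed

lemma orbits_disjoint:
  assumes "S \<in> orbits U" "T \<in> orbits U" "i \<in> S" "i \<in> T"
  shows "S = T"
  using orbits_mem_eq[OF assms(1,3)] orbits_mem_eq[OF assms(2,4)] by simp

lemma orbits_mem:
  assumes "T \<in> orbits U"
  shows "T \<subseteq> U" "finite T" "T \<noteq> {}" "0 < card T"
proof -
  obtain i where i: "T = orbit \<sigma> i" "i \<in> U" using assms unfolding orbits_def by (rule imageE)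
  show "T \<subseteq> U" unfolding i(1) by (rule orbit_subset_U[OF i(2)])
  then show f: "finite T" by (rule finite_subset) simp
  show "T \<noteq> {}" using self_in_orbit[of i] i(1) by auto
  with f show "0 < card T" by (simp add: card_gt_0_iff)
qed

lemma orbits_Union:
  assumes S: "S \<subseteq> orbits U"
  shows "orbits (\<Union>S) = S"
proof (intro equalityI subsetI)
  fix T assume "T \<in> orbits (\<Union>S)"
  then obtain i where "T = orbit \<sigma> i" "i \<in> \<Union>S" unfolding orbits_def by (rule imageE)
  then obtain T' where T': "T' \<in> S" "i \<in> T'" "T = orbit \<sigma> i" by auto
  then have "T' = T" using orbits_mem_eq[of T' i] S by auto
  then show "T \<in> S" using T'(1) by simp
next
  fix T assume T: "T \<in> S"
  then have TU: "T \<in> orbits U" using S by auto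
  then obtain i where i: "i \<in> T" using orbits_mem(3) by blast
  have "T = orbit \<sigma> i" by (rule orbits_mem_eq[OF TU i])
  then show "T \<in> orbits (\<Union>S)" using i T unfolding orbits_def by auto
qed

lemma orbits_mono: "X \<subseteq> Y \<Longrightarrow> orbits X \<subseteq> orbits Y"
  by (auto simp: orbits_def)

lemma finite_orbits: "finite (orbits U)"
  by (simp add: orbits_def)

lemma card_Union_orbits:
  assumes "S \<subseteq> orbits U"
  shows "card (\<Union>S) = sum card S"
proof (rule card_Union_disjoint)
  show "pairwise disjnt S"
  proof (rule pairwiseI)
    fix T T' assume "T \<in> S" "T' \<in> S" "T \<noteq> T'"
    then show "disjnt T T'" using orbits_disjoint[of T T'] assms unfolding disjnt_def by blast
  qed
  show "\<And>T. T \<in> S \<Longrightarrow> finite T" using assms orbits_mem(2) by auto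
qed

lemma image_Union_orbits:
  assumes "S \<subseteq> orbits U"
  shows "\<sigma> ` \<Union>S = \<Union>S"
proof -
  have "\<sigma> ` T \<subseteq> T" if T: "T \<in> S" for T
  proof -
    have "T \<in> orbit \<sigma> ` U" using T assms unfolding orbits_def by (rule subsetD[rotated])
    then obtain i where "T = orbit \<sigma> i" by (rule imageE)
    then show ?thesis by (auto intro: orbit.step)
  qed
  then have sub: "\<sigma> ` \<Union>S \<subseteq> \<Union>S" by blast
  have "\<Union>S \<subseteq> U"
  proof (rule Union_least)
    show "T \<subseteq> U" if "T \<in> S" for T using that assms by (intro orbits_mem(1)) auto
  qed
  then have "finite (\<Union>S)" by (rule finite_subset) simp
  moreover have "card (\<sigma> ` \<Union>S) = card (\<Union>S)"
    using permutes_inj_on[OF \<sigma>] by (rule card_image)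
  ultimately show ?thesis using sub by (intro card_subset_eq)
qed

text \<open>The action does not move the blocks of \<open>\<pi>\<close>. So in a fixed triple every
  \<open>l B\<close> is invariant by itself; the blocks of \<open>\<rho>\<close> cannot be permuted
  among each other.\<close>

lemma FE:
  assumes "y \<in> F"
  obtains \<pi> \<rho> l where "y = (\<pi>, \<rho>, l)" "partition_on U \<pi>" "noncrossing \<pi>" "partition_on U \<rho>"
    "\<rho> = l ` \<pi>" "inj_on l \<pi>" "l \<in> extensional \<pi>" "\<And>B. B \<in> \<pi> \<Longrightarrow> card (l B) = card B"
    "\<And>B. B \<in> \<pi> \<Longrightarrow> l B \<subseteq> U" "\<And>B. B \<in> \<pi> \<Longrightarrow> l B \<noteq> {}" "\<And>B. B \<in> \<pi> \<Longrightarrow> \<Union>(orbits (l B)) = l B"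
proof -
  obtain \<pi> \<rho> l where y: "y = (\<pi>, \<rho>, l)" by (cases y)
  have P: "\<pi> \<in> nc_partitions n" "partition_on U \<rho>" "l \<in> extensional \<pi>" "bij_betw l \<pi> \<rho>"
    "\<And>B. B \<in> \<pi> \<Longrightarrow> card (l B) = card B" and act: "Pi2_act \<sigma> (\<pi>, \<rho>, l) = (\<pi>, \<rho>, l)"
    using assms by (auto simp: F_def y Pi2_def set_partitions_def)
  have \<rho>: "\<rho> = l ` \<pi>" "inj_on l \<pi>" using P(4) by (auto simp: bij_betw_def)
  have inv: "\<sigma> ` l B = l B" if "B \<in> \<pi>" for B
    using act that by (auto simp: fun_eq_iff restrict_def dest!: spec[of _ B])
  have U: "l B \<subseteq> U" "l B \<noteq> {}" if "B \<in> \<pi>" for B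
    using P(2) \<rho>(1) that partition_on_memD[OF P(2), of "l B"] partition_onD3[OF P(2)] by auto
  show ?thesis
    using nc_partitionsD[OF P(1)] inv Union_orbits
    by (intro that[OF y _ _ P(2) \<rho> P(3,5) U]) auto
qed

lemma labels_nc_labelled:
  assumes "y \<in> F"
  shows "labels y \<in> nc_labelled card U (orbits U)"
  using assms
proof (rule FE)
  fix \<pi> \<rho> l assume y: "y = (\<pi>, \<rho>, l)" and \<pi>: "partition_on U \<pi>" "noncrossing \<pi>"
    and \<rho>: "partition_on U \<rho>" "\<rho> = l ` \<pi>" "inj_on l \<pi>"
    and card: "\<And>B. B \<in> \<pi> \<Longrightarrow> card (l B) = card B" and lU: "\<And>B. B \<in> \<pi> \<Longrightarrow> l B \<subseteq> U"
    and ne: "\<And>B. B \<in> \<pi> \<Longrightarrow> l B \<noteq> {}" and un: "\<And>B. B \<in> \<pi> \<Longrightarrow> \<Union>(orbits (l B)) = l B"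
  have lab: "labels y = (\<lambda>B. (B, orbits (l B))) ` \<pi>" by (simp add: labels_def y)
  have fst: "fst ` labels y = \<pi>" by (simp add: lab image_image)
  have "labelled card U (orbits U) (labels y)"
    unfolding labelled_def
  proof (intro conjI ballI impI)
    fix p assume "p \<in> labels y"
    then obtain B where B: "B \<in> \<pi>" "p = (B, orbits (l B))" by (auto simp: lab)
    show "fst p \<noteq> {}" using B partition_onD3[OF \<pi>(1)] by auto
    show "snd p \<noteq> {}" using B ne by (auto simp: orbits_def)
    show "card (fst p) = sum card (snd p)"
      using card_Union_orbits[OF orbits_mono[OF lU[OF B(1)]]] un[OF B(1)] card[OF B(1)] B(2) by simp
    fix q assume "q \<in> labels y" and pq: "p \<noteq> q"
    then obtain C where C: "C \<in> \<pi>" "q = (C, orbits (l C))" by (auto simp: lab)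
    have BC: "B \<noteq> C" using pq B C by auto
    then show "fst p \<inter> fst q = {}" using B C \<pi>(1) by (auto simp: partition_on_def disjoint_def)
    have "l B \<noteq> l C" using BC \<rho>(3) B(1) C(1) by (auto simp: inj_on_def)
    then have d: "l B \<inter> l C = {}" using \<rho>(1,2) B(1) C(1) by (auto simp: partition_on_def disjoint_def)
    show "snd p \<inter> snd q = {}"
    proof (rule ccontr)
      assume "snd p \<inter> snd q \<noteq> {}"
      then obtain T where T: "T \<in> orbits (l B)" "T \<in> orbits (l C)" using B C by auto
      then have "T \<subseteq> l B" "T \<subseteq> l C"
        using Union_upper[of T "orbits (l B)"] Union_upper[of T "orbits (l C)"] un B(1) C(1) by simp_all
      moreover have "T \<noteq> {}" using T(1) self_in_orbit by (auto simp: orbits_def)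
      ultimately show False using d by blast
    qed
  next
    show "\<Union>(fst ` labels y) = U" using partition_onD1[OF \<pi>(1)] fst by simp
    have "\<Union>(snd ` labels y) = orbits (\<Union>(l ` \<pi>))" by (auto simp: lab orbits_def)
    then show "\<Union>(snd ` labels y) = orbits U" using partition_onD1[OF \<rho>(1)] \<rho>(2) by simp
  qed
  then show ?thesis using fst \<pi>(2) by (simp add: nc_labelled_def)
qed

text \<open>The order makes \<open>l' B\<close> the union of the values of \<open>l\<close> on the
  blocks inside \<open>B\<close>. As the values on either side partition \<open>U\<close>, this
  amounts to \<open>l A \<subseteq> l' B\<close> for the block \<open>B\<close> around
  \<open>A\<close>, that is, to inclusion of the labels.\<close>

lemma Pi2_le_iff_finer:
  assumes x: "x \<in> F" and y: "y \<in> F"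
  shows "Pi2_le n x y \<longleftrightarrow> finer (labels y) (labels x)"
  using x
proof (rule FE)
  fix \<pi>' \<rho>' l' assume xx: "x = (\<pi>', \<rho>', l')" and \<pi>': "partition_on U \<pi>'"
    and \<rho>': "partition_on U \<rho>'" "\<rho>' = l' ` \<pi>'" "inj_on l' \<pi>'"
    and un': "\<And>B. B \<in> \<pi>' \<Longrightarrow> \<Union>(orbits (l' B)) = l' B" and lU': "\<And>B. B \<in> \<pi>' \<Longrightarrow> l' B \<subseteq> U"
  show ?thesis
    using y
  proof (rule FE)
    fix \<pi> \<rho> l assume yy: "y = (\<pi>, \<rho>, l)" and \<pi>: "partition_on U \<pi>"
      and \<rho>: "partition_on U \<rho>" "\<rho> = l ` \<pi>" "inj_on l \<pi>"
      and un: "\<And>B. B \<in> \<pi> \<Longrightarrow> \<Union>(orbits (l B)) = l B"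
    have sub: "orbits (l A) \<subseteq> orbits (l' B) \<longleftrightarrow> l A \<subseteq> l' B" if "A \<in> \<pi>" "B \<in> \<pi>'" for A B
    proof
      assume "orbits (l A) \<subseteq> orbits (l' B)"
      then have "\<Union>(orbits (l A)) \<subseteq> \<Union>(orbits (l' B))" by (rule Union_mono)
      then show "l A \<subseteq> l' B" by (simp only: un[OF that(1)] un'[OF that(2)])
    qed (rule orbits_mono)
    have fin: "finer (labels y) (labels x) \<longleftrightarrow> (\<forall>A\<in>\<pi>. \<exists>B\<in>\<pi>'. A \<subseteq> B \<and> l A \<subseteq> l' B)"
    proof -
      have "finer (labels y) (labels x) \<longleftrightarrow> (\<forall>A\<in>\<pi>. \<exists>B\<in>\<pi>'. A \<subseteq> B \<and> orbits (l A) \<subseteq> orbits (l' B))"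
        by (simp add: finer_def labels_def xx yy)
      then show ?thesis using sub by (simp cong: ball_cong bex_cong conj_cong)
    qed
    show ?thesis
      unfolding fin
    proof
      assume le: "Pi2_le n x y"
      then have r: "refines U \<pi> \<pi>'" and
        ll: "\<And>S. S \<subseteq> \<pi> \<Longrightarrow> \<Union>S \<in> \<pi>' \<Longrightarrow> l' (\<Union>S) = \<Union>(l ` S)" by (auto simp: xx yy)
      show "\<forall>A\<in>\<pi>. \<exists>B\<in>\<pi>'. A \<subseteq> B \<and> l A \<subseteq> l' B"
      proof
        fix A assume A: "A \<in> \<pi>"
        then obtain B where B: "B \<in> \<pi>'" "A \<subseteq> B" using r unfolding refines_def by blast
        let ?S = "{C \<in> \<pi>. C \<subseteq> B}"
        have "\<Union>?S = B" by (rule Union_blocks_subset[OF r B(1)])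
        then have "l' B = \<Union>(l ` ?S)" using ll[of ?S] B(1) by simp
        then have "l A \<subseteq> l' B" using A B(2) by blast
        then show "\<exists>B\<in>\<pi>'. A \<subseteq> B \<and> l A \<subseteq> l' B" using B by blast
      qed
    next
      assume sub: "\<forall>A\<in>\<pi>. \<exists>B\<in>\<pi>'. A \<subseteq> B \<and> l A \<subseteq> l' B"
      have "refines U \<pi> \<pi>'" using \<pi> \<pi>' sub unfolding refines_def by blast
      moreover have "refines U \<rho> \<rho>'" using \<rho> \<rho>' sub unfolding refines_def by blast
      moreover have "l' (\<Union>S) = \<Union>(l ` S)" if S: "S \<subseteq> \<pi>" "\<Union>S \<in> \<pi>'" for S
      proof
        show "\<Union>(l ` S) \<subseteq> l' (\<Union>S)"
        proof (rule UN_least)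
          fix A assume A: "A \<in> S"
          then obtain B where B: "B \<in> \<pi>'" "A \<subseteq> B" "l A \<subseteq> l' B" using sub S(1) by blast
          have "A \<noteq> {}" using partition_onD3[OF \<pi>] A S(1) by auto
          then obtain i where "i \<in> A" by auto
          then have "B = \<Union>S" using partition_on_block_eq[OF \<pi>' B(1) S(2), of i] A B(2) by auto
          then show "l A \<subseteq> l' (\<Union>S)" using B(3) by simp
        qed
        show "l' (\<Union>S) \<subseteq> \<Union>(l ` S)"
        proof
          fix i assume i: "i \<in> l' (\<Union>S)"
          then have "i \<in> U" using lU'[OF S(2)] by auto
          then obtain R where "R \<in> \<rho>" "i \<in> R" by (rule partition_on_blockE[OF \<rho>(1)])
          then obtain A where A: "A \<in> \<pi>" "i \<in> l A" using \<rho>(2) by auto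
          then obtain B where B: "B \<in> \<pi>'" "A \<subseteq> B" "l A \<subseteq> l' B" using sub by blast
          have "l' B = l' (\<Union>S)"
            using partition_on_block_eq[OF \<rho>'(1), of "l' B" "l' (\<Union>S)" i] B A(2) S(2) i \<rho>'(2) by blast
          then have "B = \<Union>S" using \<rho>'(3) B(1) S(2) by (auto simp: inj_on_def)
          moreover have "A \<noteq> {}" using partition_onD3[OF \<pi>] A(1) by auto
          ultimately obtain j C where j: "j \<in> A" "C \<in> S" "j \<in> C" using B(2) by blast
          then have "A = C" using partition_on_block_eq[OF \<pi> A(1), of C j] S(1) by blast
          then show "i \<in> \<Union>(l ` S)" using A(2) j(2) by blast
        qed
      qed
      ultimately show "Pi2_le n x y" by (simp add: xx yy)
    qed
  qed
qed

lemma labels_inj: "inj_on labels F"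
proof (rule inj_onI)
  fix x y assume x: "x \<in> F" and y: "y \<in> F" and eq: "labels x = labels y"
  show "x = y"
    using x
  proof (rule FE)
    fix \<pi>' \<rho>' l' assume xx: "x = (\<pi>', \<rho>', l')" "\<rho>' = l' ` \<pi>'" "l' \<in> extensional \<pi>'"
      and un': "\<And>B. B \<in> \<pi>' \<Longrightarrow> \<Union>(orbits (l' B)) = l' B"
    show ?thesis
      using y
    proof (rule FE)
      fix \<pi> \<rho> l assume yy: "y = (\<pi>, \<rho>, l)" "\<rho> = l ` \<pi>" "l \<in> extensional \<pi>"
        and un: "\<And>B. B \<in> \<pi> \<Longrightarrow> \<Union>(orbits (l B)) = l B"
      have lx: "labels x = (\<lambda>B. (B, orbits (l' B))) ` \<pi>'" and ly: "labels y = (\<lambda>B. (B, orbits (l B))) ` \<pi>"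
        by (simp_all add: labels_def xx yy)
      have "fst ` labels x = \<pi>'" "fst ` labels y = \<pi>" by (simp_all add: lx ly image_image)
      then have \<pi>: "\<pi>' = \<pi>" using eq by simp
      have orb: "orbits (l' B) = orbits (l B)" if "B \<in> \<pi>" for B
      proof -
        have "(B, orbits (l' B)) \<in> labels y" using that eq \<pi> by (auto simp: lx)
        then show ?thesis by (auto simp: ly)
      qed
      have ll: "l' B = l B" if B: "B \<in> \<pi>" for B
      proof -
        have "B \<in> \<pi>'" using B \<pi> by simp
        then have "l' B = \<Union>(orbits (l' B))" by (rule un'[symmetric])
        also have "\<dots> = \<Union>(orbits (l B))" by (rule arg_cong[OF orb[OF B]])
        also have "\<dots> = l B" by (rule un[OF B])
        finally show ?thesis .
      qed
      have "l' \<in> extensional \<pi>" using xx(3) \<pi> by simp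
      from extensionalityI[OF this yy(3) ll] have "l' = l" .
      then show ?thesis using xx yy \<pi> by simp
    qed
  qed
qed

lemma labels_surj:
  assumes "E \<in> nc_labelled card U (orbits U)"
  shows "E \<in> labels ` F"
proof -
  have E: "labelled card U (orbits U) E" and nc: "noncrossing (fst ` E)"
    using assms by (auto simp: nc_labelled_def)
  define sel where "sel = (\<lambda>B. THE S. (B, S) \<in> E)"
  have sel: "sel B = S" if "(B, S) \<in> E" for B S
    unfolding sel_def
  proof (rule the_equality)
    fix S' assume "(B, S') \<in> E"
    then show "S' = S"
      using labelled_disjoint[OF E that, of "(B, S')"] labelled_memD(1)[OF E that] by auto
  qed (rule that)
  define \<pi> where "\<pi> = fst ` E"
  define l where "l = (\<lambda>B\<in>\<pi>. \<Union>(sel B))"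
  have BE: "(B, sel B) \<in> E" if "B \<in> \<pi>" for B using that sel by (auto simp: \<pi>_def)
  have selZ: "sel B \<subseteq> orbits U" "sel B \<noteq> {}" "card B = sum card (sel B)" "B \<noteq> {}" if "B \<in> \<pi>" for B
    using labelled_memD[OF E BE[OF that]] by auto
  have lB: "l B = \<Union>(sel B)" if "B \<in> \<pi>" for B using that by (simp add: l_def)
  have orbl: "orbits (l B) = sel B" if "B \<in> \<pi>" for B using orbits_Union[OF selZ(1)[OF that]] lB[OF that] by simp
  have disj: "sel A \<inter> sel B = {} \<and> A \<inter> B = {}" if "A \<in> \<pi>" "B \<in> \<pi>" "A \<noteq> B" for A B
    using labelled_disjoint[OF E BE[OF that(1)] BE[OF that(2)]] that(3) by auto
  have ldisj: "l A \<inter> l B = {}" if AB: "A \<in> \<pi>" "B \<in> \<pi>" "A \<noteq> B" for A B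
  proof (rule ccontr)
    assume "l A \<inter> l B \<noteq> {}"
    then obtain i where "i \<in> \<Union>(sel A)" "i \<in> \<Union>(sel B)" using lB[OF AB(1)] lB[OF AB(2)] by auto
    then obtain S T where ST: "S \<in> sel A" "T \<in> sel B" "i \<in> S" "i \<in> T" by auto
    have "S \<in> orbits U" "T \<in> orbits U" using ST(1,2) selZ(1)[OF AB(1)] selZ(1)[OF AB(2)] by auto
    then have "S = T" using ST(3,4) by (rule orbits_disjoint)
    then show False using disj[OF AB] ST(1,2) by auto
  qed
  have lne: "l B \<noteq> {}" if B: "B \<in> \<pi>" for B
  proof -
    obtain T where T: "T \<in> sel B" using selZ(2)[OF B] by auto
    then have "T \<noteq> {}" using orbits_mem(3)[of T] selZ(1)[OF B] by auto
    then show ?thesis using T lB[OF B] by auto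
  qed
  have p\<pi>: "partition_on U \<pi>"
  proof (rule partition_onI)
    show "\<Union>\<pi> = U" using E by (simp add: \<pi>_def labelled_def)
    show "{} \<notin> \<pi>" using selZ(4) by auto
    show "disjnt A B" if "A \<in> \<pi>" "B \<in> \<pi>" "A \<noteq> B" for A B using disj[OF that] by (simp add: disjnt_def)
  qed
  have p\<rho>: "partition_on U (l ` \<pi>)"
  proof (rule partition_onI)
    have "\<Union>(l ` \<pi>) = (\<Union>B\<in>\<pi>. \<Union>(sel B))" using lB by simp
    also have "\<dots> = \<Union>(\<Union>(snd ` E))"
    proof -
      have "snd ` E = sel ` \<pi>" using sel by (force simp: \<pi>_def image_image)
      then show ?thesis by auto
    qed
    also have "\<dots> = \<Union>(orbits U)" using E by (simp add: labelled_def)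
    also have "\<dots> = U" by (rule Union_orbits[OF image_U])
    finally show "\<Union>(l ` \<pi>) = U" .
    show "{} \<notin> l ` \<pi>" using lne by auto
    show "disjnt A B" if "A \<in> l ` \<pi>" "B \<in> l ` \<pi>" "A \<noteq> B" for A B
      using that ldisj by (auto simp: disjnt_def)
  qed
  have inj: "inj_on l \<pi>"
  proof (rule inj_onI, rule ccontr)
    fix A B assume "A \<in> \<pi>" "B \<in> \<pi>" "l A = l B" "A \<noteq> B"
    then show False using ldisj[of A B] lne[of A] by simp
  qed
  have "card (l B) = card B" if "B \<in> \<pi>" for B
    using card_Union_orbits[OF selZ(1)[OF that]] selZ(3)[OF that] lB[OF that] by simp
  then have y: "(\<pi>, l ` \<pi>, l) \<in> Pi2 n"
    using p\<pi> p\<rho> nc inj by (simp add: Pi2_def nc_partitions_def set_partitions_def \<pi>_def bij_betw_def l_def)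
  have inv: "\<sigma> ` l B = l B" if "B \<in> \<pi>" for B using image_Union_orbits[OF selZ(1)[OF that]] lB[OF that] by simp
  then have "(`) \<sigma> ` l ` \<pi> = l ` \<pi>" by (simp add: image_image)
  moreover have "(\<lambda>B\<in>\<pi>. \<sigma> ` l B) = l" using inv by (auto simp: l_def fun_eq_iff)
  ultimately have "(\<pi>, l ` \<pi>, l) \<in> F" using y by (simp add: F_def)
  moreover have "labels (\<pi>, l ` \<pi>, l) = E"
  proof -
    have "labels (\<pi>, l ` \<pi>, l) = (\<lambda>B. (B, sel B)) ` \<pi>" using orbl by (simp add: labels_def)
    also have "\<dots> = E" using BE sel by (force simp: \<pi>_def)
    finally show ?thesis .
  qed
  ultimately show ?thesis by force
qed

lemma labels_bij: "bij_betw labels F (nc_labelled card U (orbits U))"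
  using labels_inj labels_nc_labelled labels_surj by (auto simp: bij_betw_def)

lemma finer_refl: "finer D D"
  by (auto simp: finer_def)

lemma finer_trans: "finer C D \<Longrightarrow> finer D E \<Longrightarrow> finer C E"
  unfolding finer_def by (meson subset_trans)

lemma Pi2_less_trans:
  assumes "x \<in> F" "y \<in> F" "z \<in> F" "Pi2_less n x y" "Pi2_less n y z"
  shows "Pi2_less n x z"
proof -
  have f: "finer (labels y) (labels x)" "finer (labels z) (labels y)" "x \<noteq> y"
    using assms Pi2_le_iff_finer by (auto simp: Pi2_less_def)
  then have "finer (labels z) (labels x)" using finer_trans by blast
  moreover have "x \<noteq> z"
  proof
    assume "x = z"
    then have "labels x = labels y"
      using f finer_antisym[of card U "orbits U" "labels x" "labels y"] labels_nc_labelled assms(1,2)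
      by (auto simp: nc_labelled_def)
    then show False using labels_inj assms(1,2) f(3) by (auto simp: inj_on_def)
  qed
  ultimately show ?thesis using assms Pi2_le_iff_finer by (simp add: Pi2_less_def)
qed

text \<open>This is \<open>sum_finer\<close> carried over along the bijection \<open>labels\<close>;
  it supplies the hypothesis of \<open>alternating_chain_sum\<close>.\<close>

lemma sum_above:
  assumes x: "x \<in> F"
  shows "(\<Sum>y\<in>{y \<in> F. y = x \<or> Pi2_less n x y}. label_weight card (labels y)) = 1"
proof -
  let ?N = "nc_labelled card U (orbits U)"
  have "Pi2_le n x x" using Pi2_le_iff_finer[OF x x] finer_refl by simp
  then have set: "{y \<in> F. y = x \<or> Pi2_less n x y} = {y \<in> F. finer (labels y) (labels x)}"
    using Pi2_le_iff_finer[OF x] x by (auto simp: Pi2_less_def)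
  have "bij_betw labels {y \<in> F. finer (labels y) (labels x)} {E \<in> ?N. finer E (labels x)}"
  proof (rule bij_betw_subset[OF labels_bij])
    have "labels ` {y \<in> F. finer (labels y) (labels x)} = {E \<in> labels ` F. finer E (labels x)}" by blast
    then show "labels ` {y \<in> F. finer (labels y) (labels x)} = {E \<in> ?N. finer E (labels x)}"
      by (simp only: bij_betw_imp_surj_on[OF labels_bij])
  qed simp
  from sum.reindex_bij_betw[OF this, of "label_weight card"]
  have "(\<Sum>y\<in>{y \<in> F. y = x \<or> Pi2_less n x y}. label_weight card (labels y)) =
      (\<Sum>E\<in>{E \<in> ?N. finer E (labels x)}. label_weight card E)" by (simp only: set)
  also have "\<dots> = 1"
    by (rule sum_finer) (use labels_nc_labelled[OF x] finite_orbits orbits_mem(4) in auto)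
  finally show ?thesis .
qed

lemma Pi2_min_F: "Pi2_min n \<in> F"
proof -
  have "partition_on U {U}" using n by (intro partition_on_space) auto
  then have "{U} \<in> nc_partitions n"
    by (auto simp: nc_partitions_def set_partitions_def noncrossing_def)
  then have "Pi2_min n \<in> Pi2 n" unfolding Pi2_min_eq by (intro perm_pair_in_Pi2 permutes_id)
  moreover have "Pi2_act \<sigma> (Pi2_min n) = Pi2_min n"
    unfolding Pi2_min_eq Pi2_act_perm_pair
    by (rule perm_pair_cong) (use permutes_image[OF \<sigma>] in auto)
  ultimately show ?thesis by (simp add: F_def)
qed

lemma labels_Pi2_min: "labels (Pi2_min n) = {(U, orbits U)}"
  by (simp add: labels_def Pi2_min_def)

lemma sum_orbits: "sum card (orbits U) = n"
proof -
  have "\<Union>(orbits U) = U" by (rule Union_orbits[OF image_U])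
  then show ?thesis using card_Union_orbits[of "orbits U"] by simp
qed

text \<open>Removing the minimum is thus the same as passing to the chains above it, and these are
  evaluated at a single element.\<close>

lemma above_Pi2_min: "{y \<in> F. Pi2_less n (Pi2_min n) y} = {y \<in> Pi2_bar n. Pi2_act \<sigma> y = y}"
proof -
  have "Pi2_le n (Pi2_min n) y" if y: "y \<in> F" for y
  proof -
    have lab: "labelled card U (orbits U) (labels y)"
      using labels_nc_labelled[OF y] by (simp add: nc_labelled_def)
    have "finer (labels y) (labels (Pi2_min n))"
      unfolding finer_def labels_Pi2_min using labelled_memD(4,5)[OF lab] by simp
    then show ?thesis by (simp only: Pi2_le_iff_finer[OF Pi2_min_F y])
  qed
  then show ?thesis by (auto simp: F_def Pi2_less_def Pi2_bar_def)
qed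

lemma fixed_chain_sum:
  "(\<Sum>k\<le>n - 1. (- 1) ^ k * int (card {xs \<in> strict_chains (Pi2_bar n) (Pi2_less n) k. List.map (Pi2_act \<sigma>) xs = xs}))
    = (1 - int n) ^ (card (orbits U) - 1)"
proof -
  let ?A = "\<lambda>k. {xs \<in> strict_chains (Pi2_bar n) (Pi2_less n) k. List.map (Pi2_act \<sigma>) xs = xs}"
  let ?C = "{xs. set xs \<subseteq> {y \<in> F. Pi2_less n (Pi2_min n) y} \<and> sorted_wrt (Pi2_less n) xs}"
  have C: "?C = (\<Union>k\<le>n - 1. ?A k)"
  proof
    show "?C \<subseteq> (\<Union>k\<le>n - 1. ?A k)"
    proof
      fix xs assume "xs \<in> ?C"
      then have xs: "set xs \<subseteq> {y \<in> Pi2_bar n. Pi2_act \<sigma> y = y}" "sorted_wrt (Pi2_less n) xs"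
        by (auto simp: above_Pi2_min)
      \<comment> \<open>A longer chain would contain one of \<open>n\<close> elements. So summing
        over \<open>k\<close> up to \<open>n - 1\<close> reaches every fixed chain.\<close>
      have "length xs \<le> n - 1"
      proof (rule ccontr)
        assume "\<not> ?thesis"
        then have "take n xs \<in> strict_chains (Pi2_bar n) (Pi2_less n) n"
          using xs by (auto simp: strict_chains_def sorted_wrt_take dest: in_set_takeD)
        then show False using strict_chains_Pi2_bar_top[OF n] by simp
      qed
      moreover have "List.map (Pi2_act \<sigma>) xs = xs" using xs(1) by (intro map_idI) auto
      ultimately show "xs \<in> (\<Union>k\<le>n - 1. ?A k)" using xs by (auto simp: strict_chains_def)
    qed
    show "(\<Union>k\<le>n - 1. ?A k) \<subseteq> ?C"
    proof
      fix xs assume "xs \<in> (\<Union>k\<le>n - 1. ?A k)"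
      then have xs: "set xs \<subseteq> Pi2_bar n" "sorted_wrt (Pi2_less n) xs" "List.map (Pi2_act \<sigma>) xs = xs"
        by (auto simp: strict_chains_def)
      have "Pi2_act \<sigma> x = x" if "x \<in> set xs" for x
        using that xs(3) map_eq_conv[of "Pi2_act \<sigma>" xs id] by simp
      then show "xs \<in> ?C" using xs by (auto simp: above_Pi2_min)
    qed
  qed
  have finA: "finite (?A k)" for k using finite_strict_chains[OF finite_Pi2_bar] by simp
  have "(\<Sum>xs\<in>?C. (- 1) ^ length xs) = (\<Sum>k\<le>n - 1. \<Sum>xs\<in>?A k. (- 1 :: int) ^ length xs)"
    unfolding C using finA by (intro sum.UNION_disjoint) (auto simp: strict_chains_def)
  also have "\<dots> = (\<Sum>k\<le>n - 1. (- 1) ^ k * int (card (?A k)))"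
  proof (rule sum.cong[OF refl])
    fix k
    have "(\<Sum>xs\<in>?A k. (- 1 :: int) ^ length xs) = (\<Sum>xs\<in>?A k. (- 1) ^ k)"
      by (rule sum.cong) (auto simp: strict_chains_def)
    then show "(\<Sum>xs\<in>?A k. (- 1 :: int) ^ length xs) = (- 1) ^ k * int (card (?A k))" by simp
  qed
  finally have "(\<Sum>k\<le>n - 1. (- 1) ^ k * int (card (?A k))) = (\<Sum>xs\<in>?C. (- 1) ^ length xs)" by simp
  also have "\<dots> = label_weight card (labels (Pi2_min n))"
  proof (rule alternating_chain_sum[where P = F and lt = "Pi2_less n" and \<Phi> = "\<lambda>y. label_weight card (labels y)"])
    show "finite F" using finite_Pi2 by (simp add: F_def)
    show "\<not> Pi2_less n x x" for x by (simp add: Pi2_less_def)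
  qed (fact Pi2_less_trans sum_above Pi2_min_F)+
  also have "\<dots> = (1 - int n) ^ (card (orbits U) - 1)"
  proof -
    have "label_weight card {(U, orbits U)} = (1 - int (sum card (orbits U))) ^ (card (orbits U) - 1)"
      unfolding label_weight_def by simp
    then show ?thesis by (simp only: labels_Pi2_min sum_orbits)
  qed
  finally show ?thesis .
qed

lemma num_cycles_eq: "num_cycles n \<sigma> = card (orbits U)"
  by (simp add: num_cycles_def orbits_def)

lemma num_cycles_bounds: "1 \<le> num_cycles n \<sigma>" "num_cycles n \<sigma> \<le> n"
proof -
  have "U \<noteq> {}" using n by auto
  then have "orbits U \<noteq> {}" by (simp only: orbits_def image_is_empty not_False_eq_True)
  then have "0 < card (orbits U)" using finite_orbits by (simp add: card_gt_0_iff)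
  then show "1 \<le> num_cycles n \<sigma>" by (simp add: num_cycles_eq)
  have "card (orbits U) \<le> card U" unfolding orbits_def by (rule card_image_le) simp
  then show "num_cycles n \<sigma> \<le> n" by (simp add: num_cycles_eq)
qed

end

text \<open>What remains is the sign: the trace formula contributes \<open>(- 1) ^ (n - 1)\<close>
  and the passage from \<open>1 - n\<close> to \<open>n - 1\<close> contributes
  \<open>(- 1) ^ (z - 1)\<close>, with \<open>z\<close> the number of cycles; together they give
  \<open>(- 1) ^ (n - z)\<close>.\<close>

theorem theorem57:
  fixes n :: nat and \<sigma> :: "nat \<Rightarrow> nat"
  assumes "1 \<le> n"
    and "\<sigma> permutes {1..n}"
  shows "(Pi2_character n (int n - 2) \<sigma> :: 'k::field_char_0) =
    (- 1) ^ (n - num_cycles n \<sigma>) * (of_nat n - 1) ^ (num_cycles n \<sigma> - 1)"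
proof -
  interpret fixed_points n \<sigma> using assms by unfold_locales
  let ?z = "num_cycles n \<sigma>"
  let ?c = "\<lambda>k. card {xs \<in> strict_chains (Pi2_bar n) (Pi2_less n) k. List.map (Pi2_act \<sigma>) xs = xs}"
  have "(Pi2_character n (int n - 2) \<sigma> :: 'k) = (\<Sum>k\<le>n - 1. (- 1) ^ (n - 1 - k) * of_nat (?c k))"
    by (rule Pi2_character_eq[OF assms])
  also have "\<dots> = (\<Sum>k\<le>n - 1. (- 1) ^ (n - 1) * ((- 1) ^ k * of_nat (?c k)))"
  proof (rule sum.cong[OF refl])
    fix k assume "k \<in> {..n - 1}"
    then have "n - 1 = (n - 1 - k) + k" by simp
    then have "(- 1 :: 'k) ^ (n - 1) = (- 1) ^ ((n - 1 - k) + k)" by (rule arg_cong)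
    then have "(- 1 :: 'k) ^ (n - 1) = (- 1) ^ (n - 1 - k) * (- 1) ^ k" by (simp only: power_add)
    moreover have "(- 1 :: 'k) ^ k * (- 1) ^ k = 1" by (simp flip: power_mult_distrib)
    ultimately show "(- 1) ^ (n - 1 - k) * of_nat (?c k) = (- 1 :: 'k) ^ (n - 1) * ((- 1) ^ k * of_nat (?c k))"
      by (simp add: mult.assoc flip: mult.assoc[of "(- 1) ^ k" "(- 1) ^ k"])
  qed
  also have "\<dots> = (- 1) ^ (n - 1) * of_int (\<Sum>k\<le>n - 1. (- 1) ^ k * int (?c k))"
    by (simp add: sum_distrib_left)
  also have "\<dots> = (- 1) ^ (n - 1) * (1 - of_nat n) ^ (?z - 1)"
    unfolding fixed_chain_sum num_cycles_eq by (simp only: of_int_power of_int_diff of_int_1 of_int_of_nat_eq)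
  also have "(1 - of_nat n :: 'k) ^ (?z - 1) = (- 1) ^ (?z - 1) * (of_nat n - 1) ^ (?z - 1)"
    by (simp flip: power_mult_distrib)
  also have "(- 1) ^ (n - 1) * ((- 1) ^ (?z - 1) * (of_nat n - 1 :: 'k) ^ (?z - 1)) =
      (- 1) ^ (n - ?z) * (of_nat n - 1) ^ (?z - 1)"
  proof -
    \<comment> \<open>Natural subtraction is exact here because the number of cycles lies between
      \<open>1\<close> and \<open>n\<close>.\<close>
    have "n - 1 = (n - ?z) + (?z - 1)" using num_cycles_bounds by simp
    then have "(- 1 :: 'k) ^ (n - 1) = (- 1) ^ (n - ?z) * (- 1) ^ (?z - 1)" by (simp only: power_add[symmetric])
    moreover have "(- 1 :: 'k) ^ (?z - 1) * (- 1) ^ (?z - 1) = 1" by (simp flip: power_mult_distrib)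
    ultimately show ?thesis by (simp add: mult.assoc flip: mult.assoc[of "(- 1) ^ (?z - 1)" "(- 1) ^ (?z - 1)"])
  qed
  finally show ?thesis .
qed

end
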